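(* Let $\beta>0$, let $W$ be the space-time white noise on $\mathbb R_+^2$, and let $u$ be the mild solution of $$\partial_tu(z,t)=z\,\partial_z^2u(z,t)+\hat z^{\beta}u(z,t)\dot W(z,t)\quad(z,t>0),\qquad u(z,0)=1\ (z>0),\qquad u(0,t)=0\ (t>0),$$ where $\hat z=\min\{z,1\}$. Let $u_0(z,t)=1-e^{-z/t}$ for $z,t>0$ and $u_0(z,0)=1$. Then there exists $T\in(0,1)$ such that for every $t\in[0,T]$ there exists $C_{t,\beta}>0$ with $$\sup_{z>0}\mathbb E\left[\left(\frac{u(z,t)}{u_0(z,t)}\right)^2\right]<C_{t,\beta}.$$ Furthermore, for every fixed $z>0$, $$\lim_{t\searrow0}\mathbb E\left[\left(\frac{u(z,t)}{u_0(z,t)}-1\right)^2\right]=0.$$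
   Context: $\mathbb{R}_+=(0,\infty)$. For $z,w,t>0$, $$q_0(z,w,t)=\sqrt{\tfrac{z}{w}}\,\frac{e^{-(z+w)/t}}{t}\,I_1\!\Big(\frac{2\sqrt{zw}}{t}\Big),$$ where $I_1$ is the modified Bessel function of the first kind of order $1$; one has $u_0(z,t)=\int_0^\infty q_0(z,w,t)\,dw$. Noise: $H=L^2(\mathbb{R}_+^2)$, and $W=\{W(h)\mid h\in H\}$ is an isonormal Gaussian process over $H$ on $(\Omega,\mathcal F,\mathbb P)$ with $\mathcal F$ generated by $W$ (space-time white noise). $\mathcal I_n$ denotes the $n$-fold multiple Wiener (Skorohod) integral on $H^{\otimes n}$, with $\mathcal I_n(g)=\mathcal I_n(\tilde g)$ and $\mathbb E[\mathcal I_n(g)^2]=n!\|\tilde g\|^2_{H^{\otimes n}}$, $\tilde g$ being the symmetrization of $g$ in its $n$ pairs of variables. Mild solution $u$: the (unique up to modification) square-integrable random field with $u(z,0)=1$, $u(0,t)=0$ and, for $z,t>0$, a.s. $$u(z,t)=u_0(z,t)+\int_0^t\!\int_0^\infty q_0(z,w,t-\tau)\,\hat w^{\beta}u(w,\tau)\,W(dw,d\tau)$$ (Skorohod integral). It is given by the $L^2(\Omega)$-convergent series $u(z,t)=\sum_{n\ge0}\mathcal I_n(f_n(\cdot;z,t))$, where $f_0(z,t)=u_0(z,t)$ and, for $n\ge1$, $$f_n(z_1,t_1,\dots,z_n,t_n;z,t)=\mathbf 1_{(0,t)}(t_n)\,q_0(z,z_n,t-t_n)\,\hat z_n^{\beta}\,f_{n-1}(z_1,t_1,\dots,z_{n-1},t_{n-1};z_n,t_n).$$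 *)

theory Defs
  imports "HOL-Probability.Probability"
begin

section \<open>Kernel and deterministic solution\<close>

definition bessel_I :: "nat \<Rightarrow> real \<Rightarrow> real" where
  "bessel_I n x = (\<Sum>k. (x / 2) ^ (2 * k + n) / (fact k * fact (k + n)))"

definition q0 :: "real \<Rightarrow> real \<Rightarrow> real \<Rightarrow> real" where
  "q0 z w t = sqrt (z / w) * (exp (- (z + w) / t) / t) * bessel_I 1 (2 * sqrt (z * w) / t)"

definition u0 :: "real \<Rightarrow> real \<Rightarrow> real" where
  "u0 z t = (if t = 0 then 1 else 1 - exp (- z / t))"

section \<open>Space-time white noise\<close>

text \<open>A point of the open quadrant is a pair (space, time).\<close>

definition quadrant :: "(real \<times> real) measure" where
  "quadrant = restrict_space lborel ({0<..} \<times> {0<..})"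

text \<open>Elements of $H = L^2$ are represented by functions; functions that agree almost
  everywhere represent the same element. The covariance condition in
  \<open>isonormal\<close> forces the noise to be almost surely equal on them.\<close>

definition L2_space :: "'a measure \<Rightarrow> ('a \<Rightarrow> real) set" where
  "L2_space N = {h. h \<in> borel_measurable N \<and> integrable N (\<lambda>x. (h x)\<^sup>2)}"

abbreviation H_space :: "(real \<times> real \<Rightarrow> real) set" where
  "H_space \<equiv> L2_space quadrant"

definition H_inner :: "(real \<times> real \<Rightarrow> real) \<Rightarrow> (real \<times> real \<Rightarrow> real) \<Rightarrow> real" where
  "H_inner g h = (LINT x|quadrant. g x * h x)"

text \<open>The degenerate law at 0 counts as Gaussian.\<close>

definition centered_gaussian :: "'w measure \<Rightarrow> ('w \<Rightarrow> real) \<Rightarrow> bool" where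
  "centered_gaussian M X \<longleftrightarrow>
     X \<in> borel_measurable M \<and>
     ((AE \<omega> in M. X \<omega> = 0) \<or>
      (\<exists>\<sigma>>0. distributed M lborel X (\<lambda>x. ennreal (normal_density 0 \<sigma> x))))"

definition isonormal :: "'w measure \<Rightarrow> ((real \<times> real \<Rightarrow> real) \<Rightarrow> 'w \<Rightarrow> real) \<Rightarrow> bool" where
  "isonormal M W \<longleftrightarrow>
     (\<forall>(n::nat) (h :: nat \<Rightarrow> real \<times> real \<Rightarrow> real) (a :: nat \<Rightarrow> real).
        (\<forall>i<n. h i \<in> H_space) \<longrightarrow>
        centered_gaussian M (\<lambda>\<omega>. \<Sum>i<n. a i * W (h i) \<omega>)) \<and>
     (\<forall>g\<in>H_space. \<forall>h\<in>H_space. (LINT \<omega>|M. W g \<omega> * W h \<omega>) = H_inner g h)"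

text \<open>The sigma-algebra is the one generated by the noise, up to null sets: it may or may not
  be completed.\<close>

definition generated_by_noise ::
  "'w measure \<Rightarrow> ((real \<times> real \<Rightarrow> real) \<Rightarrow> 'w \<Rightarrow> real) \<Rightarrow> bool" where
  "generated_by_noise M W \<longleftrightarrow>
     (\<forall>A\<in>sets M.
        \<exists>B\<in>sigma_sets (space M) {W h -` S \<inter> space M | h S. h \<in> H_space \<and> S \<in> sets borel}.
          AE \<omega> in M. \<omega> \<in> A \<longleftrightarrow> \<omega> \<in> B)"

definition space_time_white_noise ::
  "'w measure \<Rightarrow> ((real \<times> real \<Rightarrow> real) \<Rightarrow> 'w \<Rightarrow> real) \<Rightarrow> bool" where
  "space_time_white_noise M W \<longleftrightarrow>
     prob_space M \<and> isonormal M W \<and> generated_by_noise M W"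

section \<open>Skorohod integral\<close>

definition partial_deriv :: "nat \<Rightarrow> ((nat \<Rightarrow> real) \<Rightarrow> real) \<Rightarrow> (nat \<Rightarrow> real) \<Rightarrow> real" where
  "partial_deriv i f x = deriv (\<lambda>s. f (x(i := s))) (x i)"

text \<open>Smooth functions on $n$-dimensional space, encoded as functions on sequences that
  ignore all coordinates from \<open>n\<close> on, all of whose partial derivatives of all orders have
  polynomial growth. Since all iterated partial derivatives exist and are locally bounded,
  they are continuous, so this is the usual smoothness.\<close>

definition smooth_poly_growth :: "nat \<Rightarrow> ((nat \<Rightarrow> real) \<Rightarrow> real) \<Rightarrow> bool" where
  "smooth_poly_growth n f \<longleftrightarrow>
     (\<forall>x y. (\<forall>i<n. x i = y i) \<longrightarrow> f x = f y) \<and>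
     (\<forall>js. set js \<subseteq> {..<n} \<longrightarrow>
        (\<forall>i<n. \<forall>x. (\<lambda>s. foldr partial_deriv js f (x(i := s))) differentiable (at (x i))) \<and>
        (\<exists>C k. \<forall>x. \<bar>foldr partial_deriv js f x\<bar> \<le> C * (1 + (\<Sum>i<n. \<bar>x i\<bar>)) ^ k))"

text \<open>Malliavin derivative of the smooth random variable
  $f(W(h_0), \dots, W(h_{n-1}))$.\<close>

definition malliavin_deriv ::
  "((real \<times> real \<Rightarrow> real) \<Rightarrow> 'w \<Rightarrow> real) \<Rightarrow> nat \<Rightarrow> ((nat \<Rightarrow> real) \<Rightarrow> real) \<Rightarrow>
   (nat \<Rightarrow> real \<times> real \<Rightarrow> real) \<Rightarrow> 'w \<Rightarrow> real \<times> real \<Rightarrow> real" where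
  "malliavin_deriv W n f h \<omega> p = (\<Sum>i<n. partial_deriv i f (\<lambda>j. W (h j) \<omega>) * h i p)"

text \<open>The Skorohod integral is the adjoint of the Malliavin derivative: the square-integrable
  process \<open>v\<close> is in its domain and \<open>X\<close> is (a version of) its integral iff
  $E[F X] = E[\langle DF, v\rangle_H]$ for all smooth random variables $F$.\<close>

definition has_skorohod_integral ::
  "'w measure \<Rightarrow> ((real \<times> real \<Rightarrow> real) \<Rightarrow> 'w \<Rightarrow> real) \<Rightarrow>
   (real \<times> real \<Rightarrow> 'w \<Rightarrow> real) \<Rightarrow> ('w \<Rightarrow> real) \<Rightarrow> bool" where
  "has_skorohod_integral M W v X \<longleftrightarrow>
     (\<lambda>(\<omega>, p). v p \<omega>) \<in> L2_space (M \<Otimes>\<^sub>M quadrant) \<and>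
     X \<in> L2_space M \<and>
     (\<forall>n f h. smooth_poly_growth n f \<and> (\<forall>i<n. h i \<in> H_space) \<longrightarrow>
        (LINT \<omega>|M. f (\<lambda>j. W (h j) \<omega>) * X \<omega>) =
        (LINT \<omega>|M. H_inner (malliavin_deriv W n f h \<omega>) (\<lambda>p. v p \<omega>)))"

section \<open>Mild solution\<close>

definition mild_solution ::
  "'w measure \<Rightarrow> ((real \<times> real \<Rightarrow> real) \<Rightarrow> 'w \<Rightarrow> real) \<Rightarrow> real \<Rightarrow>
   (real \<Rightarrow> real \<Rightarrow> 'w \<Rightarrow> real) \<Rightarrow> bool" where
  "mild_solution M W \<beta> u \<longleftrightarrow>
     (\<forall>z\<ge>0. \<forall>t\<ge>0. u z t \<in> L2_space M) \<and>
     (\<forall>z>0. AE \<omega> in M. u z 0 \<omega> = 1) \<and>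
     (\<forall>t>0. AE \<omega> in M. u 0 t \<omega> = 0) \<and>
     (\<forall>z>0. \<forall>t>0. \<exists>X.
        has_skorohod_integral M W
          (\<lambda>(w, \<tau>) \<omega>. if \<tau> < t then q0 z w (t - \<tau>) * (min w 1) powr \<beta> * u w \<tau> \<omega> else 0) X \<and>
        (AE \<omega> in M. u z t \<omega> = u0 z t + X \<omega>))"

end

theory Submission
  imports Defs
begin

text \<open>
  The squared kernel satisfies
  $q_0(z,w,s)^2 \le C z^2 s^{-1} (s + z)^{-3} e^{-(\sqrt z - \sqrt w)^2 / s}$ (and the same with $w$ instead
  of $z$ inside the cube), which follows from $I_1(x)^2 \le 4 x^2 (1 + x)^{-3} e^{2x}$. Let $K$ be the
  integral operator with kernel $q_0^2 \hat w^{2\beta}$ and $\nu(z,t) = z / (z + t)$, which is comparable to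
  $u_0$. Then $K \nu^2 \le C t^\gamma \nu^2$ for $\gamma = \min(2\beta, 1/2)$, so that for small times
  $8 \nu^2$ is a supersolution of $m \le 4 \nu^2 + K m$.

  The second moment $m$ of a mild solution satisfies this inequality. Instead of the chaos expansion, test
  the Skorohod equation against $\cos(W(h) + \theta)$. This gives a linear Volterra equation for
  $E[\cos(W(h) + \theta) u(z,t)]$, and by uniqueness
  $e^{|h|^2/2} E[\cos(W(h) + \theta) u(z,t)]$ depends only on $h$ before time $t$, i.e. $u$ is adapted.
  For $F = \sum_j c_j \cos(W(h_j) + \theta_j)$ the Clark-Ocone formula is explicit, and the bound
  $E[F X]^2 \le E[F^2] \, K m$ for the stochastic integral $X$ becomes Cauchy-Schwarz together with
  $\int \rho e^R = e^{R(\infty)} - 1$ for a primitive $R$ of $\rho$. Such $F$ are dense, hence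
  $E[X^2] \le K m$.

  Both comparison arguments need uniqueness for $g \le \lambda K g$ knowing only that $K g$ is finite. This
  finiteness at one large time bounds the integral of $g$ against the weight
  $e^{-\Lambda t - z / (3T - 2t)}$, on which the adjoint of $K$ is a strict contraction for large $\Lambda$.
\<close>

section \<open>Pointwise bounds for the kernel\<close>

text \<open>The degeneracy at z = 0 shapes the estimates. Integrating q_0^2 over w leaves
  (z/(z+s))^2 s^(-1/2) (z+s)^(-1/2); uniformly in z the last two factors are only bounded by 1/s,
  whose time integral diverges. The noise coefficient min(w,1)^(2 \<beta>) <= w^\<gamma> improves
  this to s^(\<gamma>-1), which is where \<beta> > 0 enters; the cap \<gamma> <= 1/2 makes s^(-1/2)
  (z+s)^(\<gamma>-1/2) <= s^(\<gamma>-1) true.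

  A mild solution comes without any moment bound that is uniform in space or time: each integrand is
  merely square integrable. This rules out a Gronwall argument in a supremum norm, so uniqueness
  goes through a weighted integral whose finiteness is read off from one integrand.

  Cosines with a phase are the test functions because the family is stable under every operation
  applied to it: differentiation shifts the phase by pi/2, products split into sums, expectations
  are explicit, and conditioning on the past only cuts h off and multiplies by a Gaussian
  factor.\<close>

lemma central_coeff_bound:
  "((fact (2*k+1) :: real) / (2^(2*k+1) * fact k * fact (k+1)))\<^sup>2 * (2 * real k + 3) \<le> 1"
proof (induction k)
  case 0 show ?case by (simp add: power2_eq_square)
next
  case (Suc k)
  \<comment> \<open>\<open>?a k\<close> is binom(2k+1, k) / 2^(2k+1), of order k^(-1/2). Successive
    values have ratio (2k+3)/(2k+4), and (2k+3)(2k+5) <= (2k+4)^2 keeps the product with 2k+3 below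
    1.\<close>
  let ?a = "\<lambda>k. (fact (2*k+1) :: real) / (2^(2*k+1) * fact k * fact (k+1))"
  have step: "?a (Suc k) = ?a k * ((2 * real k + 3) / (2 * real k + 4))"
  proof -
    have 1: "(fact (2 * Suc k + 1) :: real) = (2 * real k + 3) * (2 * real k + 2) * fact (2*k+1)"
      by (simp add: algebra_simps)
    have 2: "(fact (Suc k + 1) :: real) = (real k + 2) * fact (k+1)" "(fact (Suc k) :: real) = (real k + 1) * fact k"
      by (simp_all add: algebra_simps)
    have 3: "(2::real)^(2 * Suc k + 1) = 4 * 2^(2*k+1)" by simp
    have nz: "(fact (k+1) :: real) \<noteq> 0" "(fact k :: real) \<noteq> 0" "(2::real)^(2*k+1) \<noteq> 0" "real k + 1 \<noteq> 0" "real k + 2 \<noteq> 0"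
      using fact_nonzero by (auto simp: add_eq_0_iff_both_eq_0)
    have "(2 * real k + 3) * (2 * real k + 2) * F / (4 * P * ((real k + 1) * G) * ((real k + 2) * H))
      = F / (P * G * H) * ((2 * real k + 3) / (2 * real k + 4))"
      if "G \<noteq> 0" "H \<noteq> 0" "P \<noteq> 0" for F P G H :: real
    proof -
      have "(2 * real k + 3) * (2 * real k + 2) * F / (4 * P * ((real k + 1) * G) * ((real k + 2) * H))
        = F / (P * G * H) * ((2 * real k + 3) * (2 * (real k + 1)) / (4 * (real k + 1) * (real k + 2)))"
        using that by (simp add: mult_ac)
      also have "(2 * real k + 3) * (2 * (real k + 1)) / (4 * (real k + 1) * (real k + 2)) = (2 * real k + 3) / (2 * real k + 4)"
        using nz(4,5) by (simp add: divide_simps) (simp add: algebra_simps)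
      finally show ?thesis .
    qed
    then show ?thesis unfolding 1 2 3 using nz by blast
  qed
  have "(?a (Suc k))\<^sup>2 * (2 * real (Suc k) + 3)
      = (?a k)\<^sup>2 * (2 * real k + 3) * ((2 * real k + 3) * (2 * real k + 5) / (2 * real k + 4)\<^sup>2)"
    unfolding step by (simp add: power2_eq_square field_simps)
  also have "\<dots> \<le> 1 * 1"
  proof (rule mult_mono[OF Suc])
    show "(2 * real k + 3) * (2 * real k + 5) / (2 * real k + 4)\<^sup>2 \<le> 1"
      by (subst divide_le_eq_1_pos) (auto simp: power2_eq_square algebra_simps add_pos_nonneg)
  qed auto
  finally show ?case by simp
qed

text \<open>Each term of the Bessel series is a Taylor term of sinh times the coefficient of
  \<open>central_coeff_bound\<close>. Cauchy-Schwarz splits off the sinh series; the squared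
  coefficient, at most 1/(2k+2), turns (2k+1)! into (2k+2)! and leaves the cosh series without its
  constant term, divided by x.\<close>

lemma bessel_I1_sq_le_hyperbolic:
  assumes "x > 0"
  shows bessel_I1_ge: "bessel_I 1 x \<ge> x / 2"
    and bessel_I1_sq: "(bessel_I 1 x)\<^sup>2 \<le> sinh x * ((cosh x - 1) / x)"
proof -
  define b where "b k = (x / 2) ^ (2 * k + 1) / (fact k * fact (k + 1))" for k :: nat
  define p where "p k = x ^ (2*k+1) / fact (2*k+1)" for k :: nat
  define a where "a k = (fact (2*k+1) :: real) / (2^(2*k+1) * fact k * fact (k+1))" for k :: nat
  have b: "b k = p k * a k" for k
    using fact_nonzero[of "2*k+1", where 'a=real]
    by (simp add: b_def p_def a_def power_divide del: fact_Suc)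
  have p0: "p k \<ge> 0" for k using assms by (simp add: p_def)
  have aa: "(a k)\<^sup>2 \<le> 1 / (2 * real k + 2)" for k
  proof -
    have "(a k)\<^sup>2 \<le> 1 / (2 * real k + 3)"
      using central_coeff_bound[of k] by (simp add: a_def field_simps add_pos_nonneg)
    also have "\<dots> \<le> 1 / (2 * real k + 2)" by (intro divide_left_mono) auto
    finally show ?thesis .
  qed
  have sp: "(\<Sum>k<n. p k) \<le> sinh x" for n
  proof -
    have *: "(\<lambda>n. if even n then 0 else x ^ n /\<^sub>R fact n) sums sinh x" by (rule sinh_converges)
    have "(\<Sum>k<n. p k) = (\<Sum>j\<in>(\<lambda>k. 2*k+1)`{..<n}. if even j then 0 else x ^ j /\<^sub>R fact j)"
      by (subst sum.reindex) (auto simp: inj_on_def p_def field_simps)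
    also have "\<dots> \<le> (\<Sum>j. if even j then 0 else x ^ j /\<^sub>R fact j)"
      using assms * by (intro sum_le_suminf) (auto simp: sums_iff)
    also have "\<dots> = sinh x" using * by (simp add: sums_iff)
    finally show ?thesis .
  qed
  have sq: "(\<Sum>k<n. p k * (a k)\<^sup>2) \<le> (cosh x - 1) / x" for n
  proof -
    have *: "(\<lambda>n. if even n then x ^ n /\<^sub>R fact n else 0) sums cosh x" by (rule cosh_converges)
    have "1 + x * (\<Sum>k<n. p k * (a k)\<^sup>2) \<le> 1 + x * (\<Sum>k<n. p k * (1 / (2 * real k + 2)))"
      using aa p0 assms by (intro add_left_mono mult_left_mono sum_mono) auto
    also have "\<dots> = 1 + (\<Sum>k<n. x ^ (2*k+2) /\<^sub>R fact (2*k+2))"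
      by (simp add: sum_distrib_left p_def field_simps)
    also have "(\<Sum>k<n. x ^ (2*k+2) /\<^sub>R fact (2*k+2)) = (\<Sum>j\<in>(\<lambda>k. 2*k+2)`{..<n}. if even j then x ^ j /\<^sub>R fact j else 0)"
      by (subst sum.reindex) (auto simp: inj_on_def)
    also have "1 + \<dots> = (\<Sum>j\<in>insert 0 ((\<lambda>k. 2*k+2)`{..<n}). if even j then x ^ j /\<^sub>R fact j else 0)"
      by (subst sum.insert) auto
    also have "\<dots> \<le> (\<Sum>j. if even j then x ^ j /\<^sub>R fact j else 0)"
      using assms * by (intro sum_le_suminf) (auto simp: sums_iff)
    also have "\<dots> = cosh x" using * by (simp add: sums_iff)
    finally show ?thesis using assms by (simp add: field_simps)
  qed
  have sb2: "(\<Sum>k<n. b k)\<^sup>2 \<le> sinh x * ((cosh x - 1) / x)" for n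
  proof -
    have "(\<Sum>k<n. b k)\<^sup>2 = (\<Sum>k<n. sqrt (p k) * (sqrt (p k) * a k))\<^sup>2"
      by (simp add: b mult.assoc[symmetric] p0)
    also have "\<dots> \<le> (\<Sum>k<n. (sqrt (p k))\<^sup>2) * (\<Sum>k<n. (sqrt (p k) * a k)\<^sup>2)"
      by (rule Cauchy_Schwarz_ineq_sum)
    also have "\<dots> = (\<Sum>k<n. p k) * (\<Sum>k<n. p k * (a k)\<^sup>2)" by (simp add: p0 power_mult_distrib)
    also have "\<dots> \<le> sinh x * ((cosh x - 1) / x)"
      using sp sq assms by (intro mult_mono) (auto intro!: sum_nonneg p0 mult_nonneg_nonneg)
    finally show ?thesis .
  qed
  have b0: "b k \<ge> 0" for k using assms by (simp add: b_def)
  \<comment> \<open>The uniform bound on the partial sums also yields convergence, without which the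
    infinite sum in \<open>bessel_I\<close> would carry no information.\<close>
  have sum: "summable b"
  proof (rule summableI_nonneg_bounded[OF b0])
    show "(\<Sum>k<n. b k) \<le> sqrt (sinh x * ((cosh x - 1) / x))" for n
      using sb2[of n] by (rule real_le_rsqrt)
  qed

  have eq: "bessel_I 1 x = suminf b" by (simp add: bessel_I_def b_def[abs_def])
  have "(\<Sum>k<1. b k) \<le> suminf b" using b0 by (intro sum_le_suminf sum) auto
  then show "bessel_I 1 x \<ge> x / 2" unfolding eq by (simp add: b_def)
  have "(\<lambda>n. (\<Sum>k<n. b k)\<^sup>2) \<longlonglongrightarrow> (suminf b)\<^sup>2"
    by (intro tendsto_power summable_LIMSEQ sum)
  then show "(bessel_I 1 x)\<^sup>2 \<le> sinh x * ((cosh x - 1) / x)"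
    unfolding eq by (rule LIMSEQ_le_const2) (use sb2 in auto)
qed

lemma one_minus_exp_neg_bounds:
  assumes "(x::real) \<ge> 0"
  shows one_minus_exp_neg_ge: "x / (1 + x) \<le> 1 - exp (- x)"
    and one_minus_exp_neg_le: "1 - exp (- x) \<le> 2 * x / (1 + x)"
proof -
  have "exp (-x) \<le> 1 / (1 + x)"
    using exp_ge_add_one_self[of x] assms
    by (simp add: exp_minus field_simps)
  then show "x / (1 + x) \<le> 1 - exp (- x)" using assms by (simp add: field_simps)
  have "1 - exp (-x) \<le> 1" "1 - exp (-x) \<le> x" using exp_ge_add_one_self[of "-x"] by auto
  then have "(1 - exp (-x)) * (1 + x) \<le> 2 * x"
  proof -
    have "x * (1 - exp (-x)) \<le> x * 1" using assms \<open>1 - exp (-x) \<le> 1\<close> by (intro mult_left_mono) auto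
    then show ?thesis using \<open>1 - exp (-x) \<le> x\<close> by (simp add: algebra_simps)
  qed
  then show "1 - exp (- x) \<le> 2 * x / (1 + x)" using assms by (simp add: field_simps)
qed

text \<open>After extraction of e^x, sinh x and cosh x - 1 become 1 - e^(-2x) and (1 - e^(-x))^2 up
  to a factor 2; each of the three small factors is at most a multiple of x/(1+x). The bound has the
  right order both at 0 and at infinity.\<close>

lemma bessel_I1_sq_le:
  assumes x: "x > 0"
  shows "(bessel_I 1 x)\<^sup>2 \<le> 4 * x\<^sup>2 / (1 + x) ^ 3 * exp (2 * x)"
proof -
  have s: "sinh x = (1 - exp (-(2*x))) / 2 * exp x"
    by (simp add: sinh_field_def field_simps flip: exp_add)
  have c: "cosh x - 1 = (1 - exp (-x))\<^sup>2 / 2 * exp x"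
    by (simp add: cosh_field_def field_simps power2_eq_square flip: exp_add)
  have "1 - exp (-(2*x)) \<le> 2 * (2*x) / (1 + 2*x)" using one_minus_exp_neg_le[of "2*x"] x by simp
  also have "\<dots> \<le> 4 * x / (1 + x)" using x by (simp add: field_simps)
  finally have 1: "1 - exp (-(2*x)) \<le> 4 * x / (1 + x)" .
  have 2: "(1 - exp (-x))\<^sup>2 \<le> (2 * x / (1 + x))\<^sup>2"
    using one_minus_exp_neg_le[of x] x by (intro power_mono) auto
  have "sinh x * ((cosh x - 1) / x) = (1 - exp (-(2*x))) * (1 - exp (-x))\<^sup>2 * (exp (2*x) / (4 * x))"
  proof -
    have *: "exp (2*x) = exp x * exp x" by (simp flip: exp_add)
    show ?thesis unfolding s c * by (simp only: times_divide_eq_left times_divide_eq_right divide_divide_eq_left mult_ac)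
  qed
  also have "\<dots> \<le> (4 * x / (1 + x)) * (2 * x / (1 + x))\<^sup>2 * (exp (2*x) / (4 * x))"
    using 1 2 x by (intro mult_mono mult_right_mono) auto
  also have "\<dots> = 4 * x\<^sup>2 / (1 + x) ^ 3 * exp (2 * x)"
    using x by (simp add: power2_eq_square power3_eq_cube divide_simps)
  finally show ?thesis using bessel_I1_sq[OF x] by linarith
qed

text \<open>Let x be the Bessel argument and y = (sqrt z - sqrt w)^2/s. Then x + y = (z+w)/s, so 1 +
  v/s <= (1+x)(1+y): decay in x becomes decay in v at the price of (1+y)^3 <= 27 e^y, which consumes
  half of the factor e^(-2y). The choice v = z serves integration over w, and v = w integration over
  z. The constant is 16 * 27.\<close>

lemma q0_sq_le:
  assumes z: "z > 0" and w: "w > 0" and s: "s > 0" and v: "v = z \<or> v = w"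
  shows "(q0 z w s)\<^sup>2 \<le> 432 * z\<^sup>2 / (s * (s + v) ^ 3) * exp (- (sqrt z - sqrt w)\<^sup>2 / s)"
proof -
  define x where "x = 2 * sqrt (z * w) / s"
  define y where "y = (sqrt z - sqrt w)\<^sup>2 / s"
  have x0: "x > 0" using assms by (simp add: x_def)
  have y0: "y \<ge> 0" using s by (simp add: y_def)
  have sz: "sqrt z * sqrt z = z" "sqrt w * sqrt w = w" "sqrt (z * w) = sqrt z * sqrt w"
    using z w by (auto simp: real_sqrt_mult)
  have yx: "- 2 * y = - 2 * (z + w) / s + 2 * x"
    using sz s by (simp add: x_def y_def power2_eq_square field_simps)
  have "v \<le> 2 * sqrt (z*w) + (sqrt z - sqrt w)\<^sup>2"
    using v sz z w by (auto simp: power2_eq_square algebra_simps)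
  then have "v / s \<le> (2 * sqrt (z*w) + (sqrt z - sqrt w)\<^sup>2) / s" using s by (intro divide_right_mono) auto
  then have "v / s \<le> x + y" by (simp add: x_def y_def add_divide_distrib)
  moreover have "0 \<le> x * y" using x0 y0 by simp
  ultimately have "1 + v / s \<le> (1 + x) * (1 + y)" by (simp add: algebra_simps)
  moreover have vp: "0 < 1 + v / s" using v z w s by (auto simp: add_pos_pos)
  ultimately have "(1 + v/s)^3 \<le> (1 + x)^3 * (1 + y)^3"
    by (metis less_imp_le power_mono power_mult_distrib)
  also have "(1 + y)^3 \<le> (3 * exp (y/3))^3"
  proof (rule power_mono)
    show "1 + y \<le> 3 * exp (y / 3)" using exp_ge_add_one_self[of "y/3"] y0 by linarith
  qed (use y0 in auto)
  also have "(3 * exp (y/3))^3 = 27 * exp y"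
    by (simp add: power_mult_distrib flip: exp_of_nat_mult)
  finally have 1: "(1 + v/s)^3 \<le> (1 + x)^3 * (27 * exp y)" using x0 by simp
  have e: "exp (- (z + w) / s) ^ 2 * exp (2 * x) = exp (- 2 * y)"
    unfolding yx by (simp flip: exp_of_nat_mult exp_add)
  have "(q0 z w s)\<^sup>2 = z / w * (exp (- (z + w) / s) ^ 2 / s\<^sup>2) * (bessel_I 1 x)\<^sup>2"
    using z w by (simp add: q0_def x_def power_mult_distrib power_divide real_sqrt_divide)
  also have "\<dots> \<le> z / w * (exp (- (z + w) / s) ^ 2 / s\<^sup>2) * (4 * x\<^sup>2 / (1 + x) ^ 3 * exp (2 * x))"
    using z w by (intro mult_left_mono bessel_I1_sq_le x0) auto
  also have "\<dots> = z / w / s\<^sup>2 * 4 * x\<^sup>2 * (exp (- (z + w) / s) ^ 2 * exp (2 * x)) / (1 + x)^3"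
    by simp
  also have "\<dots> = 16 * z\<^sup>2 / s^4 * (exp (-2 * y) / (1 + x)^3)"
    unfolding e using z w by (simp add: x_def power_divide power_mult_distrib power2_eq_square power4_eq_xxxx field_simps)
  also have "exp (-2 * y) / (1 + x)^3 \<le> 27 * exp (-y) / (1 + v/s)^3"
  proof -
    have "exp (-2*y) * (1 + v/s)^3 \<le> exp (-2*y) * ((1 + x)^3 * (27 * exp y))"
      using 1 by (intro mult_left_mono) auto
    also have "\<dots> = 27 * exp (-y) * (1 + x)^3" by (simp flip: exp_add)
    finally show ?thesis using vp x0 by (simp add: divide_simps)
  qed
  also have "(1 + v/s)^3 = (s + v)^3 / s^3" using s by (simp add: field_simps flip: power_divide)
  finally show ?thesis using s z
    by (simp add: y_def mult_left_mono field_simps power3_eq_cube power4_eq_xxxx)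
qed

text \<open>The lower bound keeps only the first Bessel term. Its exponential form is what lets
  finiteness at one large time control an exponentially weighted integral.\<close>

lemma q0_pos:
  assumes "z > 0" "w > 0" "s > 0"
  shows "q0 z w s > 0" and q0_ge: "q0 z w s \<ge> z / s\<^sup>2 * exp (- (z + w) / s)"
proof -
  define x where "x = 2 * sqrt (z * w) / s"
  have x0: "x > 0" using assms by (simp add: x_def)
  have "z / s\<^sup>2 * exp (- (z + w) / s) = sqrt (z / w) * (exp (- (z + w) / s) / s) * (x / 2)"
    using assms by (simp add: x_def real_sqrt_mult real_sqrt_divide power2_eq_square field_simps)
  also have "\<dots> \<le> q0 z w s" unfolding q0_def x_def[symmetric]
    using assms by (intro mult_left_mono bessel_I1_ge x0) auto
  finally show "q0 z w s \<ge> z / s\<^sup>2 * exp (- (z + w) / s)" .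
  moreover have "z / s\<^sup>2 * exp (- (z + w) / s) > 0" using assms by simp
  ultimately show "q0 z w s > 0" by linarith
qed

lemma bessel_I_measurable [measurable]: "bessel_I n \<in> borel_measurable borel"
  unfolding bessel_I_def by measurable

lemma q0_measurable [measurable]:
  assumes [measurable]: "f \<in> borel_measurable N" "g \<in> borel_measurable N" "h \<in> borel_measurable N"
  shows "(\<lambda>x. q0 (f x) (g x) (h x)) \<in> borel_measurable N"
  unfolding q0_def by measurable

section \<open>Spatial integrals of the squared kernel\<close>

text \<open>Multiplication by sqrt z + sqrt w turns the difference of roots into z - w; for w <=
  4(z+s) the square of that factor is at most 10(z+s), which gives a genuine Gaussian. For larger w
  one has z <= w/4, so the roots differ by at least half of sqrt w and an exponential of mean 4s
  remains.\<close>

lemma sqrt_gaussian_le: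
  assumes z: "z > 0" and w: "w > 0" and s: "s > 0"
  shows "exp (- (sqrt z - sqrt w)\<^sup>2 / s) \<le> exp (- (w - z)\<^sup>2 / (10 * s * (z + s))) + exp (- w / (4 * s))"
proof (cases "w \<le> 4 * (z + s)")
  case True
  have "(sqrt z + sqrt w)\<^sup>2 \<le> 2 * (z + w)"
    using sum_squares_bound[of "sqrt z" "sqrt w"] z w by (simp add: power2_sum)
  also have "\<dots> \<le> 10 * (z + s)" using True z s by simp
  finally have *: "(sqrt z + sqrt w)\<^sup>2 \<le> 10 * (z + s)" .
  have "(w - z)\<^sup>2 = (sqrt z - sqrt w)\<^sup>2 * (sqrt z + sqrt w)\<^sup>2"
  proof -
    have "w - z = - ((sqrt z - sqrt w) * (sqrt z + sqrt w))"
      using z w by (simp add: algebra_simps)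
    then show ?thesis by (simp add: power_mult_distrib)
  qed
  also have "\<dots> \<le> (sqrt z - sqrt w)\<^sup>2 * (10 * (z + s))"
    using * by (intro mult_left_mono) auto
  finally have "(w - z)\<^sup>2 / (10 * s * (z + s)) \<le> (sqrt z - sqrt w)\<^sup>2 / s"
    using z s by (simp add: divide_simps mult_ac)
  then have "exp (- (sqrt z - sqrt w)\<^sup>2 / s) \<le> exp (- (w - z)\<^sup>2 / (10 * s * (z + s)))" by simp
  then show ?thesis using exp_gt_zero[of "- w / (4 * s)"] by linarith
next
  case False
  then have "z \<le> w / 4" using s by simp
  then have "sqrt z \<le> sqrt (w / 4)" by simp
  then have "sqrt z \<le> sqrt w / 2" by (simp add: real_sqrt_divide)
  then have "(sqrt w / 2)\<^sup>2 \<le> (sqrt w - sqrt z)\<^sup>2" using w by (intro power_mono) auto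
  then have "w / 4 \<le> (sqrt z - sqrt w)\<^sup>2" using w by (simp add: power_divide power2_commute)
  then have "w / 4 / s \<le> (sqrt z - sqrt w)\<^sup>2 / s" using s by (intro divide_right_mono) auto
  then have "exp (- (sqrt z - sqrt w)\<^sup>2 / s) \<le> exp (- w / (4 * s))" by simp
  then show ?thesis using exp_gt_zero[of "- (w - z)\<^sup>2 / (10 * s * (z + s))"] by linarith
qed

lemma nn_integral_gaussian_kernel:
  assumes "c > 0"
  shows "(\<integral>\<^sup>+w. ennreal (exp (- (w - z)\<^sup>2 / (2 * c))) \<partial>lborel) = ennreal (sqrt (2 * pi * c))"
proof -
  have "(\<integral>\<^sup>+w. ennreal (exp (- (w - z)\<^sup>2 / (2 * c))) \<partial>lborel)
      = (\<integral>\<^sup>+w. ennreal (sqrt (2 * pi * c)) * ennreal (normal_density z (sqrt c) w) \<partial>lborel)"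
    using assms by (intro nn_integral_cong) (simp add: normal_density_def flip: ennreal_mult)
  also have "\<dots> = ennreal (sqrt (2 * pi * c)) * (\<integral>\<^sup>+w. ennreal (normal_density z (sqrt c) w) \<partial>lborel)"
    by (rule nn_integral_cmult) auto
  also have "(\<integral>\<^sup>+w. ennreal (normal_density z (sqrt c) w) \<partial>lborel) = 1"
    using assms by (subst nn_integral_eq_integral) auto
  finally show ?thesis by simp
qed

lemma nn_integral_exp_decay:
  assumes "c > 0"
  shows "(\<integral>\<^sup>+w. ennreal (exp (- w / c)) * indicator {0<..} w \<partial>lborel) \<le> ennreal c"
proof -
  interpret prob_space "density lborel (exponential_density (1/c))"
    by (rule prob_space_exponential_density) (use assms in auto)
  have "(\<integral>\<^sup>+w. ennreal (exp (- w / c)) * indicator {0<..} w \<partial>lborel)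
     \<le> (\<integral>\<^sup>+w. ennreal c * ennreal (exponential_density (1/c) w) \<partial>lborel)"
    using assms by (intro nn_integral_mono) (auto simp: exponential_density_def indicator_def simp flip: ennreal_mult)
  also have "\<dots> = ennreal c * (\<integral>\<^sup>+w. ennreal (exponential_density (1/c) w) \<partial>lborel)"
    by (rule nn_integral_cmult) auto
  also have "(\<integral>\<^sup>+w. ennreal (exponential_density (1/c) w) \<partial>lborel) = 1"
    using emeasure_space_1 by (simp add: emeasure_density)
  finally show ?thesis by simp
qed

lemma nn_integral_sqrt_gaussian:
  assumes z: "z > 0" and s: "s > 0"
  shows "(\<integral>\<^sup>+w. ennreal (exp (- (sqrt z - sqrt w)\<^sup>2 / s)) * indicator {0<..} w \<partial>lborel)
    \<le> ennreal (10 * sqrt (s * (z + s)))"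
proof -
  have "(\<integral>\<^sup>+w. ennreal (exp (- (sqrt z - sqrt w)\<^sup>2 / s)) * indicator {0<..} w \<partial>lborel)
    \<le> (\<integral>\<^sup>+w. ennreal (exp (- (w - z)\<^sup>2 / (2 * (5 * s * (z + s)))))
         + ennreal (exp (- w / (4 * s))) * indicator {0<..} w \<partial>lborel)"
  proof (intro nn_integral_mono)
    fix w :: real
    show "ennreal (exp (- (sqrt z - sqrt w)\<^sup>2 / s)) * indicator {0<..} w
      \<le> ennreal (exp (- (w - z)\<^sup>2 / (2 * (5 * s * (z + s))))) + ennreal (exp (- w / (4 * s))) * indicator {0<..} w"
      using sqrt_gaussian_le[OF z _ s, of w]
      by (auto simp: indicator_def mult.assoc simp flip: ennreal_plus intro!: ennreal_leI)
  qed
  also have "\<dots> = (\<integral>\<^sup>+w. ennreal (exp (- (w - z)\<^sup>2 / (2 * (5 * s * (z + s))))) \<partial>lborel)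
         + (\<integral>\<^sup>+w. ennreal (exp (- w / (4 * s))) * indicator {0<..} w \<partial>lborel)"
    by (rule nn_integral_add) auto
  also have "\<dots> \<le> ennreal (sqrt (2 * pi * (5 * s * (z + s)))) + ennreal (4 * s)"
    using z s by (intro add_mono nn_integral_exp_decay eq_refl nn_integral_gaussian_kernel) auto
  also have "\<dots> = ennreal (sqrt (2 * pi * (5 * s * (z + s))) + 4 * s)" using z s by simp
  also have "\<dots> \<le> ennreal (10 * sqrt (s * (z + s)))"
  proof (rule ennreal_leI)
    \<comment> \<open>The Gaussian part contributes sqrt (10 pi) <= 6 and the exponential part 4,
      hence the constant 10.\<close>
    have "sqrt (2 * pi * (5 * s * (z + s))) = sqrt (10 * pi) * sqrt (s * (z + s))"
      by (simp flip: real_sqrt_mult)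
    moreover have "sqrt (10 * pi) \<le> sqrt (6\<^sup>2)" using pi_less_4 pi_approx by (intro real_sqrt_le_mono) auto
    moreover have "s \<le> sqrt (s * (z + s))" using z s by (intro real_le_rsqrt) (auto simp: power2_eq_square)
    ultimately show "sqrt (2 * pi * (5 * s * (z + s))) + 4 * s \<le> 10 * sqrt (s * (z + s))"
    proof -
      assume *: "sqrt (2 * pi * (5 * s * (z + s))) = sqrt (10 * pi) * sqrt (s * (z + s))"
        and **: "sqrt (10 * pi) \<le> sqrt (6\<^sup>2)" and ***: "s \<le> sqrt (s * (z + s))"
      have "sqrt (10 * pi) * sqrt (s * (z + s)) \<le> 6 * sqrt (s * (z + s))"
        using ** z s by (intro mult_right_mono) auto
      then show ?thesis using * *** by linarith
    qed
  qed
  finally show ?thesis .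
qed

text \<open>The weight satisfies w <= 2(z+s)(1+y) with y = (sqrt z - sqrt w)^2/s, and the power of
  1+y is absorbed by half of the Gaussian. The cap 3 makes the constant uniform in p; the exponents
  that occur later are at most 5/2.\<close>

lemma nn_integral_powr_sqrt_gaussian:
  assumes z: "z > 0" and s: "s > 0" and p: "0 \<le> p" "p \<le> 3"
  shows "(\<integral>\<^sup>+w. ennreal (w powr p * exp (- (sqrt z - sqrt w)\<^sup>2 / s)) * indicator {0<..} w \<partial>lborel)
    \<le> ennreal (34560 * (sqrt s * (z + s) powr (p + 1/2)))"
proof -
  have pt: "w powr p * exp (- (sqrt z - sqrt w)\<^sup>2 / s)
      \<le> 1728 * (z + s) powr p * exp (- (sqrt z - sqrt w)\<^sup>2 / (2 * s))" if w: "w > 0" for w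
  proof -
    define y where "y = (sqrt z - sqrt w)\<^sup>2 / s"
    have y0: "y \<ge> 0" using s by (simp add: y_def)
    have "w \<le> 2 * z + 2 * (sqrt z - sqrt w)\<^sup>2"
    proof -
      have "2 * z + 2 * (sqrt z - sqrt w)\<^sup>2 - w = (2 * sqrt z - sqrt w)\<^sup>2"
        using z w by (simp add: power2_diff power_mult_distrib)
      then show ?thesis by (metis diff_ge_0_iff_ge zero_le_power2)
    qed
    also have "\<dots> = 2 * z + 2 * s * y" using s by (simp add: y_def)
    also have "\<dots> \<le> 2 * (z + s) * (1 + y)" using z s y0 by (simp add: algebra_simps)
    finally have "w powr p \<le> (2 * (z + s) * (1 + y)) powr p" using w p by (intro powr_mono2) auto
    also have "\<dots> = 2 powr p * (z + s) powr p * (1 + y) powr p"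
      using z s y0 powr_mult[of "2 * (z + s)" "1 + y" p] powr_mult[of 2 "z + s" p] by simp
    also have "\<dots> \<le> 2 powr 3 * (z + s) powr p * (1 + y) powr 3"
    proof (intro mult_mono mult_right_mono)
      show "(2::real) powr p \<le> 2 powr 3" using p by (intro powr_mono) auto
      show "(1 + y) powr p \<le> (1 + y) powr 3" using p y0 by (intro powr_mono) auto
    qed auto
    also have "(1 + y) powr 3 = (1 + y) ^ 3" using y0 by (simp add: powr_numeral)
    also have "(1 + y) ^ 3 \<le> (6 * exp (y/6)) ^ 3"
    proof (rule power_mono)
      show "1 + y \<le> 6 * exp (y/6)" using exp_ge_add_one_self[of "y/6"] y0 by linarith
    qed (use y0 in auto)
    also have "(6 * exp (y/6)) ^ 3 = 216 * exp (y/2)"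
      by (simp add: power_mult_distrib flip: exp_of_nat_mult)
    finally have "w powr p \<le> 1728 * (z + s) powr p * exp (y/2)"
      by (simp add: powr_numeral mult_left_mono mult.assoc)
    then have "w powr p * exp (-y) \<le> 1728 * (z + s) powr p * exp (y/2) * exp (-y)"
      by (intro mult_right_mono) auto
    also have "\<dots> = 1728 * (z + s) powr p * exp (-y/2)" by (simp flip: exp_add)
    finally show ?thesis by (simp add: y_def mult.commute)
  qed
  have "(\<integral>\<^sup>+w. ennreal (w powr p * exp (- (sqrt z - sqrt w)\<^sup>2 / s)) * indicator {0<..} w \<partial>lborel)
    \<le> (\<integral>\<^sup>+w. ennreal (1728 * (z + s) powr p) *
          (ennreal (exp (- (sqrt z - sqrt w)\<^sup>2 / (2 * s))) * indicator {0<..} w) \<partial>lborel)"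
    using pt by (intro nn_integral_mono) (auto simp: indicator_def intro!: ennreal_leI simp flip: ennreal_mult)
  also have "\<dots> = ennreal (1728 * (z + s) powr p) *
      (\<integral>\<^sup>+w. ennreal (exp (- (sqrt z - sqrt w)\<^sup>2 / (2 * s))) * indicator {0<..} w \<partial>lborel)"
    by (rule nn_integral_cmult) auto
  also have "\<dots> \<le> ennreal (1728 * (z + s) powr p) * ennreal (10 * sqrt (2 * s * (z + 2 * s)))"
    using z s by (intro mult_left_mono nn_integral_sqrt_gaussian) auto
  also have "\<dots> = ennreal (1728 * (z + s) powr p * (10 * sqrt (2 * s * (z + 2 * s))))"
    using z s by (intro ennreal_mult[symmetric]) auto
  also have "\<dots> \<le> ennreal (1728 * (z + s) powr p * (10 * (2 * sqrt s * (z + s) powr (1/2))))"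
  proof (intro ennreal_leI mult_left_mono)
    have "sqrt (2 * s * (z + 2 * s)) \<le> sqrt (2\<^sup>2 * s * (z + s))"
      using z s by (intro real_sqrt_le_mono) (simp add: algebra_simps)
    also have "\<dots> = 2 * sqrt s * (z + s) powr (1/2)"
      using z s by (simp add: real_sqrt_mult powr_half_sqrt)
    finally show "sqrt (2 * s * (z + 2 * s)) \<le> 2 * sqrt s * (z + s) powr (1/2)" .
  qed auto
  also have "\<dots> = ennreal (34560 * (sqrt s * (z + s) powr (p + 1/2)))"
    by (simp add: powr_add mult_ac)
  finally show ?thesis .
qed

lemma nn_integral_q0_sq_powr:
  assumes z: "z > 0" and s: "s > 0" and p: "0 \<le> p" "p \<le> 3"
  shows "(\<integral>\<^sup>+w. ennreal ((q0 z w s)\<^sup>2 * w powr p) * indicator {0<..} w \<partial>lborel)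
    \<le> ennreal (14929920 * z\<^sup>2 * (s powr (-1/2) * (z + s) powr (p - 5/2)))"
proof -
  let ?c = "432 * z\<^sup>2 / (s * (s + z) ^ 3)"
  have c0: "?c \<ge> 0" using z s by simp
  have "(\<integral>\<^sup>+w. ennreal ((q0 z w s)\<^sup>2 * w powr p) * indicator {0<..} w \<partial>lborel)
     \<le> (\<integral>\<^sup>+w. ennreal ?c * (ennreal (w powr p * exp (- (sqrt z - sqrt w)\<^sup>2 / s)) * indicator {0<..} w) \<partial>lborel)"
  proof (intro nn_integral_mono)
    fix w :: real
    show "ennreal ((q0 z w s)\<^sup>2 * w powr p) * indicator {0<..} w
      \<le> ennreal ?c * (ennreal (w powr p * exp (- (sqrt z - sqrt w)\<^sup>2 / s)) * indicator {0<..} w)"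
    proof (cases "w > 0")
      case True
      have "(q0 z w s)\<^sup>2 * w powr p \<le> ?c * exp (- (sqrt z - sqrt w)\<^sup>2 / s) * w powr p"
        using q0_sq_le[OF z True s, of z] by (intro mult_right_mono) auto
      then show ?thesis using True c0
        by (auto simp: mult_ac simp flip: ennreal_mult intro!: ennreal_leI)
    qed auto
  qed
  also have "\<dots> = ennreal ?c * (\<integral>\<^sup>+w. (ennreal (w powr p * exp (- (sqrt z - sqrt w)\<^sup>2 / s)) * indicator {0<..} w) \<partial>lborel)"
    by (rule nn_integral_cmult) auto
  also have "\<dots> \<le> ennreal ?c * ennreal (34560 * (sqrt s * (z + s) powr (p + 1/2)))"
    by (intro mult_left_mono nn_integral_powr_sqrt_gaussian assms) auto
  also have "\<dots> = ennreal (?c * (34560 * (sqrt s * (z + s) powr (p + 1/2))))"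
    using c0 z s by (intro ennreal_mult[symmetric]) auto
  also have "?c * (34560 * (sqrt s * (z + s) powr (p + 1/2)))
      = 14929920 * z\<^sup>2 * ((sqrt s / s) * ((z + s) powr (p + 1/2) / (z + s) ^ 3))"
    by (simp add: add_ac)
  also have "sqrt s / s = s powr (-1/2)"
    using s powr_diff[of s "1/2" 1] by (simp add: powr_half_sqrt)
  also have "(z + s) powr (p + 1/2) / (z + s) ^ 3 = (z + s) powr (p - 5/2)"
    using z s powr_diff[of "z + s" "p+1/2" 3] by (simp add: powr_numeral)
  finally show ?thesis .
qed

text \<open>Replacing z + s by s in a power with nonpositive exponent makes the time singularity
  independent of z.\<close>

lemma powr_half_mix:
  assumes "(z::real) > 0" "s > 0" "\<gamma> \<le> 1/2"
  shows "s powr (-1/2) * (z + s) powr (\<gamma> - 1/2) \<le> s powr (\<gamma> - 1)"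
proof -
  have "(z + s) powr (\<gamma> - 1/2) \<le> s powr (\<gamma> - 1/2)"
    using assms by (intro powr_mono2') auto
  then have "s powr (-1/2) * (z + s) powr (\<gamma> - 1/2) \<le> s powr (-1/2) * s powr (\<gamma> - 1/2)"
    by (intro mult_left_mono) auto
  also have "\<dots> = s powr (\<gamma> - 1)" by (simp flip: powr_add)
  finally show ?thesis .
qed

text \<open>Two bounds for the profile w/(w+t-s) compete. The bound 1 yields (z/(z+s))^2, which
  suffices when z >= t or s > t/2, since then z+t <= 2(z+s). Otherwise the profile is at most 2w/t,
  and the extra w^2 integrates to (2z/t)^2, comparable to (z/(z+t))^2 because z < t. The worst
  constant is 16 * 14929920, rounded up.\<close>

lemma nn_integral_q0_sq_profile:
  assumes z: "z > 0" and s: "0 < s" "s < t" and g: "0 < \<gamma>" "\<gamma> \<le> 1/2"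
  shows "(\<integral>\<^sup>+w. ennreal ((q0 z w s)\<^sup>2 * w powr \<gamma> * (w / (w + (t - s)))\<^sup>2) * indicator {0<..} w \<partial>lborel)
    \<le> ennreal (240000000 * (z / (z + t))\<^sup>2 * s powr (\<gamma> - 1))" (is "?L \<le> _")
proof -
  have A: "?L \<le> ennreal (14929920 * (z / (z + s))\<^sup>2 * s powr (\<gamma> - 1))"
  proof -
    have "?L \<le> (\<integral>\<^sup>+w. ennreal ((q0 z w s)\<^sup>2 * w powr \<gamma>) * indicator {0<..} w \<partial>lborel)"
    proof (intro nn_integral_mono)
      fix w :: real
      have "(w / (w + (t - s)))\<^sup>2 \<le> 1" if "w > 0"
        using that s by (intro power_le_one) auto
      then show "ennreal ((q0 z w s)\<^sup>2 * w powr \<gamma> * (w / (w + (t - s)))\<^sup>2) * indicator {0<..} w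
        \<le> ennreal ((q0 z w s)\<^sup>2 * w powr \<gamma>) * indicator {0<..} w"
        by (auto simp: indicator_def intro!: ennreal_leI mult_left_le)
    qed
    also have "\<dots> \<le> ennreal (14929920 * z\<^sup>2 * (s powr (-1/2) * (z + s) powr (\<gamma> - 5/2)))"
      using assms by (intro nn_integral_q0_sq_powr) auto
    also have "(z + s) powr (\<gamma> - 5/2) = (z + s) powr (\<gamma> - 1/2) / (z + s)\<^sup>2"
      using z s powr_diff[of "z + s" "\<gamma> - 1/2" 2] by (simp add: powr_numeral)
    also have "14929920 * z\<^sup>2 * (s powr (-1/2) * ((z + s) powr (\<gamma> - 1/2) / (z + s)\<^sup>2))
      = 14929920 * (z / (z + s))\<^sup>2 * (s powr (-1/2) * (z + s) powr (\<gamma> - 1/2))"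
      by (simp add: power_divide)
    also have "ennreal \<dots> \<le> ennreal (14929920 * (z / (z + s))\<^sup>2 * s powr (\<gamma> - 1))"
      using assms by (intro ennreal_leI mult_left_mono powr_half_mix) auto
    finally show ?thesis .
  qed
  have B: "?L \<le> ennreal (14929920 * (2 * z / t)\<^sup>2 * s powr (\<gamma> - 1))" if st: "s \<le> t / 2"
  proof -
    have "?L \<le> (\<integral>\<^sup>+w. ennreal ((2/t)\<^sup>2) * (ennreal ((q0 z w s)\<^sup>2 * w powr (\<gamma> + 2)) * indicator {0<..} w) \<partial>lborel)"
    proof (intro nn_integral_mono)
      fix w :: real
      have "(q0 z w s)\<^sup>2 * w powr \<gamma> * (w / (w + (t - s)))\<^sup>2 \<le> (2/t)\<^sup>2 * ((q0 z w s)\<^sup>2 * w powr (\<gamma> + 2))" if w: "w > 0"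
      proof -
        have "w / (w + (t - s)) \<le> w / (t / 2)"
          using w s st by (intro divide_left_mono) auto
        then have "(w / (w + (t - s)))\<^sup>2 \<le> (w / (t/2))\<^sup>2"
          using w s by (intro power_mono) auto
        then have "(q0 z w s)\<^sup>2 * w powr \<gamma> * (w / (w + (t - s)))\<^sup>2 \<le> (q0 z w s)\<^sup>2 * w powr \<gamma> * (w / (t/2))\<^sup>2"
          by (intro mult_left_mono) auto
        also have "\<dots> = (2/t)\<^sup>2 * ((q0 z w s)\<^sup>2 * w powr (\<gamma> + 2))"
          using w by (simp add: powr_add powr_numeral power_divide power_mult_distrib)
        finally show ?thesis .
      qed
      then show "ennreal ((q0 z w s)\<^sup>2 * w powr \<gamma> * (w / (w + (t - s)))\<^sup>2) * indicator {0<..} w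
        \<le> ennreal ((2/t)\<^sup>2) * (ennreal ((q0 z w s)\<^sup>2 * w powr (\<gamma> + 2)) * indicator {0<..} w)"
        by (auto simp: indicator_def intro!: ennreal_leI simp flip: ennreal_mult)
    qed
    also have "\<dots> = ennreal ((2/t)\<^sup>2) * (\<integral>\<^sup>+w. (ennreal ((q0 z w s)\<^sup>2 * w powr (\<gamma> + 2)) * indicator {0<..} w) \<partial>lborel)"
      by (rule nn_integral_cmult) measurable
    also have "\<dots> \<le> ennreal ((2/t)\<^sup>2) * ennreal (14929920 * z\<^sup>2 * (s powr (-1/2) * (z + s) powr ((\<gamma> + 2) - 5/2)))"
      using assms by (intro mult_left_mono nn_integral_q0_sq_powr) auto
    also have "\<dots> = ennreal (14929920 * (2 * z / t)\<^sup>2 * (s powr (-1/2) * (z + s) powr (\<gamma> - 1/2)))"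
      by (subst ennreal_mult[symmetric]) (auto simp: power_divide power_mult_distrib)
    also have "\<dots> \<le> ennreal (14929920 * (2 * z / t)\<^sup>2 * s powr (\<gamma> - 1))"
      using assms by (intro ennreal_leI mult_left_mono powr_half_mix) auto
    finally show ?thesis .
  qed
  show ?thesis
  proof (cases "z \<ge> t \<or> s > t / 2")
    case True
    have "z / (z + s) \<le> 2 * (z / (z + t))"
    proof -
      have "z + t \<le> 2 * (z + s)" using True z s by auto
      then show ?thesis using z s by (simp add: divide_simps)
    qed
    then have "(z / (z + s))\<^sup>2 \<le> (2 * (z / (z + t)))\<^sup>2" using z s by (intro power_mono) auto
    also have "\<dots> = 4 * (z / (z + t))\<^sup>2" by (simp only: power_mult_distrib) simp
    also have "\<dots> \<le> 16 * (z / (z + t))\<^sup>2" by (intro mult_right_mono) auto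
    finally have "14929920 * (z / (z + s))\<^sup>2 \<le> 240000000 * (z / (z + t))\<^sup>2"
      using zero_le_power2[of "z / (z + t)"] by linarith
    then have "14929920 * (z / (z + s))\<^sup>2 * s powr (\<gamma> - 1) \<le> 240000000 * (z / (z + t))\<^sup>2 * s powr (\<gamma> - 1)"
      by (intro mult_right_mono) auto
    then show ?thesis using A by (meson ennreal_leI order_trans)
  next
    case False
    then have zt: "z < t" "s \<le> t/2" by auto
    have "2 * z / t \<le> 4 * (z / (z + t))" using zt z s by (simp add: divide_simps)
    then have "(2 * z / t)\<^sup>2 \<le> (4 * (z / (z + t)))\<^sup>2" using z s by (intro power_mono) auto
    also have "\<dots> = 16 * (z / (z + t))\<^sup>2" by (simp only: power_mult_distrib) simp
    finally have "14929920 * (2 * z / t)\<^sup>2 \<le> 240000000 * (z / (z + t))\<^sup>2"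
      using zero_le_power2[of "z / (z + t)"] by linarith
    then have "14929920 * (2 * z / t)\<^sup>2 * s powr (\<gamma> - 1) \<le> 240000000 * (z / (z + t))\<^sup>2 * s powr (\<gamma> - 1)"
      by (intro mult_right_mono) auto
    then show ?thesis using B[OF zt(2)] by (meson ennreal_leI order_trans)
  qed
qed

text \<open>In the exponent this is (a+b)^2/(B+c) <= a^2/B + b^2/c with a = sqrt z, b = sqrt w -
  sqrt z and c = 2s; the two sides differ by a square over a positive number.\<close>

lemma exp_weight_transport:
  assumes "z > 0" "w > 0" "s > 0" "B > 0"
  shows "exp (- z / B) * exp (- (sqrt z - sqrt w)\<^sup>2 / (2 * s)) \<le> exp (- w / (B + 2 * s))"
proof -
  define a b c where "a = sqrt z" and "b = sqrt w - sqrt z" and "c = 2 * s"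
  have c: "c > 0" using assms by (simp add: c_def)
  have "a\<^sup>2 / B + b\<^sup>2 / c - (a + b)\<^sup>2 / (B + c) = (a * c - b * B)\<^sup>2 / (B * c * (B + c))"
    using assms c by (simp add: divide_simps) (simp add: power2_eq_square algebra_simps)
  also have "\<dots> \<ge> 0" using assms c by simp
  finally have "(a + b)\<^sup>2 / (B + c) \<le> a\<^sup>2 / B + b\<^sup>2 / c" by simp
  then have "w / (B + 2 * s) \<le> z / B + (sqrt z - sqrt w)\<^sup>2 / (2 * s)"
    using assms by (simp add: a_def b_def c_def power2_commute)
  then show ?thesis by (simp flip: exp_add)
qed

text \<open>The integration runs over the first argument of \<open>q0\<close>, so
  \<open>q0_sq_le\<close> is taken with v = w. Half of the Gaussian transports the exponential
  weight from z to w, the other half integrates z^(\<gamma>+2).\<close>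

lemma nn_integral_q0_sq_adjoint:
  assumes w: "w > 0" and s: "s > 0" and B: "B > 0" and g: "0 < \<gamma>" "\<gamma> \<le> 1/2"
  shows "(\<integral>\<^sup>+z. ennreal ((q0 z w s)\<^sup>2 * z powr \<gamma> * exp (- z / B)) * indicator {0<..} z \<partial>lborel)
    \<le> ennreal (240000000 * (s powr (\<gamma> - 1) * exp (- w / (B + 2 * s))))"
proof -
  let ?c = "432 / (s * (s + w) ^ 3) * exp (- w / (B + 2 * s))"
  have c0: "?c \<ge> 0" using w s by simp
  have "(\<integral>\<^sup>+z. ennreal ((q0 z w s)\<^sup>2 * z powr \<gamma> * exp (- z / B)) * indicator {0<..} z \<partial>lborel)
     \<le> (\<integral>\<^sup>+z. ennreal ?c * (ennreal (z powr (\<gamma> + 2) * exp (- (sqrt w - sqrt z)\<^sup>2 / (2 * s))) * indicator {0<..} z) \<partial>lborel)"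
  proof (intro nn_integral_mono)
    fix z :: real
    show "ennreal ((q0 z w s)\<^sup>2 * z powr \<gamma> * exp (- z / B)) * indicator {0<..} z
      \<le> ennreal ?c * (ennreal (z powr (\<gamma> + 2) * exp (- (sqrt w - sqrt z)\<^sup>2 / (2 * s))) * indicator {0<..} z)"
    proof (cases "z > 0")
      case z: True
      let ?E = "exp (- (sqrt z - sqrt w)\<^sup>2 / (2 * s))"
      have EE: "exp (- (sqrt z - sqrt w)\<^sup>2 / s) = ?E * ?E"
        using s by (simp add: field_simps flip: exp_add)
      have "(q0 z w s)\<^sup>2 * z powr \<gamma> * exp (- z / B)
         \<le> 432 * z\<^sup>2 / (s * (s + w) ^ 3) * (?E * ?E) * z powr \<gamma> * exp (- z / B)"
        using q0_sq_le[OF z w s, of w] unfolding EE by (intro mult_right_mono) auto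
      also have "\<dots> = 432 * z\<^sup>2 / (s * (s + w) ^ 3) * ?E * z powr \<gamma> * (exp (- z / B) * ?E)" by simp
      also have "\<dots> \<le> 432 * z\<^sup>2 / (s * (s + w) ^ 3) * ?E * z powr \<gamma> * exp (- w / (B + 2 * s))"
        using z w s B by (intro mult_left_mono exp_weight_transport) auto
      also have "\<dots> = ?c * (z powr (\<gamma> + 2) * exp (- (sqrt w - sqrt z)\<^sup>2 / (2 * s)))"
        using z by (simp add: powr_add powr_numeral power2_commute)
      finally show ?thesis using z c0
        by (auto simp flip: ennreal_mult intro!: ennreal_leI)
    qed auto
  qed
  also have "\<dots> = ennreal ?c * (\<integral>\<^sup>+z. (ennreal (z powr (\<gamma> + 2) * exp (- (sqrt w - sqrt z)\<^sup>2 / (2 * s))) * indicator {0<..} z) \<partial>lborel)"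
    by (rule nn_integral_cmult) auto
  also have "\<dots> \<le> ennreal ?c * ennreal (34560 * (sqrt (2 * s) * (w + 2 * s) powr ((\<gamma> + 2) + 1/2)))"
    using assms by (intro mult_left_mono nn_integral_powr_sqrt_gaussian) auto
  also have "\<dots> = ennreal (?c * (34560 * (sqrt (2 * s) * (w + 2 * s) powr (\<gamma> + 5/2))))"
    using c0 w s by (subst ennreal_mult[symmetric]) (auto simp: add_ac)
  also have "\<dots> \<le> ennreal (?c * (34560 * (2 * sqrt s * (8 * (w + s) powr (\<gamma> + 5/2)))))"
  proof (intro ennreal_leI mult_left_mono mult_mono c0)
    show "sqrt (2 * s) \<le> 2 * sqrt s"
      using real_sqrt_le_mono[of 2 4] s by (simp add: real_sqrt_mult)
    have "(w + 2 * s) powr (\<gamma> + 5/2) \<le> (2 * (w + s)) powr (\<gamma> + 5/2)"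
      using w s g by (intro powr_mono2) auto
    also have "\<dots> = 2 powr (\<gamma> + 5/2) * (w + s) powr (\<gamma> + 5/2)" using w s by (intro powr_mult)
    also have "\<dots> \<le> 2 powr 3 * (w + s) powr (\<gamma> + 5/2)" using g by (intro mult_right_mono powr_mono) auto
    finally show "(w + 2 * s) powr (\<gamma> + 5/2) \<le> 8 * (w + s) powr (\<gamma> + 5/2)" by (simp add: powr_numeral)
  qed (use s in auto)
  also have "?c * (34560 * (2 * sqrt s * (8 * (w + s) powr (\<gamma> + 5/2))))
     = 238878720 * ((sqrt s / s) * ((w + s) powr (\<gamma> + 5/2) / (w + s) ^ 3)) * exp (- w / (B + 2 * s))"
    by (simp add: add_ac)
  also have "sqrt s / s = s powr (-1/2)"
    using s powr_diff[of s "1/2" 1] by (simp add: powr_half_sqrt)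
  also have "(w + s) powr (\<gamma> + 5/2) / (w + s) ^ 3 = (w + s) powr (\<gamma> - 1/2)"
    using w s powr_diff[of "w + s" "\<gamma>+5/2" 3] by (simp add: powr_numeral)
  also have "ennreal (238878720 * (s powr (-1/2) * (w + s) powr (\<gamma> - 1/2)) * exp (- w / (B + 2 * s)))
     \<le> ennreal (240000000 * (s powr (\<gamma> - 1)) * exp (- w / (B + 2 * s)))"
    using powr_half_mix[OF w s g(2)]
    by (intro ennreal_leI mult_right_mono mult_mono) auto
  finally show ?thesis by (simp add: mult_ac)
qed

section \<open>The quadrant and the squared kernel operator\<close>

lemma quadrant_set_measurable [measurable]: "{0<..} \<times> {0<..} \<in> sets (borel :: (real \<times> real) measure)"
  by (simp add: borel_prod[symmetric] pair_measureI)

lemma sigma_finite_quadrant: "sigma_finite_measure quadrant"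
  unfolding quadrant_def
  by (intro sigma_finite_measure_restrict_space sigma_finite_lborel) simp

lemma space_quadrant: "space quadrant = {0<..} \<times> {0<..}"
  by (simp add: quadrant_def space_restrict_space)

lemma measurable_quadrant_borel: "f \<in> borel \<rightarrow>\<^sub>M N \<Longrightarrow> f \<in> quadrant \<rightarrow>\<^sub>M N"
  unfolding quadrant_def by (rule measurable_restrict_space1) simp

lemma fst_snd_quadrant [measurable]:
  "fst \<in> quadrant \<rightarrow>\<^sub>M borel" "snd \<in> quadrant \<rightarrow>\<^sub>M borel"
  by (auto intro!: measurable_quadrant_borel borel_measurable_continuous_onI continuous_intros)

lemma nn_integral_quadrant:
  assumes "f \<in> borel_measurable quadrant"
  shows "(\<integral>\<^sup>+p. f p \<partial>quadrant) =
    (\<integral>\<^sup>+t. (\<integral>\<^sup>+w. f (w, t) * indicator {0<..} w \<partial>lborel) * indicator {0<..} t \<partial>lborel)"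
proof -
  let ?f = "\<lambda>p. f p * indicator ({0<..} \<times> {0<..}) p"
  have [measurable]: "?f \<in> borel_measurable (lborel \<Otimes>\<^sub>M lborel)"
    using assms unfolding quadrant_def lborel_prod
    by (subst (asm) borel_measurable_restrict_space_iff_ennreal) auto
  have "(\<integral>\<^sup>+p. f p \<partial>quadrant) = (\<integral>\<^sup>+p. ?f p \<partial>(lborel \<Otimes>\<^sub>M lborel))"
    unfolding quadrant_def lborel_prod by (subst nn_integral_restrict_space) auto
  also have "\<dots> = (\<integral>\<^sup>+t. (\<integral>\<^sup>+w. ?f (w, t) \<partial>lborel) \<partial>lborel)"
    by (rule lborel_pair.nn_integral_snd[symmetric]) measurable
  also have "\<dots> = (\<integral>\<^sup>+t. (\<integral>\<^sup>+w. f (w, t) * indicator {0<..} w \<partial>lborel) * indicator {0<..} t \<partial>lborel)"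
    by (intro nn_integral_cong) (auto simp: indicator_def)
  finally show ?thesis .
qed

text \<open>Values in \<open>ennreal\<close> keep the operator meaningful for second moments before
  anything is known about their integrability.\<close>

definition kernel_op :: "real \<Rightarrow> (real \<times> real \<Rightarrow> ennreal) \<Rightarrow> real \<Rightarrow> real \<Rightarrow> ennreal" where
  "kernel_op \<beta> g z t = (\<integral>\<^sup>+p. (if snd p < t
     then ennreal ((q0 z (fst p) (t - snd p))\<^sup>2 * min (fst p) 1 powr (2 * \<beta>)) * g p else 0) \<partial>quadrant)"

lemma kernel_op_mono:
  assumes "\<And>w \<tau>. 0 < w \<Longrightarrow> 0 < \<tau> \<Longrightarrow> \<tau> < t \<Longrightarrow> g (w, \<tau>) \<le> h (w, \<tau>)"
  shows "kernel_op \<beta> g z t \<le> kernel_op \<beta> h z t"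
  unfolding kernel_op_def
  by (intro nn_integral_mono) (auto simp: space_quadrant intro!: mult_left_mono assms)

lemma kernel_op_add:
  assumes [measurable]: "g \<in> borel_measurable quadrant" "h \<in> borel_measurable quadrant"
  shows "kernel_op \<beta> (\<lambda>p. g p + h p) z t = kernel_op \<beta> g z t + kernel_op \<beta> h z t"
  unfolding kernel_op_def
  by (subst nn_integral_add[symmetric]) (auto intro!: nn_integral_cong simp: distrib_left)

lemma kernel_op_cmult:
  assumes [measurable]: "g \<in> borel_measurable quadrant"
  shows "kernel_op \<beta> (\<lambda>p. c * g p) z t = c * kernel_op \<beta> g z t"
  unfolding kernel_op_def
  by (subst nn_integral_cmult[symmetric]) (auto intro!: nn_integral_cong simp: mult_ac)

text \<open>Below 1 the larger exponent gives the smaller power, and above 1 the cut-off side equals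
  1. Applied with b = 2 \<beta>, this trades the noise coefficient for the power that gains
  integrability in time.\<close>

lemma cutoff_powr_le:
  assumes "(w::real) > 0" "0 < \<gamma>" "\<gamma> \<le> b"
  shows "min w 1 powr b \<le> w powr \<gamma>"
proof (cases "w \<le> 1")
  case True
  then have "min w 1 = w" by simp
  then show ?thesis using True assms powr_mono'[of \<gamma> b w] by simp
next
  case False
  have "(1::real) \<le> w powr \<gamma>" using False assms by (intro ge_one_powr_ge_zero) auto
  with False show ?thesis by simp
qed

lemma nn_integral_powr_interval:
  assumes "a > 0" "T \<ge> 0"
  shows "(\<integral>\<^sup>+s. ennreal (s powr (a - 1)) * indicator {0<..<T} s \<partial>lborel) \<le> ennreal (T powr a / a)"
proof -
  have "(\<integral>\<^sup>+s. ennreal (s powr (a - 1)) * indicator {0<..<T} s \<partial>lborel)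
      \<le> (\<integral>\<^sup>+s. ennreal (s powr (a - 1)) * indicator {0..T} s \<partial>lborel)"
    by (intro nn_integral_mono) (auto simp: indicator_def)
  also have "\<dots> = ennreal (T powr a / a)"
    using has_integral_powr_from_0[of "a - 1" T] assms
    by (intro nn_integral_has_integral_lebesgue') auto
  finally show ?thesis .
qed

lemma nn_integral_powr_reflect:
  assumes "a > 0" "t \<ge> 0"
  shows "(\<integral>\<^sup>+\<tau>. ennreal ((t - \<tau>) powr (a - 1)) * indicator {0<..<t} \<tau> \<partial>lborel) \<le> ennreal (t powr a / a)"
proof -
  have "(\<integral>\<^sup>+\<tau>. ennreal ((t - \<tau>) powr (a - 1)) * indicator {0<..<t} \<tau> \<partial>lborel)
     = (\<integral>\<^sup>+s. ennreal (s powr (a - 1)) * indicator {0<..<t} s \<partial>lborel)"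
    by (subst nn_integral_real_affine[of _ "-1" t]) (auto intro!: nn_integral_cong simp: indicator_def)
  then show ?thesis using nn_integral_powr_interval[OF assms] by simp
qed

lemma nn_integral_powr_shift:
  assumes "a > 0" "\<tau> \<le> T"
  shows "(\<integral>\<^sup>+t. ennreal ((t - \<tau>) powr (a - 1)) * indicator {\<tau><..<T} t \<partial>lborel) \<le> ennreal ((T - \<tau>) powr a / a)"
proof -
  have "(\<integral>\<^sup>+t. ennreal ((t - \<tau>) powr (a - 1)) * indicator {\<tau><..<T} t \<partial>lborel)
     = (\<integral>\<^sup>+s. ennreal (s powr (a - 1)) * indicator {0<..<T - \<tau>} s \<partial>lborel)"
    by (subst nn_integral_real_affine[of _ "1" \<tau>]) (auto intro!: nn_integral_cong simp: indicator_def)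
  then show ?thesis using nn_integral_powr_interval[of a "T - \<tau>"] assms by simp
qed

text \<open>The spatial estimate leaves (t - \<tau>)^(\<gamma>-1), integrable up to \<tau> = t. The
  resulting factor t^\<gamma> is the smallness on which the comparison for small times
  rests.\<close>

lemma kernel_op_profile_le:
  assumes z: "z > 0" and t: "t > 0" and g: "0 < \<gamma>" "\<gamma> \<le> 1/2" "\<gamma> \<le> 2 * \<beta>"
  shows "kernel_op \<beta> (\<lambda>p. ennreal ((fst p / (fst p + snd p))\<^sup>2)) z t
    \<le> ennreal (240000000 / \<gamma> * t powr \<gamma> * (z / (z + t))\<^sup>2)"
proof -
  let ?c = "240000000 * (z / (z + t))\<^sup>2"
  let ?I = "\<lambda>\<tau>. \<integral>\<^sup>+w. (if \<tau> < t
     then ennreal ((q0 z w (t - \<tau>))\<^sup>2 * min w 1 powr (2 * \<beta>)) * ennreal ((w / (w + \<tau>))\<^sup>2) else 0)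
      * indicator {0<..} w \<partial>lborel"
  have "kernel_op \<beta> (\<lambda>p. ennreal ((fst p / (fst p + snd p))\<^sup>2)) z t
    = (\<integral>\<^sup>+\<tau>. ?I \<tau> * indicator {0<..} \<tau> \<partial>lborel)"
    unfolding kernel_op_def by (subst nn_integral_quadrant) (auto cong: if_cong)
  also have "\<dots> \<le> (\<integral>\<^sup>+\<tau>. ennreal ?c * (ennreal ((t - \<tau>) powr (\<gamma> - 1)) * indicator {0<..<t} \<tau>) \<partial>lborel)"
  proof (intro nn_integral_mono)
    fix \<tau> :: real
    show "?I \<tau> * indicator {0<..} \<tau> \<le> ennreal ?c * (ennreal ((t - \<tau>) powr (\<gamma> - 1)) * indicator {0<..<t} \<tau>)"
    proof (cases "0 < \<tau> \<and> \<tau> < t")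
      case True
      have "?I \<tau> \<le> (\<integral>\<^sup>+w. ennreal ((q0 z w (t - \<tau>))\<^sup>2 * w powr \<gamma> * (w / (w + (t - (t - \<tau>))))\<^sup>2) * indicator {0<..} w \<partial>lborel)"
        using True cutoff_powr_le[OF _ g(1) g(3)]
        by (intro nn_integral_mono)
           (auto simp: indicator_def simp flip: ennreal_mult intro!: ennreal_leI mult_right_mono mult_left_mono)
      also have "\<dots> \<le> ennreal (?c * (t - \<tau>) powr (\<gamma> - 1))"
        using True by (intro nn_integral_q0_sq_profile z g) auto
      finally show ?thesis using True by (simp add: ennreal_mult)
    qed (auto simp: indicator_def)
  qed
  also have "\<dots> = ennreal ?c * (\<integral>\<^sup>+\<tau>. (ennreal ((t - \<tau>) powr (\<gamma> - 1)) * indicator {0<..<t} \<tau>) \<partial>lborel)"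
    by (rule nn_integral_cmult) auto
  also have "\<dots> \<le> ennreal ?c * ennreal (t powr \<gamma> / \<gamma>)"
    using g t by (intro mult_left_mono nn_integral_powr_reflect) auto
  also have "\<dots> = ennreal (?c * (t powr \<gamma> / \<gamma>))"
    using g by (intro ennreal_mult[symmetric]) auto
  finally show ?thesis by (simp add: mult_ac)
qed

section \<open>Uniqueness for the squared-kernel inequality by a dual weight\<close>

lemma exp_neg_le_powr:
  assumes "(x::real) > 0" "0 \<le> p" "p \<le> 1"
  shows "exp (- x) \<le> x powr (- p)"
proof -
  have "x powr p \<le> exp x"
  proof (cases "x \<le> 1")
    case True
    then have "x powr p \<le> 1" using assms powr_mono2[of p x 1] by simp
    also have "1 \<le> exp x" using assms by simp
    finally show ?thesis .
  next
    case False
    then have "x powr p \<le> x powr 1" using assms by (intro powr_mono) auto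
    also have "x powr 1 = x" using assms by simp
    also have "x \<le> exp x" using exp_ge_add_one_self[of x] by linarith
    finally show ?thesis .
  qed
  then show ?thesis using assms by (simp add: exp_minus powr_minus divide_simps)
qed

text \<open>The rate $1 / (3T - 2t)$ solves $1/\varepsilon(t) + 2 (t - \tau) = 1/\varepsilon(\tau)$, so that
  \<open>exp_weight_transport\<close> carries the weight from time $t$ back to time $\tau$ without loss.\<close>

definition dual_weight :: "real \<Rightarrow> real \<Rightarrow> real \<times> real \<Rightarrow> real" where
  "dual_weight L T p = exp (- L * snd p) * exp (- fst p / (3 * T - 2 * snd p))"

lemma dual_weight_measurable [measurable]: "dual_weight L T \<in> borel_measurable quadrant"
  unfolding dual_weight_def by measurable

text \<open>The spatial weight is transported without loss, so only exp (-L (t - \<tau>)) (t -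
  \<tau>)^(\<gamma>-1) remains. By e^(-x) <= x^(-\<gamma>/2), half of the gain \<gamma> is spent on
  the small factor L^(-\<gamma>/2), while the other half keeps the time integral finite; division by
  \<gamma>/2 doubles the constant.\<close>

lemma dual_weight_supersolution:
  assumes w: "w > 0" and tau: "0 < \<tau>" "\<tau> < T" and L: "L > 0" and g: "0 < \<gamma>" "\<gamma> \<le> 1/2" "\<gamma> \<le> 2 * \<beta>"
  shows "(\<integral>\<^sup>+p. (if \<tau> < snd p \<and> snd p < T
        then ennreal ((q0 (fst p) w (snd p - \<tau>))\<^sup>2 * min (fst p) 1 powr (2 * \<beta>) * dual_weight L T p) else 0) \<partial>quadrant)
    \<le> ennreal (480000000 / \<gamma> * T powr (\<gamma>/2) * L powr (-\<gamma>/2) * dual_weight L T (w, \<tau>))" (is "?L \<le> _")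
proof -
  let ?c = "240000000 * L powr (-\<gamma>/2) * dual_weight L T (w, \<tau>)"
  have c0: "?c \<ge> 0" by (simp add: dual_weight_def)
  let ?i = "\<lambda>t z. (if \<tau> < t \<and> t < T
      then ennreal ((q0 z w (t - \<tau>))\<^sup>2 * min z 1 powr (2 * \<beta>) * dual_weight L T (z, t)) else 0) * indicator {0<..} z"
  have "?L = (\<integral>\<^sup>+t. (\<integral>\<^sup>+z. ?i t z \<partial>lborel) * indicator {0<..} t \<partial>lborel)"
    by (subst nn_integral_quadrant) (auto cong: if_cong)
  also have "\<dots> \<le> (\<integral>\<^sup>+t. ennreal ?c * (ennreal ((t - \<tau>) powr (\<gamma>/2 - 1)) * indicator {\<tau><..<T} t) \<partial>lborel)"
  proof (intro nn_integral_mono)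
    fix t :: real
    show "(\<integral>\<^sup>+z. ?i t z \<partial>lborel) * indicator {0<..} t
      \<le> ennreal ?c * (ennreal ((t - \<tau>) powr (\<gamma>/2 - 1)) * indicator {\<tau><..<T} t)"
    proof (cases "\<tau> < t \<and> t < T")
      case True
      define s B where "s = t - \<tau>" and "B = 3 * T - 2 * t"
      have s: "s > 0" and B: "B > 0" and Bs: "B + 2 * s = 3 * T - 2 * \<tau>"
        using True tau by (auto simp: s_def B_def)
      have "(\<integral>\<^sup>+z. ?i t z \<partial>lborel) \<le> (\<integral>\<^sup>+z. ennreal (exp (- L * t)) * (ennreal ((q0 z w s)\<^sup>2 * z powr \<gamma> * exp (- z / B)) * indicator {0<..} z) \<partial>lborel)"
      proof (intro nn_integral_mono)
        fix z :: real
        have "(q0 z w (t - \<tau>))\<^sup>2 * min z 1 powr (2 * \<beta>) * dual_weight L T (z, t)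
          \<le> exp (- L * t) * ((q0 z w s)\<^sup>2 * z powr \<gamma> * exp (- z / B))" if "z > 0"
        proof -
          have "(q0 z w s)\<^sup>2 * min z 1 powr (2 * \<beta>) * dual_weight L T (z, t)
            \<le> (q0 z w s)\<^sup>2 * z powr \<gamma> * dual_weight L T (z, t)"
            by (intro mult_right_mono mult_left_mono cutoff_powr_le that g) (auto simp: dual_weight_def)
          then show ?thesis by (simp add: s_def B_def dual_weight_def mult_ac)
        qed
        then show "?i t z \<le> ennreal (exp (- L * t)) * (ennreal ((q0 z w s)\<^sup>2 * z powr \<gamma> * exp (- z / B)) * indicator {0<..} z)"
          by (auto simp: indicator_def simp flip: ennreal_mult intro!: ennreal_leI)
      qed
      also have "\<dots> = ennreal (exp (- L * t)) * (\<integral>\<^sup>+z. (ennreal ((q0 z w s)\<^sup>2 * z powr \<gamma> * exp (- z / B)) * indicator {0<..} z) \<partial>lborel)"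
        by (rule nn_integral_cmult) measurable
      also have "\<dots> \<le> ennreal (exp (- L * t)) * ennreal (240000000 * (s powr (\<gamma> - 1) * exp (- w / (B + 2 * s))))"
        using g by (intro mult_left_mono nn_integral_q0_sq_adjoint w s B) auto
      also have "\<dots> = ennreal (exp (- L * t) * (240000000 * (s powr (\<gamma> - 1) * exp (- w / (B + 2 * s)))))"
        by (intro ennreal_mult[symmetric]) auto
      also have "\<dots> \<le> ennreal (?c * s powr (\<gamma>/2 - 1))"
      proof (rule ennreal_leI)
        have "exp (- (L * s)) \<le> (L * s) powr (- (\<gamma>/2))"
          using L s g by (intro exp_neg_le_powr) auto
        also have "\<dots> = L powr (-\<gamma>/2) * s powr (-\<gamma>/2)"
          using L s by (simp add: powr_mult)
        finally have "exp (- (L * s)) * s powr (\<gamma> - 1) \<le> L powr (-\<gamma>/2) * s powr (-\<gamma>/2) * s powr (\<gamma> - 1)"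
          by (intro mult_right_mono) auto
        also have "\<dots> = L powr (-\<gamma>/2) * s powr (\<gamma>/2 - 1)"
          by (simp add: mult.assoc flip: powr_add)
        finally have *: "exp (- (L * s)) * s powr (\<gamma> - 1) \<le> L powr (-\<gamma>/2) * s powr (\<gamma>/2 - 1)" .
        have "exp (- L * t) * (240000000 * (s powr (\<gamma> - 1) * exp (- w / (B + 2 * s))))
          = 240000000 * dual_weight L T (w, \<tau>) * (exp (- (L * s)) * s powr (\<gamma> - 1))"
        proof -
          have "exp (- L * t) = exp (- L * \<tau>) * exp (- (L * s))"
            by (simp add: s_def algebra_simps flip: exp_add)
          then show ?thesis by (simp add: dual_weight_def Bs)
        qed
        also have "\<dots> \<le> 240000000 * dual_weight L T (w, \<tau>) * (L powr (-\<gamma>/2) * s powr (\<gamma>/2 - 1))"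
          by (intro mult_left_mono *) (auto simp: dual_weight_def)
        finally show "exp (- L * t) * (240000000 * (s powr (\<gamma> - 1) * exp (- w / (B + 2 * s)))) \<le> ?c * s powr (\<gamma>/2 - 1)"
          by (simp add: mult_ac)
      qed
      finally show ?thesis using True tau c0
        by (simp add: s_def flip: ennreal_mult)
    qed (auto simp: indicator_def)
  qed
  also have "\<dots> = ennreal ?c * (\<integral>\<^sup>+t. (ennreal ((t - \<tau>) powr (\<gamma>/2 - 1)) * indicator {\<tau><..<T} t) \<partial>lborel)"
    by (rule nn_integral_cmult) auto
  also have "\<dots> \<le> ennreal ?c * ennreal ((T - \<tau>) powr (\<gamma>/2) / (\<gamma>/2))"
    using g tau by (intro mult_left_mono nn_integral_powr_shift) auto
  also have "\<dots> \<le> ennreal ?c * ennreal (T powr (\<gamma>/2) / (\<gamma>/2))"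
    using g tau by (intro mult_left_mono ennreal_leI divide_right_mono powr_mono2) auto
  also have "\<dots> = ennreal (?c * (T powr (\<gamma>/2) / (\<gamma>/2)))"
    using c0 g by (intro ennreal_mult[symmetric]) auto
  also have "?c * (T powr (\<gamma>/2) / (\<gamma>/2)) = 480000000 / \<gamma> * T powr (\<gamma>/2) * L powr (-\<gamma>/2) * dual_weight L T (w, \<tau>)"
    by simp
  finally show ?thesis .
qed

text \<open>The integral \<open>N\<close> of g against the dual weight is finite by
  \<open>fin\<close>. Testing the inequality with this weight and exchanging the integrals gives N
  <= N/2, so g vanishes almost everywhere before T. Then its \<open>kernel_op\<close> vanishes, and
  \<open>le\<close>, which holds at every point, upgrades this to g = 0 pointwise up to T.\<close>

lemma kernel_gronwall:
  assumes \<beta>: "\<beta> > 0" and T: "T > 0"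
    and [measurable]: "g \<in> borel_measurable quadrant"
    and fin: "kernel_op \<beta> g 1 (7 * T) < \<infinity>"
    and le: "\<And>z t. 0 < z \<Longrightarrow> 0 < t \<Longrightarrow> t \<le> T \<Longrightarrow> g (z, t) \<le> ennreal K * kernel_op \<beta> g z t"
    and z: "z > 0" and t: "0 < t" "t \<le> T"
  shows "g (z, t) = 0"
proof -
  define \<gamma> where "\<gamma> = min (2 * \<beta>) (1/2)"
  have \<gamma>: "0 < \<gamma>" "\<gamma> \<le> 1/2" "\<gamma> \<le> 2 * \<beta>" using \<beta> by (auto simp: \<gamma>_def)
  define D where "D = 480000000 / \<gamma> * T powr (\<gamma>/2)"
  have D: "D \<ge> 0" using \<gamma> by (simp add: D_def)
  \<comment> \<open>\<open>J\<close> makes |K| D / J at most 1/2, and \<open>L\<close> is chosen so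
    that L^(-\<gamma>/2) = 1/J; the maximum with 1 keeps \<open>J\<close> positive for K =
    0.\<close>
  define J where "J = max 1 (2 * \<bar>K\<bar> * D)"
  define L where "L = J powr (2/\<gamma>)"
  have J: "J > 0" by (simp add: J_def)
  have L: "L > 0" using J by (simp add: L_def)
  have LJ: "L powr (-\<gamma>/2) = 1 / J"
    using J \<gamma> by (simp add: L_def powr_powr powr_minus divide_simps)
  have KD: "\<bar>K\<bar> * (D / J) \<le> 1/2" using J by (simp add: J_def field_simps)
  define a where "a p = min (fst p) 1 powr (2 * \<beta>)" for p :: "real \<times> real"
  have [measurable]: "a \<in> borel_measurable quadrant" unfolding a_def by measurable
  \<comment> \<open>The factor \<open>a\<close> belongs to the test weight: after the exchange,
    \<open>a p\<close> is the coefficient integrated in \<open>dual_weight_supersolution\<close>,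
    while the \<open>a q\<close> that comes from \<open>kernel_op\<close> rebuilds
    \<open>N\<close>.\<close>
  define N where "N = (\<integral>\<^sup>+p. (if snd p < T then ennreal (a p * dual_weight L T p) * g p else 0) \<partial>quadrant)"
  have w0: "dual_weight L T p \<ge> 0" for p by (simp add: dual_weight_def)
  have a0: "a p \<ge> 0" for p by (simp add: a_def)
  have "N < \<infinity>"
  proof - \<comment> \<open>For $\tau < T$ one has $7T - \tau > 6T$, so $q_0(1,w,7T-\tau)^2$ decays no faster than $e^{-w/(3T)}$.\<close>
    define c where "c = (7 * T) ^ 4 * exp (1 / (3 * T))"
    have c: "c > 0" using T by (simp add: c_def)
    have "N \<le> (\<integral>\<^sup>+p. ennreal c * (if snd p < 7 * T
     then ennreal ((q0 1 (fst p) (7 * T - snd p))\<^sup>2 * min (fst p) 1 powr (2 * \<beta>)) * g p else 0) \<partial>quadrant)"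
      unfolding N_def
    proof (intro nn_integral_mono)
      fix p assume "p \<in> space quadrant"
      then obtain w \<tau> where p: "p = (w, \<tau>)" and w: "w > 0" "\<tau> > 0" by (auto simp: space_quadrant)
      have "dual_weight L T p \<le> c * (q0 1 w (7 * T - \<tau>))\<^sup>2" if \<tau>: "\<tau> < T"
      proof -
        define s where "s = 7 * T - \<tau>"
        have s: "s > 6 * T" "s < 7 * T" "s > 0" using w \<tau> T by (auto simp: s_def)
        have "1 / (7 * T)\<^sup>2 * exp (- (1 + w) / (6 * T)) \<le> 1 / s\<^sup>2 * exp (- (1 + w) / s)"
        proof (intro mult_mono)
          show "1 / (7 * T)\<^sup>2 \<le> 1 / s\<^sup>2" using s by (intro divide_left_mono power_mono) auto
          have "(1 + w) / s \<le> (1 + w) / (6 * T)" using s w T by (intro divide_left_mono) auto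
          then have "- ((1 + w) / (6 * T)) \<le> - ((1 + w) / s)" by linarith
          then show "exp (- (1 + w) / (6 * T)) \<le> exp (- (1 + w) / s)"
            by (simp only: exp_le_cancel_iff minus_divide_left)
        qed auto
        also have "\<dots> \<le> q0 1 w s" using q0_ge[of 1 w s] w s by simp
        finally have "(1 / (7 * T)\<^sup>2 * exp (- (1 + w) / (6 * T)))\<^sup>2 \<le> (q0 1 w s)\<^sup>2"
          by (intro power_mono) auto
        then have "c * (1 / (7 * T)\<^sup>2 * exp (- (1 + w) / (6 * T)))\<^sup>2 \<le> c * (q0 1 w s)\<^sup>2"
          using c by (intro mult_left_mono) auto
        moreover have "c * (1 / (7 * T)\<^sup>2 * exp (- (1 + w) / (6 * T)))\<^sup>2 = exp (- w / (3 * T))"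
        proof -
          have "(exp (- (1 + w) / (6 * T)))\<^sup>2 = exp (- (1 + w) / (3 * T))"
          proof -
            have "2 * (- (1 + w) / (6 * T)) = - (1 + w) / (3 * T)" using T by (simp add: divide_simps)
            then show ?thesis by (simp only: exp_double[symmetric])
          qed
          moreover have "exp (1 / (3 * T)) * exp (- (1 + w) / (3 * T)) = exp (- w / (3 * T))"
            by (simp flip: exp_add add_divide_distrib)
          ultimately show ?thesis using T
            by (simp add: c_def power_mult_distrib power_divide flip: power_mult)
        qed
        moreover have "dual_weight L T p \<le> exp (- w / (3 * T))"
        proof -
          have "w / (3 * T) \<le> w / (3 * T - 2 * \<tau>)" using w \<tau> T by (intro divide_left_mono) auto
          then have "exp (- w / (3 * T - 2 * \<tau>)) \<le> exp (- w / (3 * T))" by simp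
          moreover have "exp (- L * \<tau>) \<le> 1" using L w by simp
          ultimately have "exp (- L * \<tau>) * exp (- w / (3 * T - 2 * \<tau>)) \<le> 1 * exp (- w / (3 * T))"
            by (intro mult_mono) auto
          then show ?thesis by (simp add: p dual_weight_def)
        qed
        ultimately show ?thesis by (simp add: s_def)
      qed
      then have "ennreal (a p * dual_weight L T p) \<le> ennreal c * ennreal ((q0 1 w (7 * T - \<tau>))\<^sup>2 * a p)" if "\<tau> < T"
        using that c a0[of p] by (auto simp flip: ennreal_mult intro!: ennreal_leI simp: mult_ac intro: mult_left_mono)
           (metis mult.left_commute mult_left_mono)
      then show "(if snd p < T then ennreal (a p * dual_weight L T p) * g p else 0)
        \<le> ennreal c * (if snd p < 7 * T
           then ennreal ((q0 1 (fst p) (7 * T - snd p))\<^sup>2 * min (fst p) 1 powr (2 * \<beta>)) * g p else 0)"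
        using T w by (auto simp: p a_def mult.assoc[symmetric] intro!: mult_right_mono)
    qed
    also have "\<dots> = ennreal c * kernel_op \<beta> g 1 (7 * T)"
      unfolding kernel_op_def by (rule nn_integral_cmult) measurable
    also have "\<dots> < \<infinity>" using fin by (simp add: ennreal_mult_less_top)
    finally show ?thesis .
  qed
  interpret Q: sigma_finite_measure quadrant by (rule sigma_finite_quadrant)
  interpret QQ: pair_sigma_finite quadrant quadrant ..
  let ?F = "\<lambda>p q. if snd q < snd p \<and> snd p < T
     then ennreal ((q0 (fst p) (fst q) (snd p - snd q))\<^sup>2 * a p * dual_weight L T p) * (ennreal (a q) * g q) else 0"
  have [measurable]: "(\<lambda>(p, q). ?F p q) \<in> borel_measurable (quadrant \<Otimes>\<^sub>M quadrant)"
    by measurable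
  have "N \<le> (\<integral>\<^sup>+p. ennreal \<bar>K\<bar> * (\<integral>\<^sup>+q. ?F p q \<partial>quadrant) \<partial>quadrant)"
    unfolding N_def
  proof (intro nn_integral_mono)
    fix p assume "p \<in> space quadrant"
    then obtain z t where p: "p = (z, t)" and zt: "z > 0" "t > 0" by (auto simp: space_quadrant)
    show "(if snd p < T then ennreal (a p * dual_weight L T p) * g p else 0) \<le> ennreal \<bar>K\<bar> * (\<integral>\<^sup>+q. ?F p q \<partial>quadrant)"
    proof (cases "t < T")
      case True
      have "ennreal (a p * dual_weight L T p) * g p \<le> ennreal (a p * dual_weight L T p) * (ennreal \<bar>K\<bar> * kernel_op \<beta> g z t)"
      proof (intro mult_left_mono)
        have "g p \<le> ennreal K * kernel_op \<beta> g z t" using le[of z t] zt True by (simp add: p)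
        also have "\<dots> \<le> ennreal \<bar>K\<bar> * kernel_op \<beta> g z t" by (intro mult_right_mono ennreal_leI) auto
        finally show "g p \<le> ennreal \<bar>K\<bar> * kernel_op \<beta> g z t" .
      qed auto
      also have "\<dots> = ennreal \<bar>K\<bar> * (ennreal (a p * dual_weight L T p) * kernel_op \<beta> g z t)"
        by (simp add: mult_ac)
      also have "ennreal (a p * dual_weight L T p) * kernel_op \<beta> g z t = (\<integral>\<^sup>+q. ?F p q \<partial>quadrant)"
        unfolding kernel_op_def using a0[of p] w0[of p]
        by (subst nn_integral_cmult[symmetric])
           (auto intro!: nn_integral_cong simp: p True a_def ennreal_mult mult_ac)
      finally show ?thesis using True by (simp add: p)
    qed (simp add: p)
  qed
  also have "\<dots> = ennreal \<bar>K\<bar> * (\<integral>\<^sup>+p. (\<integral>\<^sup>+q. ?F p q \<partial>quadrant) \<partial>quadrant)"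
    by (rule nn_integral_cmult) measurable
  also have "(\<integral>\<^sup>+p. (\<integral>\<^sup>+q. ?F p q \<partial>quadrant) \<partial>quadrant) = (\<integral>\<^sup>+q. (\<integral>\<^sup>+p. ?F p q \<partial>quadrant) \<partial>quadrant)"
    by (rule QQ.Fubini') measurable
  also have "\<dots> \<le> (\<integral>\<^sup>+q. ennreal (D / J) * (if snd q < T then ennreal (a q * dual_weight L T q) * g q else 0) \<partial>quadrant)"
  proof (intro nn_integral_mono)
    fix q assume "q \<in> space quadrant"
    then obtain w \<tau> where q: "q = (w, \<tau>)" and w: "w > 0" "\<tau> > 0" by (auto simp: space_quadrant)
    show "(\<integral>\<^sup>+p. ?F p q \<partial>quadrant) \<le> ennreal (D / J) * (if snd q < T then ennreal (a q * dual_weight L T q) * g q else 0)"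
    proof (cases "\<tau> < T")
      case True
      have "(\<integral>\<^sup>+p. ?F p q \<partial>quadrant) = (\<integral>\<^sup>+p. (if \<tau> < snd p \<and> snd p < T
          then ennreal ((q0 (fst p) w (snd p - \<tau>))\<^sup>2 * min (fst p) 1 powr (2 * \<beta>) * dual_weight L T p) else 0)
          * (ennreal (a q) * g q) \<partial>quadrant)"
        by (intro nn_integral_cong) (auto simp: q a_def)
      also have "\<dots> = (\<integral>\<^sup>+p. (if \<tau> < snd p \<and> snd p < T
          then ennreal ((q0 (fst p) w (snd p - \<tau>))\<^sup>2 * min (fst p) 1 powr (2 * \<beta>) * dual_weight L T p) else 0)
           \<partial>quadrant) * (ennreal (a q) * g q)"
        by (rule nn_integral_multc) measurable
      also have "\<dots> \<le> ennreal (D * L powr (-\<gamma>/2) * dual_weight L T (w, \<tau>)) * (ennreal (a q) * g q)"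
        unfolding D_def by (intro mult_right_mono dual_weight_supersolution w True L \<gamma>) auto
      also have "\<dots> = ennreal (D / J) * (ennreal (a q * dual_weight L T q) * g q)"
      proof -
        have "ennreal (D * L powr (-\<gamma>/2) * dual_weight L T (w, \<tau>)) * ennreal (a q)
            = ennreal (D * L powr (-\<gamma>/2) * dual_weight L T (w, \<tau>) * a q)"
          using D w0[of q] a0[of q] by (intro ennreal_mult[symmetric]) (auto simp: q)
        also have "\<dots> = ennreal (D / J * (a q * dual_weight L T q))"
          unfolding LJ by (simp add: q mult_ac)
        also have "\<dots> = ennreal (D / J) * ennreal (a q * dual_weight L T q)"
          using D J w0[of q] a0[of q] by (intro ennreal_mult) auto
        finally show ?thesis by (simp only: mult.assoc[symmetric])
      qed
      finally show ?thesis using True by (simp add: q)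
    next
      case False
      then have "(\<integral>\<^sup>+p. ?F p q \<partial>quadrant) = (\<integral>\<^sup>+p. 0 \<partial>quadrant)"
        by (intro nn_integral_cong) (auto simp: q)
      then show ?thesis by simp
    qed
  qed
  also have "\<dots> = ennreal (D / J) * N"
    unfolding N_def by (rule nn_integral_cmult) measurable
  also have "ennreal \<bar>K\<bar> * (ennreal (D / J) * N) = ennreal (\<bar>K\<bar> * (D / J)) * N"
    using D J by (subst ennreal_mult) (auto simp: mult.assoc)
  also have "\<dots> \<le> ennreal (1/2) * N" by (intro mult_right_mono ennreal_leI KD) auto
  finally have "N \<le> ennreal (1/2) * N" by (simp add: mult_left_mono)
  \<comment> \<open>Finiteness is decisive here, because N <= N/2 also holds for an infinite
    \<open>N\<close>.\<close>
  then have "N = 0"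
  proof -
    obtain r where r: "N = ennreal r" "r \<ge> 0" using \<open>N < \<infinity>\<close> by (cases N) auto
    have "ennreal r \<le> ennreal (1/2 * r)"
      using \<open>N \<le> ennreal (1/2) * N\<close> unfolding r(1) by (subst ennreal_mult) (use r in auto)
    then have "r = 0" using r(2) by (subst (asm) ennreal_le_iff) auto
    then show ?thesis using r by simp
  qed
  then have "AE p in quadrant. (if snd p < T then ennreal (a p * dual_weight L T p) * g p else 0) = 0"
    unfolding N_def by (subst (asm) nn_integral_0_iff_AE) auto
  then have "AE p in quadrant. snd p < T \<longrightarrow> g p = 0"
  proof (rule AE_mp, intro AE_I2 impI)
    fix p assume "p \<in> space quadrant" "(if snd p < T then ennreal (a p * dual_weight L T p) * g p else 0) = 0" "snd p < T"
    moreover from this have "a p * dual_weight L T p > 0"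
      by (auto simp: a_def dual_weight_def space_quadrant)
    ultimately show "g p = 0" by (auto simp: not_le)
  qed
  then have "AE p in quadrant. (if snd p < t
     then ennreal ((q0 z (fst p) (t - snd p))\<^sup>2 * min (fst p) 1 powr (2 * \<beta>)) * g p else 0) = 0"
    by (rule AE_mp) (use t in auto)
  then have "kernel_op \<beta> g z t = (\<integral>\<^sup>+p. 0 \<partial>quadrant)"
    unfolding kernel_op_def by (intro nn_integral_cong_AE)
  then show ?thesis using le[OF z t] by simp
qed

section \<open>Density of bounded algebras in $L^2$\<close>

lemma L2_spaceD:
  assumes "f \<in> L2_space N"
  shows L2_measurable: "f \<in> borel_measurable N" and L2_integrable_sq: "integrable N (\<lambda>x. (f x)\<^sup>2 :: real)"
  using assms by (auto simp: L2_space_def)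

lemma L2_mult_integrable:
  assumes "f \<in> L2_space N" "g \<in> L2_space N"
  shows "integrable N (\<lambda>x. f x * g x :: real)"
proof (rule Bochner_Integration.integrable_bound)
  show "integrable N (\<lambda>x. (f x)\<^sup>2 + (g x)\<^sup>2)" using assms by (auto simp: L2_space_def)
  show "(\<lambda>x. f x * g x) \<in> borel_measurable N" using assms by (auto simp: L2_space_def)
  have "\<bar>a * b\<bar> \<le> a\<^sup>2 + b\<^sup>2" for a b :: real
  proof -
    have "2 * (\<bar>a\<bar> * \<bar>b\<bar>) \<le> a\<^sup>2 + b\<^sup>2" using sum_squares_bound[of "\<bar>a\<bar>" "\<bar>b\<bar>"] by simp
    moreover have "0 \<le> \<bar>a\<bar> * \<bar>b\<bar>" by simp
    ultimately show ?thesis unfolding abs_mult by linarith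
  qed
  then show "AE x in N. norm (f x * g x) \<le> norm ((f x)\<^sup>2 + (g x)\<^sup>2)" by auto
qed

lemma L2_lincomb:
  assumes "f \<in> L2_space N" "g \<in> L2_space N"
  shows "(\<lambda>x. a * f x + b * g x) \<in> L2_space N"
proof -
  have "integrable N (\<lambda>x. a\<^sup>2 * (f x)\<^sup>2 + 2 * a * b * (f x * g x) + b\<^sup>2 * (g x)\<^sup>2)"
    using L2_integrable_sq[OF assms(1)] L2_integrable_sq[OF assms(2)] L2_mult_integrable[OF assms] by simp
  then have "integrable N (\<lambda>x. (a * f x + b * g x)\<^sup>2)"
    by (simp add: power2_sum power_mult_distrib mult_ac add_ac)
  then show ?thesis using assms unfolding L2_space_def by auto
qed

lemma L2_add: "f \<in> L2_space N \<Longrightarrow> g \<in> L2_space N \<Longrightarrow> (\<lambda>x. f x + g x) \<in> L2_space N"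
  using L2_lincomb[of f _ g 1 1] by simp

lemma L2_diff: "f \<in> L2_space N \<Longrightarrow> g \<in> L2_space N \<Longrightarrow> (\<lambda>x. f x - g x) \<in> L2_space N"
  using L2_lincomb[of f _ g 1 "-1"] by simp

lemma L2_cmult: "f \<in> L2_space N \<Longrightarrow> (\<lambda>x. c * f x) \<in> L2_space N"
  using L2_lincomb[of f _ f c 0] by simp

lemma L2_bound:
  assumes "g \<in> L2_space N" "f \<in> borel_measurable N" "AE x in N. \<bar>f x\<bar> \<le> \<bar>g x\<bar>"
  shows "f \<in> L2_space N"
proof -
  have "integrable N (\<lambda>x. (f x)\<^sup>2)"
  proof (rule Bochner_Integration.integrable_bound[OF L2_integrable_sq[OF assms(1)]])
    show "AE x in N. norm ((f x)\<^sup>2) \<le> norm ((g x)\<^sup>2)"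
      using assms(3) by (auto simp: abs_le_square_iff)
  qed (use assms in auto)
  then show ?thesis using assms by (auto simp: L2_space_def)
qed

lemma L2_cauchy_schwarz:
  assumes f: "f \<in> L2_space N" and g: "g \<in> L2_space N"
  shows "(LINT x|N. f x * g x)\<^sup>2 \<le> (LINT x|N. (f x)\<^sup>2) * (LINT x|N. (g x)\<^sup>2)"
proof -
  let ?a = "LINT x|N. (f x)\<^sup>2" and ?b = "LINT x|N. f x * g x" and ?c = "LINT x|N. (g x)\<^sup>2"
  have q: "0 \<le> ?a * s\<^sup>2 + 2 * s * ?b + ?c" for s
  proof -
    have "0 \<le> (LINT x|N. (s * f x + g x)\<^sup>2)" by simp
    also have "\<dots> = (LINT x|N. s\<^sup>2 * (f x)\<^sup>2 + 2 * s * (f x * g x) + (g x)\<^sup>2)"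
      by (intro Bochner_Integration.integral_cong) (auto simp: power2_sum power_mult_distrib)
    also have "\<dots> = ?a * s\<^sup>2 + 2 * s * ?b + ?c"
      using L2_integrable_sq[OF f] L2_integrable_sq[OF g] L2_mult_integrable[OF f g] by simp
    finally show ?thesis .
  qed
  show ?thesis
  proof (cases "?a = 0")
    case True
    have "?b = 0"
    proof (rule ccontr)
      assume b: "?b \<noteq> 0"
      have "0 \<le> 2 * (- (?c + 1) / (2 * ?b)) * ?b + ?c" using q[of "- (?c + 1) / (2 * ?b)"] True by simp
      also have "2 * (- (?c + 1) / (2 * ?b)) * ?b = - (?c + 1)" using b by simp
      finally show False by simp
    qed
    then show ?thesis by simp
  next
    case False
    then have a: "?a > 0" using Bochner_Integration.integral_nonneg[of N "\<lambda>x. (f x)\<^sup>2"] by (simp add: less_le)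
    have "0 \<le> ?a * (- ?b / ?a)\<^sup>2 + 2 * (- ?b / ?a) * ?b + ?c" by (rule q)
    also have "\<dots> = ?c - ?b\<^sup>2 / ?a" using a by (simp add: power2_eq_square field_simps)
    finally show ?thesis using a by (simp add: field_simps)
  qed
qed

section \<open>The L2-closure of a bounded algebra of random variables\<close>

locale bounded_algebra = prob_space M for M :: "'w measure" +
  fixes A :: "('w \<Rightarrow> real) set"
  assumes alg_measurable: "a \<in> A \<Longrightarrow> a \<in> borel_measurable M"
    and alg_bounded: "a \<in> A \<Longrightarrow> \<exists>B. \<forall>\<omega>\<in>space M. \<bar>a \<omega>\<bar> \<le> B"
    and alg_add: "a \<in> A \<Longrightarrow> b \<in> A \<Longrightarrow> (\<lambda>\<omega>. a \<omega> + b \<omega>) \<in> A"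
    and alg_mult: "a \<in> A \<Longrightarrow> b \<in> A \<Longrightarrow> (\<lambda>\<omega>. a \<omega> * b \<omega>) \<in> A"
    and alg_const: "(\<lambda>\<omega>. c) \<in> A"
begin

lemma alg_L2: assumes "a \<in> A" shows "a \<in> L2_space M"
proof -
  obtain B where B: "\<forall>\<omega>\<in>space M. \<bar>a \<omega>\<bar> \<le> B" using alg_bounded[OF assms] by auto
  have "(\<lambda>\<omega>. B) \<in> L2_space M" by (auto simp: L2_space_def)
  then show ?thesis
  proof (rule L2_bound)
    show "a \<in> borel_measurable M" by (rule alg_measurable[OF assms])
    show "AE \<omega> in M. \<bar>a \<omega>\<bar> \<le> \<bar>B\<bar>" using B by (intro AE_I2 order_trans[OF _ abs_ge_self]) auto
  qed
qed

definition approximable :: "('w \<Rightarrow> real) \<Rightarrow> bool" where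
  "approximable f \<longleftrightarrow> f \<in> L2_space M \<and> (\<forall>\<epsilon>>0. \<exists>a\<in>A. (LINT \<omega>|M. (f \<omega> - a \<omega>)\<^sup>2) < \<epsilon>)"

lemma integral_diff_sq_le:
  assumes "f \<in> L2_space M" "g \<in> L2_space M" "h \<in> L2_space M"
  shows "(LINT \<omega>|M. (f \<omega> - h \<omega>)\<^sup>2) \<le> 2 * (LINT \<omega>|M. (f \<omega> - g \<omega>)\<^sup>2) + 2 * (LINT \<omega>|M. (g \<omega> - h \<omega>)\<^sup>2)"
proof -
  have "(x - z)\<^sup>2 \<le> 2 * (x - y)\<^sup>2 + 2 * (y - z)\<^sup>2" for x y z :: real
    using sum_squares_bound[of "x - y" "y - z"] by (simp add: power2_eq_square algebra_simps)
  then have "(LINT \<omega>|M. (f \<omega> - h \<omega>)\<^sup>2) \<le> (LINT \<omega>|M. 2 * (f \<omega> - g \<omega>)\<^sup>2 + 2 * (g \<omega> - h \<omega>)\<^sup>2)"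
    using assms by (intro integral_mono) (auto intro!: Bochner_Integration.integrable_add integrable_mult_right L2_integrable_sq L2_diff)
  also have "\<dots> = 2 * (LINT \<omega>|M. (f \<omega> - g \<omega>)\<^sup>2) + 2 * (LINT \<omega>|M. (g \<omega> - h \<omega>)\<^sup>2)"
    using assms by (subst Bochner_Integration.integral_add) (auto intro!: integrable_mult_right L2_integrable_sq L2_diff)
  finally show ?thesis .
qed

lemma approximable_closed:
  assumes f: "f \<in> L2_space M" and ap: "\<And>\<epsilon>. \<epsilon> > 0 \<Longrightarrow> \<exists>g. approximable g \<and> (LINT \<omega>|M. (f \<omega> - g \<omega>)\<^sup>2) < \<epsilon>"
  shows "approximable f"
  unfolding approximable_def
proof (intro conjI f allI impI)
  fix \<epsilon> :: real assume e: "\<epsilon> > 0"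
  then obtain g where g: "approximable g" "(LINT \<omega>|M. (f \<omega> - g \<omega>)\<^sup>2) < \<epsilon> / 4" using ap[of "\<epsilon> / 4"] by auto
  then obtain a where a: "a \<in> A" "(LINT \<omega>|M. (g \<omega> - a \<omega>)\<^sup>2) < \<epsilon> / 4"
    using e unfolding approximable_def by (meson divide_pos_pos zero_less_numeral)
  show "\<exists>a\<in>A. (LINT \<omega>|M. (f \<omega> - a \<omega>)\<^sup>2) < \<epsilon>"
    using integral_diff_sq_le[OF f _ alg_L2[OF a(1)], of g] g a by (intro bexI[of _ a]) (auto simp: approximable_def)
qed

lemma alg_approximable: "a \<in> A \<Longrightarrow> approximable a"
  unfolding approximable_def using alg_L2 by (auto intro!: bexI[of _ a])

text \<open>Under a square-integrable majorant, pointwise convergence implies L2 convergence. In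
  this form closedness produces indicators from continuous functions and countable unions from
  finite ones.\<close>

lemma approximable_dominated:
  assumes ap: "\<And>k. approximable (F k)" and G: "G \<in> L2_space M" and f: "f \<in> borel_measurable M"
    and lim: "AE \<omega> in M. (\<lambda>k. F k \<omega>) \<longlonglongrightarrow> f \<omega>" and bd: "\<And>k. AE \<omega> in M. \<bar>F k \<omega>\<bar> \<le> \<bar>G \<omega>\<bar>"
  shows "approximable f"
proof (rule approximable_closed)
  have [measurable]: "F k \<in> borel_measurable M" for k using ap[of k] by (auto simp: approximable_def L2_space_def)
  have "AE \<omega> in M. \<forall>k. \<bar>F k \<omega>\<bar> \<le> \<bar>G \<omega>\<bar>" using bd by (simp add: AE_all_countable)
  with lim have fG: "AE \<omega> in M. \<bar>f \<omega>\<bar> \<le> \<bar>G \<omega>\<bar>"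
  proof eventually_elim
    case (elim \<omega>)
    then show ?case by (intro LIMSEQ_le_const2[of "\<lambda>k. \<bar>F k \<omega>\<bar>"] tendsto_rabs) auto
  qed
  show "f \<in> L2_space M" by (rule L2_bound[OF G f fG])
  have "(\<lambda>k. LINT \<omega>|M. (f \<omega> - F k \<omega>)\<^sup>2) \<longlonglongrightarrow> (LINT \<omega>|M. 0)"
  proof (rule integral_dominated_convergence[where w = "\<lambda>\<omega>. 4 * (G \<omega>)\<^sup>2"])
    show "integrable M (\<lambda>\<omega>. 4 * (G \<omega>)\<^sup>2)" using L2_integrable_sq[OF G] by simp
    show "AE \<omega> in M. (\<lambda>k. (f \<omega> - F k \<omega>)\<^sup>2) \<longlonglongrightarrow> 0"
      using lim
    proof eventually_elim
      case (elim \<omega>)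
      have "(\<lambda>k. (f \<omega> - F k \<omega>)\<^sup>2) \<longlonglongrightarrow> (f \<omega> - f \<omega>)\<^sup>2" by (intro tendsto_intros elim)
      then show ?case by simp
    qed
    fix k
    show "AE \<omega> in M. norm ((f \<omega> - F k \<omega>)\<^sup>2) \<le> 4 * (G \<omega>)\<^sup>2"
      using fG bd[of k]
    proof eventually_elim
      case (elim \<omega>)
      then have "\<bar>f \<omega> - F k \<omega>\<bar> \<le> 2 * \<bar>G \<omega>\<bar>" by linarith
      then have "\<bar>f \<omega> - F k \<omega>\<bar>\<^sup>2 \<le> (2 * \<bar>G \<omega>\<bar>)\<^sup>2" by (intro power_mono) auto
      then show ?case by (simp add: power_mult_distrib)
    qed
  qed (use f in measurable)
  then have *: "(\<lambda>k. LINT \<omega>|M. (f \<omega> - F k \<omega>)\<^sup>2) \<longlonglongrightarrow> 0" by simp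
  fix \<epsilon> :: real assume "\<epsilon> > 0"
  then have "eventually (\<lambda>k. (LINT \<omega>|M. (f \<omega> - F k \<omega>)\<^sup>2) < \<epsilon>) sequentially"
    using * by (intro order_tendstoD(2)) auto
  then obtain k where "(LINT \<omega>|M. (f \<omega> - F k \<omega>)\<^sup>2) < \<epsilon>" by (auto simp: eventually_sequentially)
  then show "\<exists>g. approximable g \<and> (LINT \<omega>|M. (f \<omega> - g \<omega>)\<^sup>2) < \<epsilon>" using ap by blast
qed

lemma approximable_AE:
  assumes "approximable f" "g \<in> borel_measurable M" "AE \<omega> in M. f \<omega> = g \<omega>"
  shows "approximable g"
  by (rule approximable_dominated[where F = "\<lambda>_. f" and G = f]) (use assms in \<open>auto simp: approximable_def\<close>)

lemma approximable_add:
  assumes f: "approximable f" and g: "approximable g"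
  shows "approximable (\<lambda>\<omega>. f \<omega> + g \<omega>)"
  unfolding approximable_def
proof (intro conjI allI impI)
  have L: "f \<in> L2_space M" "g \<in> L2_space M" using f g by (auto simp: approximable_def)
  then show L': "(\<lambda>\<omega>. f \<omega> + g \<omega>) \<in> L2_space M" by (rule L2_add)
  fix \<epsilon> :: real assume e: "\<epsilon> > 0"
  then obtain a b where a: "a \<in> A" "(LINT \<omega>|M. (f \<omega> - a \<omega>)\<^sup>2) < \<epsilon> / 4" and b: "b \<in> A" "(LINT \<omega>|M. (g \<omega> - b \<omega>)\<^sup>2) < \<epsilon> / 4"
    using f g unfolding approximable_def by (meson divide_pos_pos zero_less_numeral)
  have "(LINT \<omega>|M. ((f \<omega> + g \<omega>) - (a \<omega> + b \<omega>))\<^sup>2)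
      \<le> 2 * (LINT \<omega>|M. ((f \<omega> + g \<omega>) - (a \<omega> + g \<omega>))\<^sup>2) + 2 * (LINT \<omega>|M. ((a \<omega> + g \<omega>) - (a \<omega> + b \<omega>))\<^sup>2)"
    using L alg_L2[OF a(1)] alg_L2[OF b(1)] by (intro integral_diff_sq_le L2_add)
  also have "\<dots> < \<epsilon>" using a b by simp
  finally show "\<exists>c\<in>A. (LINT \<omega>|M. (f \<omega> + g \<omega> - c \<omega>)\<^sup>2) < \<epsilon>"
    using alg_add[OF a(1) b(1)] by (intro bexI[of _ "\<lambda>\<omega>. a \<omega> + b \<omega>"])
qed

lemma approximable_mult:
  assumes a: "a \<in> A" and f: "approximable f"
  shows "approximable (\<lambda>\<omega>. a \<omega> * f \<omega>)"
  unfolding approximable_def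
proof (intro conjI allI impI)
  obtain B where B: "\<forall>\<omega>\<in>space M. \<bar>a \<omega>\<bar> \<le> B" using alg_bounded[OF a] by auto
  define C where "C = max B 1"
  have C: "C > 0" "\<forall>\<omega>\<in>space M. \<bar>a \<omega>\<bar> \<le> C" using B by (auto simp: C_def le_max_iff_disj)
  have L: "f \<in> L2_space M" using f by (auto simp: approximable_def)
  have dom: "(\<lambda>\<omega>. a \<omega> * g \<omega>) \<in> L2_space M" if "g \<in> L2_space M" for g
  proof (rule L2_bound[OF L2_cmult[OF that, of C]])
    show "(\<lambda>\<omega>. a \<omega> * g \<omega>) \<in> borel_measurable M"
      using alg_measurable[OF a] L2_measurable[OF that] by simp
    show "AE \<omega> in M. \<bar>a \<omega> * g \<omega>\<bar> \<le> \<bar>C * g \<omega>\<bar>"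
      using C by (intro AE_I2) (auto simp: abs_mult intro!: mult_right_mono)
  qed
  show "(\<lambda>\<omega>. a \<omega> * f \<omega>) \<in> L2_space M" using dom[OF L] .
  fix \<epsilon> :: real assume e: "\<epsilon> > 0"
  then obtain b where b: "b \<in> A" "(LINT \<omega>|M. (f \<omega> - b \<omega>)\<^sup>2) < \<epsilon> / C\<^sup>2"
    using f C unfolding approximable_def by (meson divide_pos_pos zero_less_power)
  have "(LINT \<omega>|M. (a \<omega> * f \<omega> - a \<omega> * b \<omega>)\<^sup>2) \<le> (LINT \<omega>|M. C\<^sup>2 * (f \<omega> - b \<omega>)\<^sup>2)"
  proof (rule integral_mono)
    show "integrable M (\<lambda>\<omega>. (a \<omega> * f \<omega> - a \<omega> * b \<omega>)\<^sup>2)"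
      by (intro L2_integrable_sq L2_diff dom L alg_L2 b)
    show "integrable M (\<lambda>\<omega>. C\<^sup>2 * (f \<omega> - b \<omega>)\<^sup>2)"
      by (intro integrable_mult_right L2_integrable_sq L2_diff L alg_L2 b)
    fix \<omega> assume "\<omega> \<in> space M"
    then have "\<bar>a \<omega>\<bar>\<^sup>2 \<le> C\<^sup>2" using C by (intro power_mono) auto
    then have "(a \<omega>)\<^sup>2 * (f \<omega> - b \<omega>)\<^sup>2 \<le> C\<^sup>2 * (f \<omega> - b \<omega>)\<^sup>2" by (intro mult_right_mono) auto
    then show "(a \<omega> * f \<omega> - a \<omega> * b \<omega>)\<^sup>2 \<le> C\<^sup>2 * (f \<omega> - b \<omega>)\<^sup>2"
      by (simp add: power_mult_distrib flip: right_diff_distrib)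
  qed
  also have "\<dots> < \<epsilon>" using b C by (simp add: field_simps)
  finally show "\<exists>c\<in>A. (LINT \<omega>|M. (a \<omega> * f \<omega> - c \<omega>)\<^sup>2) < \<epsilon>"
    using alg_mult[OF a b(1)] by (intro bexI[of _ "\<lambda>\<omega>. a \<omega> * b \<omega>"])
qed

lemma approximable_polynomial:
  assumes a: "a \<in> A" and p: "real_polynomial_function (p :: real \<Rightarrow> real)"
  shows "approximable f \<Longrightarrow> approximable (\<lambda>\<omega>. p (a \<omega>) * f \<omega>)"
  using p
proof (induction arbitrary: f)
  case (linear p)
  then obtain c where "p = (\<lambda>x. x * c)" using real_bounded_linear by blast
  have "approximable (\<lambda>\<omega>. c * (a \<omega> * f \<omega>))"
    by (intro approximable_mult[OF alg_const] approximable_mult[OF a] linear(2))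
  then show ?case unfolding \<open>p = (\<lambda>x. x * c)\<close> by (simp add: mult_ac)
next
  case (const c)
  then show ?case using approximable_mult[OF alg_const[of c]] by simp
next
  case (add p q)
  then show ?case using approximable_add[of "\<lambda>\<omega>. p (a \<omega>) * f \<omega>" "\<lambda>\<omega>. q (a \<omega>) * f \<omega>"]
    by (simp add: distrib_right)
next
  case (mult p q)
  then show ?case using mult.IH(1)[OF mult.IH(2)[OF mult.prems]] by (simp add: mult.assoc)
qed

text \<open>An element of the algebra takes values in a compact interval, where Weierstrass
  polynomials approximate \<phi> uniformly; since the errors stay below 1, (D+1)|f| is a
  majorant.\<close>

lemma approximable_continuous:
  assumes a: "a \<in> A" and \<phi>: "continuous_on UNIV (\<phi> :: real \<Rightarrow> real)" and f: "approximable f"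
  shows "approximable (\<lambda>\<omega>. \<phi> (a \<omega>) * f \<omega>)"
proof -
  obtain B where B: "\<forall>\<omega>\<in>space M. \<bar>a \<omega>\<bar> \<le> B" using alg_bounded[OF a] by auto
  have L: "f \<in> L2_space M" using f by (auto simp: approximable_def)
  have "continuous_on {-B..B} \<phi>" using \<phi> by (rule continuous_on_subset) auto
  then have "\<exists>p. real_polynomial_function p \<and> (\<forall>x\<in>{-B..B}. \<bar>\<phi> x - p x\<bar> < 1 / real (Suc k))" for k
  proof -
    obtain q where "real_polynomial_function q" "\<And>x. x \<in> {-B..B} \<Longrightarrow> \<bar>\<phi> x - q x\<bar> < 1 / real (Suc k)"
      by (rule Stone_Weierstrass_real_polynomial_function[of "{-B..B}" \<phi> "1 / real (Suc k)"])
         (use \<open>continuous_on {-B..B} \<phi>\<close> in auto)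
    then show ?thesis by blast
  qed
  then obtain p where p: "\<And>k. real_polynomial_function (p k)"
    and pa': "\<And>k. \<forall>x\<in>{-B..B}. \<bar>\<phi> x - p k x\<bar> < 1 / real (Suc k)"
    using choice[of "\<lambda>k p. real_polynomial_function p \<and> (\<forall>x\<in>{-B..B}. \<bar>\<phi> x - p x\<bar> < 1 / real (Suc k))"] by blast
  have pa: "\<bar>\<phi> x - p k x\<bar> < 1 / real (Suc k)" if "x \<in> {-B..B}" for k x using pa' that by blast
  have aB: "a \<omega> \<in> {-B..B}" if "\<omega> \<in> space M" for \<omega>
    using B[rule_format, OF that] by (simp add: abs_le_iff)
  have "bounded (\<phi> ` {-B..B})"
    by (intro compact_imp_bounded compact_continuous_image \<open>continuous_on {-B..B} \<phi>\<close> compact_Icc)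
  then obtain D where "\<forall>y\<in>\<phi> ` {-B..B}. norm y \<le> D" unfolding bounded_iff by blast
  then have D: "\<bar>\<phi> x\<bar> \<le> D" if "x \<in> {-B..B}" for x using that by auto
  have [measurable]: "\<phi> \<in> borel_measurable borel" using \<phi> by (rule borel_measurable_continuous_onI)
  note [measurable] = alg_measurable[OF a] L2_measurable[OF L]
  show ?thesis
  proof (rule approximable_dominated[where F = "\<lambda>k \<omega>. p k (a \<omega>) * f \<omega>" and G = "\<lambda>\<omega>. (D + 1) * f \<omega>"])
    show "approximable (\<lambda>\<omega>. p k (a \<omega>) * f \<omega>)" for k by (intro approximable_polynomial a p f)
    show "(\<lambda>\<omega>. (D + 1) * f \<omega>) \<in> L2_space M" by (rule L2_cmult[OF L])
    show "AE \<omega> in M. (\<lambda>k. p k (a \<omega>) * f \<omega>) \<longlonglongrightarrow> \<phi> (a \<omega>) * f \<omega>"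
    proof (intro AE_I2 tendsto_mult tendsto_const)
      fix \<omega> assume w: "\<omega> \<in> space M"
      have lim0: "(\<lambda>k. 1 / real (Suc k)) \<longlonglongrightarrow> 0" by (rule LIMSEQ_Suc[OF lim_1_over_n])
      have "norm (p k (a \<omega>) - \<phi> (a \<omega>)) \<le> 1 / real (Suc k)" for k
        using pa[OF aB[OF w], of k] by (simp only: real_norm_def abs_minus_commute less_imp_le)
      then have "\<forall>k. norm (p k (a \<omega>) - \<phi> (a \<omega>)) \<le> 1 / real (Suc k)" by blast
      then have "(\<lambda>k. p k (a \<omega>) - \<phi> (a \<omega>)) \<longlonglongrightarrow> 0"
        by (rule Lim_null_comparison[OF always_eventually lim0])
      then show "(\<lambda>k. p k (a \<omega>)) \<longlonglongrightarrow> \<phi> (a \<omega>)" by (rule LIM_zero_cancel)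
    qed
    fix k
    show "AE \<omega> in M. \<bar>p k (a \<omega>) * f \<omega>\<bar> \<le> \<bar>(D + 1) * f \<omega>\<bar>"
    proof (rule AE_I2)
      fix \<omega> assume w: "\<omega> \<in> space M"
      have "1 / real (Suc k) \<le> 1" by simp
      then have "\<bar>p k (a \<omega>)\<bar> \<le> \<bar>D + 1\<bar>" using pa[OF aB[OF w], of k] D[OF aB[OF w]] by linarith
      then show "\<bar>p k (a \<omega>) * f \<omega>\<bar> \<le> \<bar>(D + 1) * f \<omega>\<bar>"
        unfolding abs_mult by (rule mult_right_mono) simp
    qed
    show "(\<lambda>\<omega>. \<phi> (a \<omega>) * f \<omega>) \<in> borel_measurable M" by measurable
  qed
qed

text \<open>These sets form a $\sigma$-algebra by construction, so no monotone class argument is needed.\<close>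

definition cutting_sets :: "'w set set" where
  "cutting_sets = {B \<in> sets M. \<forall>f. approximable f \<longrightarrow> approximable (\<lambda>\<omega>. indicator B \<omega> * f \<omega>)}"

lemma sublevel_cutting:
  assumes a: "a \<in> A"
  shows "{\<omega> \<in> space M. a \<omega> \<le> c} \<in> cutting_sets"
  unfolding cutting_sets_def
proof (intro CollectI conjI allI impI)
  note [measurable] = alg_measurable[OF a]
  show S: "{\<omega> \<in> space M. a \<omega> \<le> c} \<in> sets M" by measurable
  fix f assume f: "approximable f"
  then have L: "f \<in> L2_space M" by (auto simp: approximable_def)
  note [measurable] = L2_measurable[OF L]
  \<comment> \<open>For k > 0 these continuous functions are 1 up to c and 0 from c + 1/k on, so
    they decrease to the indicator of the closed half-line.\<close>
  define \<phi> :: "nat \<Rightarrow> real \<Rightarrow> real" where "\<phi> k x = max 0 (1 - real k * max 0 (x - c))" for k x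
  show "approximable (\<lambda>\<omega>. indicator {\<omega> \<in> space M. a \<omega> \<le> c} \<omega> * f \<omega>)"
  proof (rule approximable_dominated[where F = "\<lambda>k \<omega>. \<phi> k (a \<omega>) * f \<omega>" and G = f])
    show "approximable (\<lambda>\<omega>. \<phi> k (a \<omega>) * f \<omega>)" for k
      unfolding \<phi>_def by (intro approximable_continuous a f continuous_intros)
    show "AE \<omega> in M. (\<lambda>k. \<phi> k (a \<omega>) * f \<omega>) \<longlonglongrightarrow> indicator {\<omega> \<in> space M. a \<omega> \<le> c} \<omega> * f \<omega>"
    proof (intro AE_I2 tendsto_mult tendsto_const)
      fix \<omega> assume w: "\<omega> \<in> space M"
      show "(\<lambda>k. \<phi> k (a \<omega>)) \<longlonglongrightarrow> indicator {\<omega> \<in> space M. a \<omega> \<le> c} \<omega>"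
      proof (cases "a \<omega> \<le> c")
        case True then show ?thesis using w by (simp add: \<phi>_def)
      next
        case False
        obtain K where K: "real K * (a \<omega> - c) > 1" using False by (meson reals_Archimedean3 diff_gt_0_iff_gt not_le)
        have "\<phi> k (a \<omega>) = 0" if "k \<ge> K" for k
        proof -
          have "real K * (a \<omega> - c) \<le> real k * (a \<omega> - c)" using that False by (intro mult_right_mono) auto
          then have "1 - real k * (a \<omega> - c) \<le> 0" using K by linarith
          then show ?thesis using False by (simp add: \<phi>_def)
        qed
        then have "eventually (\<lambda>k. \<phi> k (a \<omega>) = 0) sequentially" by (auto simp: eventually_sequentially)
        then show ?thesis using False by (simp add: tendsto_eventually)
      qed
    qed
    fix k
    have "\<bar>\<phi> k x\<bar> \<le> 1" for x by (auto simp: \<phi>_def)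
    then show "AE \<omega> in M. \<bar>\<phi> k (a \<omega>) * f \<omega>\<bar> \<le> \<bar>f \<omega>\<bar>"
      by (intro AE_I2) (simp add: abs_mult mult_left_le_one_le)
  qed (use L S in auto)
qed

text \<open>An intersection feeds the output of one cut into the other. This is why
  \<open>cutting_sets\<close> quantifies over all approximable f and not just over f = 1.\<close>

lemma sigma_algebra_cutting: "sigma_algebra (space M) cutting_sets"
proof -
  have emp: "{} \<in> cutting_sets"
    using approximable_mult[OF alg_const[of 0]] by (auto simp: cutting_sets_def)
  have compl: "space M - B \<in> cutting_sets" if B: "B \<in> cutting_sets" for B
    unfolding cutting_sets_def
  proof (intro CollectI conjI allI impI)
    show S: "space M - B \<in> sets M" using B by (auto simp: cutting_sets_def)
    fix f assume f: "approximable f"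
    then have Bf: "approximable (\<lambda>\<omega>. indicator B \<omega> * f \<omega>)" using B by (auto simp: cutting_sets_def)
    have "approximable (\<lambda>\<omega>. f \<omega> + (-1) * (indicator B \<omega> * f \<omega>))"
      by (intro approximable_add f approximable_mult[OF alg_const] Bf)
    then show "approximable (\<lambda>\<omega>. indicator (space M - B) \<omega> * f \<omega>)"
    proof (rule approximable_AE)
      show "(\<lambda>\<omega>. indicator (space M - B) \<omega> * f \<omega>) \<in> borel_measurable M"
        using f S by (auto simp: approximable_def L2_space_def)
    qed (auto simp: indicator_def)
  qed
  have inter: "B \<inter> C \<in> cutting_sets" if B: "B \<in> cutting_sets" and C: "C \<in> cutting_sets" for B C
    using B C unfolding cutting_sets_def
    by (auto simp: indicator_inter_arith mult.assoc)
  have union: "B \<union> C \<in> cutting_sets" if B: "B \<in> cutting_sets" and C: "C \<in> cutting_sets" for B C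
  proof -
    have "B \<union> C = space M - ((space M - B) \<inter> (space M - C))"
      using B C sets.space_closed[of M] unfolding cutting_sets_def by blast
    then show ?thesis using compl inter B C by metis
  qed
  have cunion: "(\<Union>i. B i) \<in> cutting_sets" if B: "range B \<subseteq> cutting_sets" for B :: "nat \<Rightarrow> 'w set"
    unfolding cutting_sets_def
  proof (intro CollectI conjI allI impI)
    have fin: "(\<Union>i<n. B i) \<in> cutting_sets" for n
    proof (induction n)
      case (Suc n)
      then show ?case using union[of "\<Union>i<n. B i" "B n"] B by (auto simp: lessThan_Suc Un_commute)
    qed (simp add: emp)
    have "range B \<subseteq> sets M" using B by (auto simp: cutting_sets_def)
    then show S: "(\<Union>i. B i) \<in> sets M" by auto
    fix f assume f: "approximable f"
    show "approximable (\<lambda>\<omega>. indicator (\<Union>i. B i) \<omega> * f \<omega>)"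
    proof (rule approximable_dominated[where F = "\<lambda>k \<omega>. indicator (\<Union>i<k. B i) \<omega> * f \<omega>" and G = f])
      show "approximable (\<lambda>\<omega>. indicator (\<Union>i<k. B i) \<omega> * f \<omega>)" for k
        using fin[of k] f by (auto simp: cutting_sets_def)
      show "AE \<omega> in M. (\<lambda>k. indicator (\<Union>i<k. B i) \<omega> * f \<omega>) \<longlonglongrightarrow> indicator (\<Union>i. B i) \<omega> * f \<omega>"
        by (intro AE_I2 tendsto_mult tendsto_const LIMSEQ_indicator_UN)
      show "f \<in> L2_space M" using f by (auto simp: approximable_def)
      then show "(\<lambda>\<omega>. indicator (\<Union>i. B i) \<omega> * f \<omega>) \<in> borel_measurable M"
        using S by (auto simp: L2_space_def)
    qed (auto simp: indicator_def)
  qed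
  have "cutting_sets \<subseteq> Pow (space M)"
    using sets.space_closed[of M] by (auto simp: cutting_sets_def)
  then show ?thesis unfolding sigma_algebra_iff2 using emp compl cunion by blast
qed

text \<open>The noise variables are unbounded in general and so fall outside the algebra. It is
  enough that they are pointwise limits of rescaled members, since limits preserve measurability for
  the \<sigma>-algebra of cutting sets.\<close>

lemma measurable_cutting_limit:
  assumes "\<And>k. a k \<in> A" "\<And>\<omega>. \<omega> \<in> space M \<Longrightarrow> (\<lambda>k. c k * a k \<omega>) \<longlonglongrightarrow> X \<omega>" "S \<in> sets borel"
  shows "X -` S \<inter> space M \<in> cutting_sets"
proof -
  interpret sigma_algebra "space M" cutting_sets by (rule sigma_algebra_cutting)
  define N where "N = sigma (space M) cutting_sets"
  have N: "space N = space M" "sets N = cutting_sets"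
    using space_closed by (auto simp: N_def sigma_sets_eq)
  have "a k \<in> borel_measurable N" for k
    unfolding borel_measurable_iff_le N using sublevel_cutting[OF assms(1)] by auto
  then have "(\<lambda>\<omega>. c k * a k \<omega>) \<in> borel_measurable N" for k by simp
  then have "X \<in> borel_measurable N"
    by (rule borel_measurable_LIMSEQ_real[rotated]) (use assms N in auto)
  from measurable_sets[OF this assms(3)] show ?thesis by (simp add: N)
qed

text \<open>Cutting f = 1 makes indicators approximable, and simple functions dominated by 2|f| do
  the rest. The almost sure equality in \<open>gen\<close> matches a \<sigma>-algebra that is
  generated only up to null sets.\<close>

lemma approximable_L2:
  assumes gen: "\<And>B. B \<in> sets M \<Longrightarrow> \<exists>C\<in>cutting_sets. AE \<omega> in M. \<omega> \<in> B \<longleftrightarrow> \<omega> \<in> C"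
    and f: "f \<in> L2_space M"
  shows "approximable f"
proof -
  have ind: "approximable (\<lambda>\<omega>. indicator B \<omega>)" if B: "B \<in> sets M" for B
  proof -
    obtain C where C: "C \<in> cutting_sets" "AE \<omega> in M. \<omega> \<in> B \<longleftrightarrow> \<omega> \<in> C" using gen[OF B] by auto
    have "approximable (\<lambda>\<omega>. indicator C \<omega> * 1)"
      using C(1) alg_approximable[OF alg_const[of 1]] by (auto simp: cutting_sets_def)
    then show ?thesis
      by (rule approximable_AE) (use B C(2) in \<open>auto simp: indicator_def\<close>)
  qed
  have sum: "approximable (\<lambda>\<omega>. \<Sum>y\<in>Y. c y * g y \<omega>)"
    if "finite Y" "\<And>y. y \<in> Y \<Longrightarrow> approximable (g y)" for Y :: "real set" and c and g :: "real \<Rightarrow> 'w \<Rightarrow> real"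
    using that
  proof (induction Y)
    case empty
    then show ?case using alg_approximable[OF alg_const[of 0]] by simp
  next
    case (insert y Y)
    then show ?case by (auto intro!: approximable_add approximable_mult alg_const)
  qed
  obtain F where F: "\<And>i. simple_function M (F i)" "\<And>\<omega>. \<omega> \<in> space M \<Longrightarrow> (\<lambda>i. F i \<omega>) \<longlonglongrightarrow> f \<omega>"
    "\<And>i \<omega>. \<omega> \<in> space M \<Longrightarrow> dist (F i \<omega>) 0 \<le> 2 * dist (f \<omega>) 0"
    using borel_measurable_implies_sequence_metric[OF L2_measurable[OF f], of 0] by blast
  show ?thesis
  proof (rule approximable_dominated[where F = F and G = "\<lambda>\<omega>. 2 * f \<omega>"])
    fix i
    let ?Y = "F i ` space M" and ?g = "\<lambda>y. indicator (F i -` {y} \<inter> space M)"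
    have "approximable (\<lambda>\<omega>. \<Sum>y\<in>?Y. y * ?g y \<omega>)"
      using F(1)[of i] by (intro sum ind) (auto simp: simple_function_def)
    then show "approximable (F i)"
    proof (rule approximable_AE)
      show "F i \<in> borel_measurable M" using F(1) by (rule borel_measurable_simple_function)
      show "AE \<omega> in M. (\<Sum>y\<in>?Y. y * ?g y \<omega>) = F i \<omega>"
      proof (rule AE_I2)
        fix \<omega> assume w: "\<omega> \<in> space M"
        have "(\<Sum>y\<in>?Y. y * ?g y \<omega>) = (\<Sum>y\<in>?Y. if y = F i \<omega> then y else 0)"
          using w by (intro sum.cong) (auto simp: indicator_def)
        also have "\<dots> = F i \<omega>" using F(1)[of i] w by (subst sum.delta) (auto simp: simple_function_def)
        finally show "(\<Sum>y\<in>?Y. y * ?g y \<omega>) = F i \<omega>" .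
      qed
    qed
    show "AE \<omega> in M. \<bar>F i \<omega>\<bar> \<le> \<bar>2 * f \<omega>\<bar>" using F(3)[of _ i] by (intro AE_I2) (simp add: abs_mult)
  qed (use F(2) f L2_cmult[OF f] in \<open>auto simp: L2_space_def\<close>)
qed

end

section \<open>Trigonometric functions of the noise\<close>

text \<open>The integral is the real part of e^(i \<theta>) times the characteristic function of the
  standard normal law at \<sigma>.\<close>

lemma integral_std_normal_cos:
  "(LINT x|lborel. std_normal_density x * cos (\<sigma> * x + \<theta>)) = exp (- \<sigma>\<^sup>2 / 2) * cos \<theta>"
proof -
  interpret P: real_distribution std_normal_distribution by (rule real_dist_normal_dist)
  have int: "integrable std_normal_distribution (\<lambda>x. cis \<theta> * iexp (\<sigma> * x))"
    by (intro P.integrable_const_bound[where B=1]) (auto simp: norm_mult)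
  have "(LINT x|lborel. std_normal_density x * cos (\<sigma> * x + \<theta>)) = (LINT x|std_normal_distribution. cos (\<sigma> * x + \<theta>))"
    by (subst integral_density) auto
  also have "\<dots> = (LINT x|std_normal_distribution. Re (cis \<theta> * iexp (\<sigma> * x)))"
    by (intro Bochner_Integration.integral_cong) (auto simp: cos_add Re_exp Im_exp cis.sel)
  also have "\<dots> = Re (LINT x|std_normal_distribution. cis \<theta> * iexp (\<sigma> * x))"
    by (rule integral_Re[OF int])
  also have "(LINT x|std_normal_distribution. cis \<theta> * iexp (\<sigma> * x)) = cis \<theta> * char std_normal_distribution \<sigma>"
    by (simp add: char_def)
  also have "Re \<dots> = exp (- \<sigma>\<^sup>2 / 2) * cos \<theta>"
    unfolding char_std_normal_distribution by (simp add: mult.commute)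
  finally show ?thesis .
qed

lemma integral_normal_cos:
  assumes s: "\<sigma> > 0"
  shows "(LINT x|lborel. normal_density 0 \<sigma> x * cos (x + \<theta>)) = exp (- \<sigma>\<^sup>2 / 2) * cos \<theta>"
proof -
  have d: "\<sigma> * normal_density 0 \<sigma> (\<sigma> * x) = std_normal_density x" for x
    using s by (simp add: normal_density_def real_sqrt_mult power_mult_distrib)
  have "(LINT x|lborel. normal_density 0 \<sigma> x * cos (x + \<theta>))
     = \<sigma> * (LINT x|lborel. normal_density 0 \<sigma> (\<sigma> * x) * cos (\<sigma> * x + \<theta>))"
    using s lborel_integral_real_affine[of \<sigma> "\<lambda>x. normal_density 0 \<sigma> x * cos (x + \<theta>)" 0] by simp
  also have "\<dots> = (LINT x|lborel. std_normal_density x * cos (\<sigma> * x + \<theta>))"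
    by (simp add: d mult.assoc[symmetric] flip: integral_mult_right_zero)
  finally show ?thesis by (simp add: integral_std_normal_cos)
qed

context prob_space
begin

lemma centered_gaussian_moments:
  assumes "centered_gaussian M X"
  shows centered_gaussian_L2: "X \<in> L2_space M"
    and centered_gaussian_cos: "expectation (\<lambda>\<omega>. cos (X \<omega> + \<theta>)) = exp (- expectation (\<lambda>\<omega>. (X \<omega>)\<^sup>2) / 2) * cos \<theta>"
proof -
  have X [measurable]: "X \<in> borel_measurable M" using assms by (auto simp: centered_gaussian_def)
  consider "AE \<omega> in M. X \<omega> = 0" | \<sigma> where "\<sigma> > 0" "distributed M lborel X (\<lambda>x. ennreal (normal_density 0 \<sigma> x))"
    using assms by (auto simp: centered_gaussian_def)
  then have "X \<in> L2_space M \<and> expectation (\<lambda>\<omega>. cos (X \<omega> + \<theta>)) = exp (- expectation (\<lambda>\<omega>. (X \<omega>)\<^sup>2) / 2) * cos \<theta>"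
  proof cases
    case 1
    have "X \<in> L2_space M"
      by (rule L2_bound[of "\<lambda>_. 0"]) (use 1 in \<open>auto simp: L2_space_def\<close>)
    moreover have "expectation (\<lambda>\<omega>. (X \<omega>)\<^sup>2) = expectation (\<lambda>\<omega>. 0)"
      by (intro integral_cong_AE) (use 1 in auto)
    moreover have "expectation (\<lambda>\<omega>. cos (X \<omega> + \<theta>)) = expectation (\<lambda>\<omega>. cos \<theta>)"
      by (intro integral_cong_AE) (use 1 in auto)
    ultimately show ?thesis by (simp add: prob_space)
  next
    case 2
    have "integrable lborel (\<lambda>x. normal_density 0 \<sigma> x * (x - 0)^2)" by (rule integrable_normal_moment[OF 2(1)])
    then have "integrable M (\<lambda>\<omega>. (X \<omega>)\<^sup>2)"
      using distributed_integrable[OF 2(2), of "\<lambda>x. x\<^sup>2"] by simp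
    then have L: "X \<in> L2_space M" by (simp add: L2_space_def)
    have "expectation (\<lambda>\<omega>. (X \<omega>)\<^sup>2) = (LINT x|lborel. normal_density 0 \<sigma> x * x\<^sup>2)"
      using distributed_integral[OF 2(2), of "\<lambda>x. x\<^sup>2"] by simp
    also have "\<dots> = \<sigma>\<^sup>2"
      using integral_normal_moment_even[OF 2(1), of 0 1] by simp
    finally have "expectation (\<lambda>\<omega>. (X \<omega>)\<^sup>2) = \<sigma>\<^sup>2" .
    moreover have "expectation (\<lambda>\<omega>. cos (X \<omega> + \<theta>)) = exp (- \<sigma>\<^sup>2 / 2) * cos \<theta>"
      using distributed_integral[OF 2(2), of "\<lambda>x. cos (x + \<theta>)"] integral_normal_cos[OF 2(1)] by simp
    ultimately show ?thesis using L by simp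
  qed
  then show "X \<in> L2_space M"
    "expectation (\<lambda>\<omega>. cos (X \<omega> + \<theta>)) = exp (- expectation (\<lambda>\<omega>. (X \<omega>)\<^sup>2) / 2) * cos \<theta>" by auto
qed

end

section \<open>The noise as a linear Gaussian family\<close>

lemma H_inner_lincomb:
  assumes "g \<in> H_space" "h \<in> H_space" "k \<in> H_space"
  shows H_inner_lincomb_left: "H_inner (\<lambda>p. a * g p + b * h p) k = a * H_inner g k + b * H_inner h k"
    and H_inner_lincomb_right: "H_inner k (\<lambda>p. a * g p + b * h p) = a * H_inner k g + b * H_inner k h"
proof -
  have "(LINT p|quadrant. a * (g p * k p) + b * (h p * k p)) = a * H_inner g k + b * H_inner h k"
    unfolding H_inner_def using assms by (simp add: L2_mult_integrable)
  then show "H_inner (\<lambda>p. a * g p + b * h p) k = a * H_inner g k + b * H_inner h k"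
    by (simp add: H_inner_def algebra_simps)
  then show "H_inner k (\<lambda>p. a * g p + b * h p) = a * H_inner k g + b * H_inner k h"
    by (simp add: H_inner_def mult.commute)
qed

lemma H_inner_commute: "H_inner g h = H_inner h g"
  by (simp add: H_inner_def mult.commute)

lemma zero_in_H: "(\<lambda>_. 0) \<in> H_space"
  by (simp add: L2_space_def)

locale white_noise = prob_space M for M :: "'w measure" +
  fixes W :: "(real \<times> real \<Rightarrow> real) \<Rightarrow> 'w \<Rightarrow> real"
  assumes isonormal: "isonormal M W" and generated: "generated_by_noise M W"
begin

lemma W_gaussian: "h \<in> H_space \<Longrightarrow> centered_gaussian M (W h)"
proof -
  assume h: "h \<in> H_space"
  have "\<And>(n::nat) (h :: nat \<Rightarrow> real \<times> real \<Rightarrow> real) (a :: nat \<Rightarrow> real).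
        (\<forall>i<n. h i \<in> H_space) \<Longrightarrow> centered_gaussian M (\<lambda>\<omega>. \<Sum>i<n. a i * W (h i) \<omega>)"
    using isonormal by (auto simp: isonormal_def)
  from this[of 1 "\<lambda>_. h" "\<lambda>_. 1"] h show ?thesis by simp
qed

lemma W_L2: "h \<in> H_space \<Longrightarrow> W h \<in> L2_space M"
  by (intro centered_gaussian_L2 W_gaussian)

lemma W_measurable: "h \<in> H_space \<Longrightarrow> W h \<in> borel_measurable M"
  by (intro L2_measurable W_L2)

lemma W_covariance: "g \<in> H_space \<Longrightarrow> h \<in> H_space \<Longrightarrow> expectation (\<lambda>\<omega>. W g \<omega> * W h \<omega>) = H_inner g h"
  using isonormal by (auto simp: isonormal_def)

lemma expectation_cos:
  "h \<in> H_space \<Longrightarrow> expectation (\<lambda>\<omega>. cos (W h \<omega> + \<theta>)) = exp (- H_inner h h / 2) * cos \<theta>"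
  using centered_gaussian_cos[OF W_gaussian, of h \<theta>] W_covariance[of h h] by (simp add: power2_eq_square)

text \<open>Linearity is not a clause of \<open>isonormal\<close>. It follows almost surely, since
  the covariances make the second moment of the difference vanish; identities between noise
  variables therefore hold up to null sets throughout.\<close>

lemma W_lincomb:
  assumes g: "g \<in> H_space" and h: "h \<in> H_space"
  shows "AE \<omega> in M. W (\<lambda>p. a * g p + b * h p) \<omega> = a * W g \<omega> + b * W h \<omega>"
proof -
  let ?f = "\<lambda>p. a * g p + b * h p"
  let ?Y = "\<lambda>\<omega>. W ?f \<omega> - (a * W g \<omega> + b * W h \<omega>)"
  have f: "?f \<in> H_space" by (rule L2_lincomb[OF g h])
  note L = W_L2[OF f] W_L2[OF g] W_L2[OF h]
  have Y: "?Y \<in> L2_space M" by (intro L2_diff L2_lincomb L)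
  note i = L2_mult_integrable[OF L(1) L(1)] L2_mult_integrable[OF L(1) L(2)] L2_mult_integrable[OF L(1) L(3)]
    L2_mult_integrable[OF L(2) L(2)] L2_mult_integrable[OF L(2) L(3)] L2_mult_integrable[OF L(3) L(3)]
  have "expectation (\<lambda>\<omega>. (?Y \<omega>)\<^sup>2) = expectation (\<lambda>\<omega>. W ?f \<omega> * W ?f \<omega> - 2 * a * (W ?f \<omega> * W g \<omega>)
      - 2 * b * (W ?f \<omega> * W h \<omega>) + a\<^sup>2 * (W g \<omega> * W g \<omega>) + 2 * a * b * (W g \<omega> * W h \<omega>) + b\<^sup>2 * (W h \<omega> * W h \<omega>))"
    by (intro Bochner_Integration.integral_cong) (auto simp: power2_eq_square algebra_simps)
  also have "\<dots> = H_inner ?f ?f - 2 * a * H_inner ?f g - 2 * b * H_inner ?f h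
      + a\<^sup>2 * H_inner g g + 2 * a * b * H_inner g h + b\<^sup>2 * H_inner h h"
    using i by (simp add: W_covariance f g h)
  also have "\<dots> = 0"
    using f g h by (simp add: H_inner_lincomb_left H_inner_lincomb_right H_inner_commute[of h g] power2_eq_square algebra_simps)
  finally have "AE \<omega> in M. (?Y \<omega>)\<^sup>2 = 0"
    using L2_integrable_sq[OF Y] by (subst (asm) integral_nonneg_eq_0_iff_AE) auto
  then show ?thesis by auto
qed

text \<open>The product formula for cosines reduces this to the noise of g+h and g-h, whose
  variances differ from |g|^2 + |h|^2 by plus or minus twice the inner product.\<close>

lemma expectation_cos_cos:
  assumes g: "g \<in> H_space" and h: "h \<in> H_space"
  shows "expectation (\<lambda>\<omega>. cos (W g \<omega> + \<alpha>) * cos (W h \<omega> + \<beta>))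
    = exp (- (H_inner g g + H_inner h h) / 2) *
      (exp (- H_inner g h) * cos (\<alpha> + \<beta>) + exp (H_inner g h) * cos (\<alpha> - \<beta>)) / 2"
proof -
  let ?s = "\<lambda>p. 1 * g p + 1 * h p" and ?d = "\<lambda>p. 1 * g p + (-1) * h p"
  have s: "?s \<in> H_space" and d: "?d \<in> H_space" by (intro L2_lincomb g h)+
  note [measurable] = W_measurable[OF g] W_measurable[OF h] W_measurable[OF s] W_measurable[OF d]
  have "expectation (\<lambda>\<omega>. cos (W g \<omega> + \<alpha>) * cos (W h \<omega> + \<beta>))
     = expectation (\<lambda>\<omega>. (cos (W ?s \<omega> + (\<alpha> + \<beta>)) + cos (W ?d \<omega> + (\<alpha> - \<beta>))) / 2)"
  proof (intro integral_cong_AE)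
    show "AE \<omega> in M. cos (W g \<omega> + \<alpha>) * cos (W h \<omega> + \<beta>) = (cos (W ?s \<omega> + (\<alpha> + \<beta>)) + cos (W ?d \<omega> + (\<alpha> - \<beta>))) / 2"
      using W_lincomb[OF g h, of 1 1] W_lincomb[OF g h, of 1 "-1"]
    proof eventually_elim
      case (elim \<omega>)
      show ?case unfolding elim cos_times_cos by (simp add: algebra_simps)
    qed
  qed measurable
  also have "\<dots> = (expectation (\<lambda>\<omega>. cos (W ?s \<omega> + (\<alpha> + \<beta>))) + expectation (\<lambda>\<omega>. cos (W ?d \<omega> + (\<alpha> - \<beta>)))) / 2"
  proof -
    have "integrable M (\<lambda>\<omega>. cos (W ?s \<omega> + (\<alpha> + \<beta>)))" "integrable M (\<lambda>\<omega>. cos (W ?d \<omega> + (\<alpha> - \<beta>)))"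
      by (rule integrable_const_bound[where B=1], simp, measurable)+
    then show ?thesis by simp
  qed
  also have "\<dots> = (exp (- H_inner ?s ?s / 2) * cos (\<alpha> + \<beta>) + exp (- H_inner ?d ?d / 2) * cos (\<alpha> - \<beta>)) / 2"
    by (simp only: expectation_cos[OF s] expectation_cos[OF d])
  also have "H_inner ?s ?s = H_inner g g + H_inner h h + 2 * H_inner g h"
    using g h s by (simp only: H_inner_lincomb_left H_inner_lincomb_right) (simp add: H_inner_commute[of h g])
  also have "H_inner ?d ?d = H_inner g g + H_inner h h - 2 * H_inner g h"
    using g h d by (simp only: H_inner_lincomb_left H_inner_lincomb_right) (simp add: H_inner_commute[of h g])
  also have "exp (- (H_inner g g + H_inner h h + 2 * H_inner g h) / 2)
     = exp (- (H_inner g g + H_inner h h) / 2) * exp (- H_inner g h)"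
    by (simp add: field_simps flip: exp_add)
  also have "exp (- (H_inner g g + H_inner h h - 2 * H_inner g h) / 2)
     = exp (- (H_inner g g + H_inner h h) / 2) * exp (H_inner g h)"
    by (simp add: field_simps flip: exp_add)
  finally show ?thesis by (simp add: algebra_simps)
qed

section \<open>Density of trigonometric functions of the noise\<close>

inductive_set trig_span :: "('w \<Rightarrow> real) set" where
  trig_base: "h \<in> H_space \<Longrightarrow> (\<lambda>\<omega>. c * cos (W h \<omega> + \<theta>)) \<in> trig_span"
| trig_add: "F \<in> trig_span \<Longrightarrow> G \<in> trig_span \<Longrightarrow> (\<lambda>\<omega>. F \<omega> + G \<omega>) \<in> trig_span"

text \<open>A normal form for computations with double sums. All \<open>h j\<close> lie in
  \<open>H_space\<close>, also beyond n, so that later arguments carry no index bound.\<close>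

lemma trig_span_sum:
  assumes "F \<in> trig_span"
  shows "\<exists>(n::nat) c h \<theta>. (\<forall>j. h j \<in> H_space) \<and> F = (\<lambda>\<omega>. \<Sum>j<n. c j * cos (W (h j) \<omega> + \<theta> j))"
  using assms
proof induction
  case (trig_base h c \<theta>)
  then show ?case
    by (intro exI[of _ 1] exI[of _ "\<lambda>_. c"] exI[of _ "\<lambda>_. h"] exI[of _ "\<lambda>_. \<theta>"]) auto
next
  case (trig_add F G)
  obtain n :: nat and c h \<theta> where F: "\<forall>j. h j \<in> H_space" "F = (\<lambda>\<omega>. \<Sum>j<n. c j * cos (W (h j) \<omega> + \<theta> j))"
    using trig_add.IH(1) by blast
  obtain n' :: nat and c' h' \<theta>' where G: "\<forall>j. h' j \<in> H_space" "G = (\<lambda>\<omega>. \<Sum>j<n'. c' j * cos (W (h' j) \<omega> + \<theta>' j))"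
    using trig_add.IH(2) by blast
  let ?p = "\<lambda>a b j. if j < n then a j else b (j - n)"
  have "(\<Sum>j<n + n'. ?p c c' j * cos (W (?p h h' j) \<omega> + ?p \<theta> \<theta>' j)) = F \<omega> + G \<omega>" for \<omega>
  proof -
    have split: "(\<Sum>j<n + m. f j) = (\<Sum>j<n. f j) + (\<Sum>j<m. f (n + j))" for m and f :: "nat \<Rightarrow> real"
      by (induction m) auto
    show ?thesis unfolding F G split by simp
  qed
  then show ?case using F(1) G(1)
    by (intro exI[of _ "n + n'"] exI[of _ "?p c c'"] exI[of _ "?p h h'"] exI[of _ "?p \<theta> \<theta>'"]) auto
qed

lemma trig_span_measurable: "F \<in> trig_span \<Longrightarrow> F \<in> borel_measurable M"
proof (induction rule: trig_span.induct)
  case (trig_base h c \<theta>)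
  note [measurable] = W_measurable[OF trig_base]
  show ?case by measurable
qed measurable

lemma trig_span_bounded: "F \<in> trig_span \<Longrightarrow> \<exists>B. \<forall>\<omega>. \<bar>F \<omega>\<bar> \<le> B"
proof (induction rule: trig_span.induct)
  case (trig_base h c \<theta>)
  have "\<bar>c * cos (W h \<omega> + \<theta>)\<bar> \<le> \<bar>c\<bar>" for \<omega>
    by (simp add: abs_mult mult_left_le)
  then show ?case by blast
next
  case (trig_add F G)
  then obtain B C where "\<forall>\<omega>. \<bar>F \<omega>\<bar> \<le> B" "\<forall>\<omega>. \<bar>G \<omega>\<bar> \<le> C" by blast
  then have "\<bar>F \<omega> + G \<omega>\<bar> \<le> B + C" for \<omega> by (meson abs_triangle_ineq add_mono order_trans)
  then show ?case by blast
qed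

lemma trig_span_L2: "F \<in> trig_span \<Longrightarrow> F \<in> L2_space M"
proof -
  assume F: "F \<in> trig_span"
  obtain B where B: "\<forall>\<omega>. \<bar>F \<omega>\<bar> \<le> B" using trig_span_bounded[OF F] by blast
  show ?thesis
  proof (rule L2_bound[of "\<lambda>_. B"])
    show "AE \<omega> in M. \<bar>F \<omega>\<bar> \<le> \<bar>B\<bar>" using B by (intro AE_I2 order_trans[OF _ abs_ge_self]) auto
  qed (use trig_span_measurable[OF F] in \<open>auto simp: L2_space_def\<close>)
qed

lemma trig_span_mult_base:
  assumes F: "F \<in> trig_span" and h: "h \<in> H_space"
  shows "\<exists>K\<in>trig_span. AE \<omega> in M. F \<omega> * (c * cos (W h \<omega> + \<theta>)) = K \<omega>"
  using F
proof induction
  case (trig_base g a \<alpha>)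
  let ?s = "\<lambda>p. 1 * g p + 1 * h p" and ?d = "\<lambda>p. 1 * g p + (-1) * h p"
  let ?K = "\<lambda>\<omega>. a * c / 2 * cos (W ?s \<omega> + (\<alpha> + \<theta>)) + a * c / 2 * cos (W ?d \<omega> + (\<alpha> - \<theta>))"
  have "?K \<in> trig_span" by (intro trig_span.intros L2_lincomb trig_base h)
  moreover have "AE \<omega> in M. a * cos (W g \<omega> + \<alpha>) * (c * cos (W h \<omega> + \<theta>)) = ?K \<omega>"
    using W_lincomb[OF trig_base h, of 1 1] W_lincomb[OF trig_base h, of 1 "-1"]
  proof eventually_elim
    case (elim \<omega>)
    have "a * cos (W g \<omega> + \<alpha>) * (c * cos (W h \<omega> + \<theta>)) = a * c * (cos (W g \<omega> + \<alpha>) * cos (W h \<omega> + \<theta>))" by simp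
    also have "\<dots> = ?K \<omega>" unfolding elim cos_times_cos by (simp add: algebra_simps)
    finally show ?case .
  qed
  ultimately show ?case by (intro bexI[of _ ?K])
next
  case (trig_add F G)
  then obtain K L where K: "K \<in> trig_span" "AE \<omega> in M. F \<omega> * (c * cos (W h \<omega> + \<theta>)) = K \<omega>"
    and L: "L \<in> trig_span" "AE \<omega> in M. G \<omega> * (c * cos (W h \<omega> + \<theta>)) = L \<omega>" by blast
  have "AE \<omega> in M. (F \<omega> + G \<omega>) * (c * cos (W h \<omega> + \<theta>)) = K \<omega> + L \<omega>"
    using K(2) L(2) by eventually_elim (simp only: distrib_right)
  then show ?case using trig_span.trig_add[OF K(1) L(1)] by (intro bexI[of _ "\<lambda>\<omega>. K \<omega> + L \<omega>"])
qed

lemma trig_span_mult: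
  assumes F: "F \<in> trig_span" and G: "G \<in> trig_span"
  shows "\<exists>K\<in>trig_span. AE \<omega> in M. F \<omega> * G \<omega> = K \<omega>"
  using G
proof induction
  case (trig_base h c \<theta>)
  then show ?case by (rule trig_span_mult_base[OF F])
next
  case (trig_add G G')
  then obtain K L where K: "K \<in> trig_span" "AE \<omega> in M. F \<omega> * G \<omega> = K \<omega>"
    and L: "L \<in> trig_span" "AE \<omega> in M. F \<omega> * G' \<omega> = L \<omega>" by blast
  have "AE \<omega> in M. F \<omega> * (G \<omega> + G' \<omega>) = K \<omega> + L \<omega>"
    using K(2) L(2) by eventually_elim (simp only: distrib_left)
  then show ?case using trig_span.trig_add[OF K(1) L(1)] by (intro bexI[of _ "\<lambda>\<omega>. K \<omega> + L \<omega>"])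
qed

text \<open>Products leave \<open>trig_span\<close> on a null set, because they use the noise of g+h
  instead of the sum of the two noises. The algebra therefore consists of bounded measurable
  functions with an almost sure representative in the span. Phases bring in sines, and h = 0 brings
  in constants.\<close>

definition trig_algebra :: "('w \<Rightarrow> real) set" where
  "trig_algebra = {f \<in> borel_measurable M. (\<exists>B. \<forall>\<omega>\<in>space M. \<bar>f \<omega>\<bar> \<le> B) \<and> (\<exists>F\<in>trig_span. AE \<omega> in M. f \<omega> = F \<omega>)}"

sublocale trig: bounded_algebra M trig_algebra
proof
  show "a \<in> borel_measurable M" if "a \<in> trig_algebra" for a using that by (auto simp: trig_algebra_def)
  show "\<exists>B. \<forall>\<omega>\<in>space M. \<bar>a \<omega>\<bar> \<le> B" if "a \<in> trig_algebra" for a using that by (auto simp: trig_algebra_def)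
next
  fix a b assume a: "a \<in> trig_algebra" and b: "b \<in> trig_algebra"
  obtain B C where B: "\<forall>\<omega>\<in>space M. \<bar>a \<omega>\<bar> \<le> B" and C: "\<forall>\<omega>\<in>space M. \<bar>b \<omega>\<bar> \<le> C"
    using a b by (auto simp: trig_algebra_def)
  obtain F G where F: "F \<in> trig_span" "AE \<omega> in M. a \<omega> = F \<omega>" and G: "G \<in> trig_span" "AE \<omega> in M. b \<omega> = G \<omega>"
    using a b by (auto simp: trig_algebra_def)
  have [measurable]: "a \<in> borel_measurable M" "b \<in> borel_measurable M" using a b by (auto simp: trig_algebra_def)
  have "\<forall>\<omega>\<in>space M. \<bar>a \<omega> + b \<omega>\<bar> \<le> B + C"
    using B C by (meson abs_triangle_ineq add_mono order_trans)
  moreover have "AE \<omega> in M. a \<omega> + b \<omega> = F \<omega> + G \<omega>" using F(2) G(2) by eventually_elim simp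
  ultimately show "(\<lambda>\<omega>. a \<omega> + b \<omega>) \<in> trig_algebra"
    using trig_span.trig_add[OF F(1) G(1)] unfolding trig_algebra_def
    by (auto intro!: bexI[of _ "\<lambda>\<omega>. F \<omega> + G \<omega>"])
  have "\<bar>a \<omega> * b \<omega>\<bar> \<le> B * C" if "\<omega> \<in> space M" for \<omega>
    unfolding abs_mult using B C that by (intro mult_mono) (auto intro: order_trans[OF abs_ge_zero])
  moreover obtain K where K: "K \<in> trig_span" "AE \<omega> in M. F \<omega> * G \<omega> = K \<omega>" using trig_span_mult[OF F(1) G(1)] by blast
  moreover have "AE \<omega> in M. a \<omega> * b \<omega> = K \<omega>" using F(2) G(2) K(2) by eventually_elim simp
  ultimately show "(\<lambda>\<omega>. a \<omega> * b \<omega>) \<in> trig_algebra" unfolding trig_algebra_def by auto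
next
  fix c :: real
  have "AE \<omega> in M. W (\<lambda>_. 0) \<omega> = 0"
    using W_lincomb[OF zero_in_H zero_in_H, of 0 0] by simp
  then have "AE \<omega> in M. c = c * cos (W (\<lambda>_. 0) \<omega> + 0)" by eventually_elim simp
  then have "\<exists>F\<in>trig_span. AE \<omega> in M. c = F \<omega>" using trig_base[OF zero_in_H, of c 0]
    by (intro bexI[of _ "\<lambda>\<omega>. c * cos (W (\<lambda>_. 0) \<omega> + 0)"])
  then show "(\<lambda>\<omega>. c) \<in> trig_algebra" unfolding trig_algebra_def by auto
qed

lemma tendsto_scaled_sin: "(\<lambda>k. real (Suc k) * sin (x / real (Suc k))) \<longlonglongrightarrow> x"
proof -
  have "((\<lambda>y. sin (x * y)) has_real_derivative x) (at 0)"
    by (auto intro!: derivative_eq_intros)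
  then have "((\<lambda>h. sin (x * h) / h) \<longlongrightarrow> x) (at 0)" by (simp add: DERIV_def)
  moreover have "filterlim (\<lambda>k. 1 / real (Suc k)) (at 0) sequentially"
    unfolding filterlim_at using LIMSEQ_Suc[OF lim_1_over_n] by auto
  ultimately have "(\<lambda>k. sin (x * (1 / real (Suc k))) / (1 / real (Suc k))) \<longlonglongrightarrow> x" by (rule filterlim_compose)
  then show ?thesis by (simp add: mult.commute)
qed

text \<open>The variable W h is the limit of k sin (W h / k). Each sine is bounded and almost surely
  equals the cosine of the noise of h/k with phase -pi/2, hence lies in the algebra.\<close>

lemma noise_cutting:
  assumes h: "h \<in> H_space" and S: "S \<in> sets borel"
  shows "W h -` S \<inter> space M \<in> trig.cutting_sets"
proof (rule trig.measurable_cutting_limit[OF _ _ S])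
  fix k :: nat
  let ?c = "1 / real (Suc k)"
  note [measurable] = W_measurable[OF h]
  have "(\<lambda>p. ?c * h p + 0 * h p) \<in> H_space" by (rule L2_lincomb[OF h h])
  then have "(\<lambda>\<omega>. 1 * cos (W (\<lambda>p. ?c * h p + 0 * h p) \<omega> + (- pi / 2))) \<in> trig_span"
    by (rule trig_base)
  moreover have "AE \<omega> in M. sin (W h \<omega> / real (Suc k)) = 1 * cos (W (\<lambda>p. ?c * h p + 0 * h p) \<omega> + (- pi / 2))"
    using W_lincomb[OF h h, of ?c 0]
  proof eventually_elim
    case (elim \<omega>)
    show ?case unfolding elim by (simp add: cos_diff)
  qed
  ultimately have "\<exists>F\<in>trig_span. AE \<omega> in M. sin (W h \<omega> / real (Suc k)) = F \<omega>"
    by (intro bexI[of _ "\<lambda>\<omega>. 1 * cos (W (\<lambda>p. ?c * h p + 0 * h p) \<omega> + (- pi / 2))"])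
  then show "(\<lambda>\<omega>. sin (W h \<omega> / real (Suc k))) \<in> trig_algebra"
    unfolding trig_algebra_def by (auto intro!: exI[of _ 1])
  show "(\<lambda>k. real (Suc k) * sin (W h \<omega> / real (Suc k))) \<longlonglongrightarrow> W h \<omega>" for \<omega> by (rule tendsto_scaled_sin)
qed

lemma trig_span_dense:
  assumes f: "f \<in> L2_space M" and e: "\<epsilon> > 0"
  shows "\<exists>F\<in>trig_span. expectation (\<lambda>\<omega>. (f \<omega> - F \<omega>)\<^sup>2) < \<epsilon>"
proof -
  interpret C: sigma_algebra "space M" trig.cutting_sets by (rule trig.sigma_algebra_cutting)
  have sub: "sigma_sets (space M) {W h -` S \<inter> space M | h S. h \<in> H_space \<and> S \<in> sets borel} \<subseteq> trig.cutting_sets"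
    by (rule C.sigma_sets_subset) (auto intro: noise_cutting)
  have "trig.approximable f"
  proof (rule trig.approximable_L2[OF _ f])
    fix B assume "B \<in> sets M"
    then show "\<exists>C\<in>trig.cutting_sets. AE \<omega> in M. \<omega> \<in> B \<longleftrightarrow> \<omega> \<in> C"
      using generated sub unfolding generated_by_noise_def by blast
  qed
  then obtain a where a: "a \<in> trig_algebra" "expectation (\<lambda>\<omega>. (f \<omega> - a \<omega>)\<^sup>2) < \<epsilon>"
    using e by (auto simp: trig.approximable_def)
  then obtain F where F: "F \<in> trig_span" "AE \<omega> in M. a \<omega> = F \<omega>" by (auto simp: trig_algebra_def)
  have "expectation (\<lambda>\<omega>. (f \<omega> - F \<omega>)\<^sup>2) = expectation (\<lambda>\<omega>. (f \<omega> - a \<omega>)\<^sup>2)"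
    using F f a trig_span_measurable[OF F(1)] by (intro integral_cong_AE) (auto simp: L2_space_def trig_algebra_def)
  then show ?thesis using F(1) a(2) by (intro bexI[of _ F]) auto
qed

text \<open>Duality, with F_k tending to X in L2. For x = E[X^2] the hypothesis becomes (x - d_k)^2
  <= C (x - 2 d_k + \<delta>_k), where d_k and \<delta>_k tend to 0; in the limit x^2 <= C
  x.\<close>

lemma second_moment_le_of_trig:
  assumes X: "X \<in> L2_space M"
    and bd: "\<And>F. F \<in> trig_span \<Longrightarrow> (expectation (\<lambda>\<omega>. F \<omega> * X \<omega>))\<^sup>2 \<le> C * expectation (\<lambda>\<omega>. (F \<omega>)\<^sup>2)"
    and C: "C \<ge> 0"
  shows "expectation (\<lambda>\<omega>. (X \<omega>)\<^sup>2) \<le> C"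
proof -
  define x where "x = expectation (\<lambda>\<omega>. (X \<omega>)\<^sup>2)"
  have x0: "x \<ge> 0" by (simp add: x_def)
  have "\<exists>F\<in>trig_span. expectation (\<lambda>\<omega>. (X \<omega> - F \<omega>)\<^sup>2) < 1 / real (Suc k)" for k
    by (intro trig_span_dense X) simp
  then obtain F where F: "\<And>k. F k \<in> trig_span" "\<And>k. expectation (\<lambda>\<omega>. (X \<omega> - F k \<omega>)\<^sup>2) < 1 / real (Suc k)"
    by metis
  define \<delta> where "\<delta> k = expectation (\<lambda>\<omega>. (X \<omega> - F k \<omega>)\<^sup>2)" for k
  define d where "d k = expectation (\<lambda>\<omega>. X \<omega> * (X \<omega> - F k \<omega>))" for k
  have LF: "F k \<in> L2_space M" for k by (rule trig_span_L2[OF F(1)])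
  have LD: "(\<lambda>\<omega>. X \<omega> - F k \<omega>) \<in> L2_space M" for k by (rule L2_diff[OF X LF])
  have inv0: "(\<lambda>k. 1 / real (Suc k)) \<longlonglongrightarrow> 0" by (rule LIMSEQ_Suc[OF lim_1_over_n])
  have \<delta>0: "\<delta> \<longlonglongrightarrow> 0"
    by (rule tendsto_sandwich[OF _ _ tendsto_const inv0]) (use F(2) in \<open>auto simp: \<delta>_def less_imp_le intro!: always_eventually\<close>)
  have "(\<lambda>k. (d k)\<^sup>2) \<longlonglongrightarrow> 0"
  proof (rule tendsto_sandwich[OF _ _ tendsto_const])
    show "(\<lambda>k. x * \<delta> k) \<longlonglongrightarrow> 0" using tendsto_mult_left[OF \<delta>0, of x] by simp
    show "eventually (\<lambda>k. (d k)\<^sup>2 \<le> x * \<delta> k) sequentially"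
      unfolding d_def x_def \<delta>_def by (intro always_eventually allI L2_cauchy_schwarz X LD)
  qed auto
  then have "(\<lambda>k. sqrt ((d k)\<^sup>2)) \<longlonglongrightarrow> sqrt 0" by (rule tendsto_real_sqrt)
  then have d0: "d \<longlonglongrightarrow> 0" by (simp add: tendsto_rabs_zero_iff)
  have le: "(x - d k)\<^sup>2 \<le> C * (x - 2 * d k + \<delta> k)" for k
  proof -
    have "expectation (\<lambda>\<omega>. F k \<omega> * X \<omega>) = expectation (\<lambda>\<omega>. (X \<omega>)\<^sup>2 - X \<omega> * (X \<omega> - F k \<omega>))"
      by (intro Bochner_Integration.integral_cong) (auto simp: power2_eq_square algebra_simps)
    also have "\<dots> = x - d k" unfolding x_def d_def
      by (intro Bochner_Integration.integral_diff L2_integrable_sq L2_mult_integrable X LD)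
    finally have 1: "expectation (\<lambda>\<omega>. F k \<omega> * X \<omega>) = x - d k" .
    have "expectation (\<lambda>\<omega>. (F k \<omega>)\<^sup>2) = expectation (\<lambda>\<omega>. (X \<omega>)\<^sup>2 - 2 * (X \<omega> * (X \<omega> - F k \<omega>)) + (X \<omega> - F k \<omega>)\<^sup>2)"
      by (intro Bochner_Integration.integral_cong) (auto simp: power2_eq_square algebra_simps)
    also have "\<dots> = x - 2 * d k + \<delta> k" unfolding x_def d_def \<delta>_def
      using L2_integrable_sq[OF X] L2_mult_integrable[OF X LD[of k]] L2_integrable_sq[OF LD[of k]] by simp
    finally show ?thesis using bd[OF F(1)[of k]] 1 by simp
  qed
  have "x\<^sup>2 \<le> C * x"
  proof (rule LIMSEQ_le)
    have "(\<lambda>k. (x - d k)\<^sup>2) \<longlonglongrightarrow> (x - 0)\<^sup>2" by (intro tendsto_intros d0)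
    then show "(\<lambda>k. (x - d k)\<^sup>2) \<longlonglongrightarrow> x\<^sup>2" by simp
    have "(\<lambda>k. C * (x - 2 * d k + \<delta> k)) \<longlonglongrightarrow> C * (x - 2 * 0 + 0)" by (intro tendsto_intros d0 \<delta>0)
    then show "(\<lambda>k. C * (x - 2 * d k + \<delta> k)) \<longlonglongrightarrow> C * x" by simp
  qed (use le in auto)
  then have "x \<le> C" using x0 C by (cases "x = 0") (auto simp: power2_eq_square)
  then show ?thesis by (simp add: x_def)
qed

end

section \<open>Exponentials of primitives\<close>

text \<open>The cut-off time is extended real so that \<open>\<infinity>\<close> yields the uncut function.\<close>

definition before :: "('a \<Rightarrow> real) \<Rightarrow> ereal \<Rightarrow> ('a \<Rightarrow> real) \<Rightarrow> 'a \<Rightarrow> real" where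
  "before s x \<rho> p = (if ereal (s p) < x then \<rho> p else 0)"

lemma before_measurable [measurable]:
  assumes [measurable]: "s \<in> borel_measurable N" "\<rho> \<in> borel_measurable N"
  shows "before s x \<rho> \<in> borel_measurable N"
  unfolding before_def by measurable

lemma before_integrable:
  assumes "integrable N \<rho>" and [measurable]: "s \<in> borel_measurable N"
  shows "integrable N (before s x \<rho>)"
  by (rule Bochner_Integration.integrable_bound[OF assms(1)])
     (use assms in \<open>auto simp: before_def\<close>)

lemma abs_integral_before_le:
  assumes "integrable N \<rho>" and [measurable]: "s \<in> borel_measurable N"
  shows "\<bar>LINT q|N. before s x \<rho> q\<bar> \<le> (LINT q|N. \<bar>\<rho> q\<bar>)"
proof -
  have "\<bar>LINT q|N. before s x \<rho> q\<bar> \<le> (LINT q|N. \<bar>before s x \<rho> q\<bar>)" by (rule integral_abs_bound)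
  also have "\<dots> \<le> (LINT q|N. \<bar>\<rho> q\<bar>)"
  proof (rule integral_mono)
    show "integrable N (\<lambda>q. \<bar>before s x \<rho> q\<bar>)" by (intro integrable_abs before_integrable assms)
    show "integrable N (\<lambda>q. \<bar>\<rho> q\<bar>)" using assms(1) by simp
  qed (simp add: before_def)
  finally show ?thesis .
qed

context sigma_finite_measure
begin

lemma integral_before_measurable:
  assumes [measurable]: "s \<in> borel_measurable M" "\<rho> \<in> borel_measurable M"
  shows "(\<lambda>p. LINT q|M. before s (ereal (s p)) \<rho> q) \<in> borel_measurable M"
proof -
  have "(\<lambda>(p, q). before s (ereal (s p)) \<rho> q) \<in> borel_measurable (M \<Otimes>\<^sub>M M)"
    unfolding before_def by measurable
  then show ?thesis by (rule borel_measurable_lebesgue_integral)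
qed

lemma integrable_mult_before:
  assumes \<rho>: "integrable M \<rho>" and \<sigma>: "integrable M \<sigma>" and [measurable]: "s \<in> borel_measurable M"
  shows "integrable M (\<lambda>p. \<rho> p * (LINT q|M. before s (ereal (s p)) \<sigma> q))"
proof (rule Bochner_Integration.integrable_bound)
  show "integrable M (\<lambda>p. \<rho> p * (LINT q|M. \<bar>\<sigma> q\<bar>))" using \<rho> by simp
  have [measurable]: "\<rho> \<in> borel_measurable M" "\<sigma> \<in> borel_measurable M" using \<rho> \<sigma> by auto
  show "(\<lambda>p. \<rho> p * (LINT q|M. before s (ereal (s p)) \<sigma> q)) \<in> borel_measurable M"
    by (intro borel_measurable_times integral_before_measurable) measurable
  show "AE p in M. norm (\<rho> p * (LINT q|M. before s (ereal (s p)) \<sigma> q)) \<le> norm (\<rho> p * (LINT q|M. \<bar>\<sigma> q\<bar>))"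
  proof (rule AE_I2)
    fix p
    have "\<bar>LINT q|M. before s (ereal (s p)) \<sigma> q\<bar> \<le> \<bar>LINT q|M. \<bar>\<sigma> q\<bar>\<bar>"
      by (rule order_trans[OF abs_integral_before_le[OF \<sigma>] abs_ge_self]) measurable
    then show "norm (\<rho> p * (LINT q|M. before s (ereal (s p)) \<sigma> q)) \<le> norm (\<rho> p * (LINT q|M. \<bar>\<sigma> q\<bar>))"
      unfolding real_norm_def abs_mult by (rule mult_left_mono) simp
  qed
qed

text \<open>Integration by parts for primitives along the coordinate s. The double integral of
  \<rho>(p) \<sigma>(q) over points before x is split according to which point comes first;
  \<open>null\<close> discards ties.\<close>

lemma product_of_primitives:
  assumes \<rho>: "integrable M \<rho>" and \<sigma>: "integrable M \<sigma>" and s[measurable]: "s \<in> borel_measurable M"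
    and null: "\<And>p. p \<in> space M \<Longrightarrow> AE q in M. s q \<noteq> s p"
  shows "(LINT p|M. before s x \<rho> p) * (LINT p|M. before s x \<sigma> p)
    = (LINT p|M. before s x (\<lambda>p. \<rho> p * (LINT q|M. before s (ereal (s p)) \<sigma> q)
        + \<sigma> p * (LINT q|M. before s (ereal (s p)) \<rho> q)) p)"
proof -
  interpret PP: pair_sigma_finite M M ..
  have [measurable]: "\<rho> \<in> borel_measurable M" "\<sigma> \<in> borel_measurable M" using \<rho> \<sigma> by auto
  let ?r = "before s x \<rho>" and ?g = "before s x \<sigma>"
  have r: "integrable M ?r" and g: "integrable M ?g" by (intro before_integrable \<rho> \<sigma> s)+
  have pr: "integrable (M \<Otimes>\<^sub>M M) (\<lambda>(p, q). ?r p * ?g q)"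
  proof (rule PP.Fubini_integrable)
    show "integrable M (\<lambda>p. LINT q|M. norm (case (p, q) of (p, q) \<Rightarrow> ?r p * ?g q))"
      using r g by (simp add: abs_mult)
    show "AE p in M. integrable M (\<lambda>q. case (p, q) of (p, q) \<Rightarrow> ?r p * ?g q)"
      using g by simp
  qed measurable
  let ?A = "\<lambda>p q. if s q < s p then ?r p * ?g q else 0" and ?B = "\<lambda>p q. if s p < s q then ?r p * ?g q else 0"
  have A: "integrable (M \<Otimes>\<^sub>M M) (\<lambda>(p, q). ?A p q)"
    by (rule Bochner_Integration.integrable_bound[OF pr]) (auto split: if_splits)
  have B: "integrable (M \<Otimes>\<^sub>M M) (\<lambda>(p, q). ?B p q)"
    by (rule Bochner_Integration.integrable_bound[OF pr]) (auto split: if_splits)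
  have before_trans: "ereal (s q) < x" if "s q < s p" "ereal (s p) < x" for p q
    using that less_trans[of "ereal (s q)" "ereal (s p)" x] by simp
  have Ai: "(LINT q|M. ?A p q) = before s x (\<lambda>p. \<rho> p * (LINT q|M. before s (ereal (s p)) \<sigma> q)) p" for p
  proof -
    have "(LINT q|M. ?A p q) = (LINT q|M. ?r p * before s (ereal (s p)) \<sigma> q)"
      by (intro Bochner_Integration.integral_cong) (auto simp: before_def dest: before_trans)
    then show ?thesis by (simp add: before_def)
  qed
  have Bi: "(LINT p|M. ?B p q) = before s x (\<lambda>p. \<sigma> p * (LINT q|M. before s (ereal (s p)) \<rho> q)) q" for q
  proof -
    have "(LINT p|M. ?B p q) = (LINT p|M. ?g q * before s (ereal (s q)) \<rho> p)"
      by (intro Bochner_Integration.integral_cong) (auto simp: before_def dest: before_trans)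
    then show ?thesis by (simp add: before_def)
  qed
  have "(LINT p|M. ?r p) * (LINT q|M. ?g q) = (LINT p|M. (LINT q|M. ?r p * ?g q))" by simp
  also have "\<dots> = (LINT p|M. (LINT q|M. ?A p q + ?B p q))"
  proof (rule Bochner_Integration.integral_cong[OF refl])
    fix p assume p: "p \<in> space M"
    show "(LINT q|M. ?r p * ?g q) = (LINT q|M. ?A p q + ?B p q)"
    proof (rule integral_cong_AE)
      from null[OF p] show "AE q in M. ?r p * ?g q = ?A p q + ?B p q"
        by eventually_elim auto
    qed measurable
  qed
  also have "\<dots> = (LINT z|(M \<Otimes>\<^sub>M M). (case z of (p, q) \<Rightarrow> ?A p q + ?B p q))"
    using A B Bochner_Integration.integrable_add[OF A B]
    by (subst PP.integral_fst[symmetric]) (auto simp: case_prod_unfold)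
  also have "\<dots> = (LINT z|(M \<Otimes>\<^sub>M M). (case z of (p, q) \<Rightarrow> ?A p q)) + (LINT z|(M \<Otimes>\<^sub>M M). (case z of (p, q) \<Rightarrow> ?B p q))"
    using Bochner_Integration.integral_add[OF A B] by (simp add: case_prod_unfold)
  also have "(LINT z|(M \<Otimes>\<^sub>M M). (case z of (p, q) \<Rightarrow> ?A p q)) = (LINT p|M. (LINT q|M. ?A p q))"
    by (rule PP.integral_fst[symmetric, OF A])
  also have "(LINT z|(M \<Otimes>\<^sub>M M). (case z of (p, q) \<Rightarrow> ?B p q)) = (LINT q|M. (LINT p|M. ?B p q))"
    by (rule PP.integral_snd[symmetric, OF B])
  also have "(LINT p|M. (LINT q|M. ?A p q)) + (LINT q|M. (LINT p|M. ?B p q))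
     = (LINT p|M. before s x (\<lambda>p. \<rho> p * (LINT q|M. before s (ereal (s p)) \<sigma> q)) p
        + before s x (\<lambda>p. \<sigma> p * (LINT q|M. before s (ereal (s p)) \<rho> q)) p)"
    unfolding Ai Bi
    by (intro Bochner_Integration.integral_add[symmetric] before_integrable integrable_mult_before \<rho> \<sigma> s)
  also have "\<dots> = (LINT p|M. before s x (\<lambda>p. \<rho> p * (LINT q|M. before s (ereal (s p)) \<sigma> q)
        + \<sigma> p * (LINT q|M. before s (ereal (s p)) \<rho> q)) p)"
    by (intro Bochner_Integration.integral_cong) (auto simp: before_def)
  finally show ?thesis .
qed

lemma integrable_mult_before_power:
  assumes \<rho>: "integrable M \<rho>" and [measurable]: "s \<in> borel_measurable M"
  shows "integrable M (\<lambda>p. \<rho> p * (LINT q|M. before s (ereal (s p)) \<rho> q) ^ n)"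
proof (rule Bochner_Integration.integrable_bound)
  show "integrable M (\<lambda>p. \<rho> p * (LINT q|M. \<bar>\<rho> q\<bar>) ^ n)" using \<rho> by simp
  have [measurable]: "\<rho> \<in> borel_measurable M" using \<rho> by auto
  show "(\<lambda>p. \<rho> p * (LINT q|M. before s (ereal (s p)) \<rho> q) ^ n) \<in> borel_measurable M"
    by (intro borel_measurable_times borel_measurable_power integral_before_measurable) measurable
  show "AE p in M. norm (\<rho> p * (LINT q|M. before s (ereal (s p)) \<rho> q) ^ n) \<le> norm (\<rho> p * (LINT q|M. \<bar>\<rho> q\<bar>) ^ n)"
  proof (rule AE_I2)
    fix p
    have "\<bar>LINT q|M. before s (ereal (s p)) \<rho> q\<bar> \<le> \<bar>LINT q|M. \<bar>\<rho> q\<bar>\<bar>"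
      by (rule order_trans[OF abs_integral_before_le[OF \<rho>] abs_ge_self]) measurable
    then have "\<bar>LINT q|M. before s (ereal (s p)) \<rho> q\<bar> ^ n \<le> \<bar>LINT q|M. \<bar>\<rho> q\<bar>\<bar> ^ n" by (rule power_mono) simp
    then show "norm (\<rho> p * (LINT q|M. before s (ereal (s p)) \<rho> q) ^ n) \<le> norm (\<rho> p * (LINT q|M. \<bar>\<rho> q\<bar>) ^ n)"
      unfolding real_norm_def abs_mult power_abs by (rule mult_left_mono) simp
  qed
qed

text \<open>By induction: the previous power of the primitive R is itself a primitive, with density
  (n+1) \<rho> R^n, so \<open>product_of_primitives\<close> applies to it and \<rho>.\<close>

lemma power_of_primitive:
  assumes \<rho>: "integrable M \<rho>" and s[measurable]: "s \<in> borel_measurable M"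
    and null: "\<And>p. p \<in> space M \<Longrightarrow> AE q in M. s q \<noteq> s p"
  shows "(LINT p|M. before s x \<rho> p) ^ Suc n
    = (LINT p|M. before s x (\<lambda>p. real (Suc n) * (\<rho> p * (LINT q|M. before s (ereal (s p)) \<rho> q) ^ n)) p)"
proof (induction n arbitrary: x)
  case 0
  show ?case by simp
next
  case (Suc n)
  let ?R = "\<lambda>p. LINT q|M. before s (ereal (s p)) \<rho> q"
  let ?\<sigma> = "\<lambda>p. real (Suc n) * (\<rho> p * ?R p ^ n)"
  have \<sigma>: "integrable M ?\<sigma>" by (intro integrable_mult_right integrable_mult_before_power \<rho> s)
  have "(LINT p|M. before s x \<rho> p) ^ Suc (Suc n) = (LINT p|M. before s x \<rho> p) * (LINT p|M. before s x ?\<sigma> p)"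
    by (simp only: Suc.IH[symmetric] power_Suc)
  also have "\<dots> = (LINT p|M. before s x (\<lambda>p. \<rho> p * (LINT q|M. before s (ereal (s p)) ?\<sigma> q)
        + ?\<sigma> p * (LINT q|M. before s (ereal (s p)) \<rho> q)) p)"
    by (rule product_of_primitives[OF \<rho> \<sigma> s null])
  also have "(\<lambda>p. \<rho> p * (LINT q|M. before s (ereal (s p)) ?\<sigma> q) + ?\<sigma> p * (LINT q|M. before s (ereal (s p)) \<rho> q))
     = (\<lambda>p. real (Suc (Suc n)) * (\<rho> p * ?R p ^ Suc n))"
    by (simp only: Suc.IH[symmetric]) (auto simp: algebra_simps)
  finally show ?case .
qed

text \<open>The exponential series is integrated term by term under the majorant |\<rho>| exp
  (\<integral>|\<rho>|). The coordinate s only orders the points, so the fundamental theorem holds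
  on the quadrant with time as s.\<close>

lemma exp_of_primitive:
  assumes \<rho>: "integrable M \<rho>" and s[measurable]: "s \<in> borel_measurable M"
    and null: "\<And>p. p \<in> space M \<Longrightarrow> AE q in M. s q \<noteq> s p"
  shows exp_of_primitive_integrable: "integrable M (\<lambda>p. \<rho> p * exp (LINT q|M. before s (ereal (s p)) \<rho> q))"
    and integral_exp_of_primitive:
      "(LINT p|M. \<rho> p * exp (LINT q|M. before s (ereal (s p)) \<rho> q)) = exp (LINT p|M. \<rho> p) - 1"
proof -
  let ?R = "\<lambda>p. LINT q|M. before s (ereal (s p)) \<rho> q" and ?K = "LINT q|M. \<bar>\<rho> q\<bar>" and ?T = "LINT p|M. \<rho> p"
  have [measurable]: "\<rho> \<in> borel_measurable M" using \<rho> by auto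
  have [measurable]: "?R \<in> borel_measurable M" by (intro integral_before_measurable) measurable
  have R: "\<bar>?R p\<bar> \<le> ?K" for p by (intro abs_integral_before_le \<rho>) measurable
  have K: "integrable M (\<lambda>p. \<bar>\<rho> p\<bar> * exp ?K)" using \<rho> by simp
  show "integrable M (\<lambda>p. \<rho> p * exp (?R p))"
    by (rule Bochner_Integration.integrable_bound[OF K])
       (use abs_le_D1[OF R] in \<open>auto simp: abs_mult intro!: mult_left_mono AE_I2\<close>)
  let ?S = "\<lambda>n p. \<Sum>k<n. \<rho> p * (?R p ^ k / fact k)"
  have part: "(LINT p|M. ?S n p) = (\<Sum>k<n. ?T ^ Suc k / fact (Suc k))" for n
  proof -
    have "(LINT p|M. \<rho> p * (?R p ^ k / fact k)) = ?T ^ Suc k / fact (Suc k)" for k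
    proof -
      have "before s \<infinity> f = f" for f by (auto simp: before_def)
      then have "?T ^ Suc k = (LINT p|M. real (Suc k) * (\<rho> p * ?R p ^ k))"
        using power_of_primitive[OF \<rho> s null, of \<infinity> k] by simp
      also have "\<dots> = real (Suc k) * (LINT p|M. \<rho> p * ?R p ^ k)" by simp
      finally have "?T ^ Suc k / fact (Suc k) = (LINT p|M. \<rho> p * ?R p ^ k) / fact k"
        by (simp del: power_Suc)
      then show ?thesis by simp
    qed
    moreover have "integrable M (\<lambda>p. \<rho> p * (?R p ^ k / fact k))" for k
      using integrable_mult_before_power[OF \<rho> s, of k] by simp
    ultimately show ?thesis by (subst Bochner_Integration.integral_sum) auto
  qed
  have expS: "(\<lambda>n. \<Sum>k<n. y ^ k / fact k) \<longlonglongrightarrow> exp y" for y :: real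
    using exp_converges[of y] by (simp add: sums_def scaleR_conv_of_real divide_inverse mult.commute)
  have "(\<lambda>n. LINT p|M. ?S n p) \<longlonglongrightarrow> (LINT p|M. \<rho> p * exp (?R p))"
  proof (rule integral_dominated_convergence[OF _ _ K])
    show "AE p in M. (\<lambda>n. ?S n p) \<longlonglongrightarrow> \<rho> p * exp (?R p)"
      unfolding sum_distrib_left[symmetric] by (intro AE_I2 tendsto_mult_left expS)
    fix n
    show "AE p in M. norm (?S n p) \<le> \<bar>\<rho> p\<bar> * exp ?K"
    proof (rule AE_I2)
      fix p
      have "\<bar>\<Sum>k<n. ?R p ^ k / fact k\<bar> \<le> (\<Sum>k<n. \<bar>?R p ^ k / fact k\<bar>)" by (rule sum_abs)
      also have "\<dots> \<le> (\<Sum>k<n. ?K ^ k / fact k)"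
        using R[of p] by (intro sum_mono) (auto simp: power_abs intro!: divide_right_mono power_mono)
      also have "\<dots> \<le> (\<Sum>k. ?K ^ k / fact k)"
        using expS[of ?K] by (intro sum_le_suminf) (auto simp: summable_def sums_def)
      also have "\<dots> = exp ?K" using expS[of ?K] by (auto simp: sums_def intro: sums_unique[symmetric])
      finally show "norm (?S n p) \<le> \<bar>\<rho> p\<bar> * exp ?K"
        unfolding real_norm_def sum_distrib_left[symmetric] abs_mult by (rule mult_left_mono) simp
    qed
  qed measurable
  moreover have "(\<lambda>n. LINT p|M. ?S n p) \<longlonglongrightarrow> exp ?T - 1"
  proof -
    have "(\<lambda>n. (\<Sum>k<Suc n. ?T ^ k / fact k) - 1) \<longlonglongrightarrow> exp ?T - 1"
      by (intro tendsto_intros LIMSEQ_Suc expS)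
    moreover have "(\<Sum>k<Suc n. ?T ^ k / fact k) - 1 = (\<Sum>k<n. ?T ^ Suc k / fact (Suc k))" for n
      by (subst sum.lessThan_Suc_shift) simp
    ultimately show ?thesis unfolding part by simp
  qed
  ultimately show "(LINT p|M. \<rho> p * exp (?R p)) = exp ?T - 1" by (rule LIMSEQ_unique)
qed

end

text \<open>This provides the absence of ties that primitives along time require.\<close>

lemma AE_quadrant_time: "AE q in quadrant. snd q \<noteq> c"
proof -
  have "(\<integral>\<^sup>+q. indicator {c} (snd q) \<partial>quadrant) = (\<integral>\<^sup>+t. (\<integral>\<^sup>+w. indicator {c} t * indicator {0<..} (w::real) \<partial>lborel) * indicator {0<..} (t::real) \<partial>lborel)"
    by (subst nn_integral_quadrant) auto
  also have "\<dots> = (\<integral>\<^sup>+t. 0 \<partial>(lborel :: real measure))"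
  proof (rule nn_integral_cong_AE)
    show "AE t in lborel. (\<integral>\<^sup>+w. indicator {c} t * indicator {0<..} (w::real) \<partial>lborel) * indicator {0<..} (t::real) = 0"
      using AE_lborel_singleton[of c] by eventually_elim auto
  qed
  finally have "(\<integral>\<^sup>+q. indicator {c} (snd q) \<partial>quadrant) = 0" by simp
  then have "AE q in quadrant. (indicator {c} (snd q) :: ennreal) = 0"
    by (subst (asm) nn_integral_0_iff_AE) auto
  then show ?thesis by (auto simp: indicator_def)
qed

section \<open>Duality against cosines of the noise\<close>

text \<open>Writing -sin as a shifted cosine keeps all iterated derivatives inside one
  family.\<close>

lemma partial_deriv_cos: "partial_deriv 0 (\<lambda>x. cos (x 0 + \<alpha>)) = (\<lambda>x. cos (x 0 + (\<alpha> + pi / 2)))"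
proof
  fix x :: "nat \<Rightarrow> real"
  have "((\<lambda>s. cos (s + \<alpha>)) has_real_derivative - sin (x 0 + \<alpha>)) (at (x 0))"
    by (auto intro!: derivative_eq_intros)
  then have "deriv (\<lambda>s. cos (s + \<alpha>)) (x 0) = - sin (x 0 + \<alpha>)" by (rule DERIV_imp_deriv)
  also have "\<dots> = cos (x 0 + \<alpha> + pi / 2)" unfolding cos_add[of "x 0 + \<alpha>"] by simp
  finally show "partial_deriv 0 (\<lambda>x. cos (x 0 + \<alpha>)) x = cos (x 0 + (\<alpha> + pi / 2))"
    by (simp add: partial_deriv_def add.assoc)
qed

lemma smooth_poly_growth_cos: "smooth_poly_growth 1 (\<lambda>x. cos (x 0 + \<theta>))"
proof -
  have iter: "\<exists>\<alpha>. foldr partial_deriv js (\<lambda>x. cos (x 0 + \<theta>)) = (\<lambda>x. cos (x 0 + \<alpha>))" if "set js \<subseteq> {..<1}" for js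
    using that
  proof (induction js)
    case Nil
    show ?case by (intro exI[of _ \<theta>]) simp
  next
    case (Cons j js)
    then obtain \<alpha> where "foldr partial_deriv js (\<lambda>x. cos (x 0 + \<theta>)) = (\<lambda>x. cos (x 0 + \<alpha>))" by auto
    then show ?case using Cons.prems by (intro exI[of _ "\<alpha> + pi / 2"]) (simp add: partial_deriv_cos)
  qed
  show ?thesis unfolding smooth_poly_growth_def
  proof (intro conjI allI impI)
    fix js :: "nat list" assume "set js \<subseteq> {..<1}"
    then obtain \<alpha> where a: "foldr partial_deriv js (\<lambda>x. cos (x 0 + \<theta>)) = (\<lambda>x. cos (x 0 + \<alpha>))" using iter by blast
    show "\<exists>C k. \<forall>x. \<bar>foldr partial_deriv js (\<lambda>x. cos (x 0 + \<theta>)) x\<bar> \<le> C * (1 + (\<Sum>i<1. \<bar>x i\<bar>)) ^ k"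
      unfolding a by (intro exI[of _ 1] exI[of _ 0]) simp
    fix i :: nat and x :: "nat \<Rightarrow> real" assume "i < 1"
    have "((\<lambda>s. cos (s + \<alpha>)) has_real_derivative - sin (x 0 + \<alpha>)) (at (x 0))"
      by (auto intro!: derivative_eq_intros)
    then have "(\<lambda>s. cos (s + \<alpha>)) differentiable at (x 0)" unfolding real_differentiable_def by (rule exI)
    then show "(\<lambda>s. foldr partial_deriv js (\<lambda>x. cos (x 0 + \<theta>)) (x(i := s))) differentiable (at (x i))"
      unfolding a using \<open>i < 1\<close> by simp
  qed auto
qed

text \<open>The deterministic factor of the Skorohod integrand; its square is the kernel of
  \<open>kernel_op\<close>. Extension by 0 encodes the range of integration in time.\<close>

definition kern :: "real \<Rightarrow> real \<Rightarrow> real \<Rightarrow> real \<times> real \<Rightarrow> real" where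
  "kern \<beta> z t p = (if snd p < t then q0 z (fst p) (t - snd p) * min (fst p) 1 powr \<beta> else 0)"

lemma kern_measurable [measurable]: "kern \<beta> z t \<in> borel_measurable quadrant"
  unfolding kern_def by measurable

lemma kernel_op_kern:
  "kernel_op \<beta> g z t = (\<integral>\<^sup>+p. ennreal ((kern \<beta> z t p)\<^sup>2) * g p \<partial>quadrant)"
  unfolding kernel_op_def
  by (intro nn_integral_cong) (auto simp: kern_def power_mult_distrib powr_power space_quadrant mult.commute)

lemma kern_pos: "p \<in> space quadrant \<Longrightarrow> z > 0 \<Longrightarrow> snd p < t \<Longrightarrow> kern \<beta> z t p > 0"
  by (auto simp: kern_def space_quadrant q0_pos)

section \<open>Moments of a mild solution against cosines of the noise\<close>

locale mild_noise = white_noise M W for M :: "'w measure" and W +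
  fixes \<beta> :: real and u :: "real \<Rightarrow> real \<Rightarrow> 'w \<Rightarrow> real"
  assumes \<beta>_pos: "\<beta> > 0" and mild: "mild_solution M W \<beta> u"
begin

sublocale Q: sigma_finite_measure quadrant by (rule sigma_finite_quadrant)
sublocale MQ: pair_sigma_finite M quadrant ..

definition U :: "real \<times> real \<Rightarrow> 'w \<Rightarrow> real" where
  "U p \<omega> = u (fst p) (snd p) \<omega>"

lemma U_L2: "p \<in> space quadrant \<Longrightarrow> U p \<in> L2_space M"
  using mild unfolding mild_solution_def U_def[abs_def] by (auto simp: space_quadrant)

lemma mild_skorohod:
  assumes "z > 0" "t > 0"
  obtains X where "has_skorohod_integral M W (\<lambda>p \<omega>. kern \<beta> z t p * U p \<omega>) X" "AE \<omega> in M. u z t \<omega> = u0 z t + X \<omega>"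
proof -
  have "(\<lambda>(w, \<tau>) \<omega>. if \<tau> < t then q0 z w (t - \<tau>) * (min w 1) powr \<beta> * u w \<tau> \<omega> else 0)
     = (\<lambda>p \<omega>. kern \<beta> z t p * U p \<omega>)"
    by (auto simp: fun_eq_iff kern_def U_def)
  moreover have "\<exists>X. has_skorohod_integral M W
          (\<lambda>(w, \<tau>) \<omega>. if \<tau> < t then q0 z w (t - \<tau>) * (min w 1) powr \<beta> * u w \<tau> \<omega> else 0) X \<and>
        (AE \<omega> in M. u z t \<omega> = u0 z t + X \<omega>)"
    using mild assms unfolding mild_solution_def by blast
  ultimately show ?thesis using that by auto
qed

lemma integrand_L2:
  assumes "z > 0" "t > 0"
  shows "(\<lambda>(\<omega>, p). kern \<beta> z t p * U p \<omega>) \<in> L2_space (M \<Otimes>\<^sub>M quadrant)"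
  using mild_skorohod[OF assms] by (auto simp: has_skorohod_integral_def)

text \<open>Joint measurability is part of the definition only for the integrands. Dividing by the
  kernel recovers u wherever the kernel is positive, which at any given point is the case for all
  large n.\<close>

lemma U_measurable: "(\<lambda>(\<omega>, p). U p \<omega>) \<in> borel_measurable (M \<Otimes>\<^sub>M quadrant)"
proof (rule borel_measurable_LIMSEQ_real)
  fix n :: nat
  have [measurable]: "(\<lambda>(\<omega>, p). kern \<beta> 1 (real (Suc n)) p * U p \<omega>) \<in> borel_measurable (M \<Otimes>\<^sub>M quadrant)"
    by (intro L2_measurable integrand_L2) auto
  show "(\<lambda>x. (case x of (\<omega>, p) \<Rightarrow> kern \<beta> 1 (real (Suc n)) p * U p \<omega>) / kern \<beta> 1 (real (Suc n)) (snd x))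
    \<in> borel_measurable (M \<Otimes>\<^sub>M quadrant)" by measurable
next
  fix x assume "x \<in> space (M \<Otimes>\<^sub>M quadrant)"
  then obtain \<omega> p where x: "x = (\<omega>, p)" "p \<in> space quadrant" by (auto simp: space_pair_measure)
  obtain N :: nat where N: "snd p < real N" using reals_Archimedean2 by blast
  have "eventually (\<lambda>n. (case x of (\<omega>, p) \<Rightarrow> kern \<beta> 1 (real (Suc n)) p * U p \<omega>) / kern \<beta> 1 (real (Suc n)) (snd x)
      = (case x of (\<omega>, p) \<Rightarrow> U p \<omega>)) sequentially"
    unfolding eventually_sequentially
  proof (intro exI allI impI)
    fix n assume "N \<le> n"
    then have "kern \<beta> 1 (real (Suc n)) p > 0" using x N by (intro kern_pos) auto
    then show "(case x of (\<omega>, p) \<Rightarrow> kern \<beta> 1 (real (Suc n)) p * U p \<omega>) / kern \<beta> 1 (real (Suc n)) (snd x)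
      = (case x of (\<omega>, p) \<Rightarrow> U p \<omega>)" by (simp add: x)
  qed
  then show "(\<lambda>n. (case x of (\<omega>, p) \<Rightarrow> kern \<beta> 1 (real (Suc n)) p * U p \<omega>) / kern \<beta> 1 (real (Suc n)) (snd x))
     \<longlonglongrightarrow> (case x of (\<omega>, p) \<Rightarrow> U p \<omega>)" by (rule tendsto_eventually)
qed

lemma U_measurable_swap [measurable]: "(\<lambda>(p, \<omega>). U p \<omega>) \<in> borel_measurable (quadrant \<Otimes>\<^sub>M M)"
  using measurable_pair_swap[OF U_measurable] by simp

definition second_moment :: "real \<times> real \<Rightarrow> real" where
  "second_moment p = expectation (\<lambda>\<omega>. (U p \<omega>)\<^sup>2)"

lemma second_moment_nonneg: "second_moment p \<ge> 0"
  by (simp add: second_moment_def)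

lemma second_moment_measurable [measurable]: "second_moment \<in> borel_measurable quadrant"
  unfolding second_moment_def[abs_def] by (rule borel_measurable_lebesgue_integral) measurable

text \<open>Square integrability of the integrand on the product space, read through Tonelli. It
  supplies the finiteness that \<open>kernel_gronwall\<close> asks for.\<close>

lemma kernel_op_second_moment_finite:
  assumes "z > 0" "t > 0"
  shows "kernel_op \<beta> (\<lambda>p. ennreal (second_moment p)) z t < \<infinity>"
proof -
  let ?V = "\<lambda>\<omega> p. kern \<beta> z t p * U p \<omega>"
  have [measurable]: "(\<lambda>(\<omega>, p). ?V \<omega> p) \<in> borel_measurable (M \<Otimes>\<^sub>M quadrant)"
    by (rule L2_measurable[OF integrand_L2[OF assms]])
  have "kernel_op \<beta> (\<lambda>p. ennreal (second_moment p)) z t = (\<integral>\<^sup>+p. (\<integral>\<^sup>+\<omega>. ennreal ((?V \<omega> p)\<^sup>2) \<partial>M) \<partial>quadrant)"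
    unfolding kernel_op_kern
  proof (intro nn_integral_cong)
    fix p assume p: "p \<in> space quadrant"
    have "ennreal (second_moment p) = (\<integral>\<^sup>+\<omega>. ennreal ((U p \<omega>)\<^sup>2) \<partial>M)"
      unfolding second_moment_def using L2_integrable_sq[OF U_L2[OF p]] by (intro nn_integral_eq_integral[symmetric]) auto
    then show "ennreal ((kern \<beta> z t p)\<^sup>2) * ennreal (second_moment p) = (\<integral>\<^sup>+\<omega>. ennreal ((?V \<omega> p)\<^sup>2) \<partial>M)"
      using L2_measurable[OF U_L2[OF p]]
      by (simp add: nn_integral_cmult[symmetric] power_mult_distrib ennreal_mult)
  qed
  also have "\<dots> = (\<integral>\<^sup>+x. ennreal ((case x of (\<omega>, p) \<Rightarrow> ?V \<omega> p)\<^sup>2) \<partial>(M \<Otimes>\<^sub>M quadrant))"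
    by (subst MQ.nn_integral_snd[symmetric]) auto
  also have "\<dots> < \<infinity>"
    using L2_integrable_sq[OF integrand_L2[OF assms]] by (auto simp: integrable_iff_bounded)
  finally show ?thesis .
qed

text \<open>A function dominated by the second moments inherits their finiteness, so
  \<open>kernel_op\<close> of its square becomes a real squared norm to which Cauchy-Schwarz
  applies.\<close>

lemma kern_mult_L2:
  assumes z: "z > 0" and t: "t > 0" and [measurable]: "f \<in> borel_measurable quadrant"
    and bd: "\<And>p. p \<in> space quadrant \<Longrightarrow> (f p)\<^sup>2 \<le> C * second_moment p"
  shows kern_mult_in_L2: "(\<lambda>p. kern \<beta> z t p * f p) \<in> L2_space quadrant"
    and kern_mult_norm: "ennreal (LINT p|quadrant. (kern \<beta> z t p * f p)\<^sup>2) = kernel_op \<beta> (\<lambda>p. ennreal ((f p)\<^sup>2)) z t"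
proof -
  have eq: "(\<integral>\<^sup>+p. ennreal ((kern \<beta> z t p * f p)\<^sup>2) \<partial>quadrant) = kernel_op \<beta> (\<lambda>p. ennreal ((f p)\<^sup>2)) z t"
    unfolding kernel_op_kern by (intro nn_integral_cong) (simp add: power_mult_distrib ennreal_mult)
  have "kernel_op \<beta> (\<lambda>p. ennreal ((f p)\<^sup>2)) z t \<le> kernel_op \<beta> (\<lambda>p. ennreal \<bar>C\<bar> * ennreal (second_moment p)) z t"
  proof (rule kernel_op_mono)
    fix w \<tau> :: real assume "0 < w" "0 < \<tau>"
    then have "(f (w, \<tau>))\<^sup>2 \<le> C * second_moment (w, \<tau>)" by (intro bd) (simp add: space_quadrant)
    also have "\<dots> \<le> \<bar>C\<bar> * second_moment (w, \<tau>)" by (intro mult_right_mono second_moment_nonneg) simp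
    finally show "ennreal ((f (w, \<tau>))\<^sup>2) \<le> ennreal \<bar>C\<bar> * ennreal (second_moment (w, \<tau>))"
      by (simp add: ennreal_leI second_moment_nonneg flip: ennreal_mult)
  qed
  also have "\<dots> < \<infinity>"
    using kernel_op_second_moment_finite[OF z t] by (subst kernel_op_cmult) (auto simp: ennreal_mult_less_top)
  finally have fin: "kernel_op \<beta> (\<lambda>p. ennreal ((f p)\<^sup>2)) z t < \<infinity>" .
  have int: "integrable quadrant (\<lambda>p. (kern \<beta> z t p * f p)\<^sup>2)"
    unfolding integrable_iff_bounded using eq fin by simp
  then show "(\<lambda>p. kern \<beta> z t p * f p) \<in> L2_space quadrant" by (simp add: L2_space_def)
  show "ennreal (LINT p|quadrant. (kern \<beta> z t p * f p)\<^sup>2) = kernel_op \<beta> (\<lambda>p. ennreal ((f p)\<^sup>2)) z t"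
    unfolding eq[symmetric] using int by (intro nn_integral_eq_integral[symmetric]) auto
qed

definition cos_moment :: "real \<Rightarrow> (real \<times> real \<Rightarrow> real) \<Rightarrow> real \<times> real \<Rightarrow> real" where
  "cos_moment \<theta> h p = expectation (\<lambda>\<omega>. cos (W h \<omega> + \<theta>) * U p \<omega>)"

lemma cos_L2:
  assumes [measurable]: "Y \<in> borel_measurable M"
  shows "(\<lambda>\<omega>. cos (Y \<omega> + \<theta>)) \<in> L2_space M"
  by (rule L2_bound[of "\<lambda>_. 1"]) (auto simp: L2_space_def)

lemma cos_moment_measurable [measurable]:
  assumes "h \<in> H_space"
  shows "cos_moment \<theta> h \<in> borel_measurable quadrant"
proof -
  note [measurable] = W_measurable[OF assms]
  show ?thesis unfolding cos_moment_def[abs_def] by (rule borel_measurable_lebesgue_integral) measurable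
qed

lemma cos_moment_sq_le:
  assumes h: "h \<in> H_space" and p: "p \<in> space quadrant"
  shows "(cos_moment \<theta> h p)\<^sup>2 \<le> second_moment p"
proof -
  have "(cos_moment \<theta> h p)\<^sup>2 \<le> expectation (\<lambda>\<omega>. (cos (W h \<omega> + \<theta>))\<^sup>2) * second_moment p"
    unfolding cos_moment_def second_moment_def by (intro L2_cauchy_schwarz cos_L2 W_measurable h U_L2 p)
  also have "\<dots> \<le> 1 * second_moment p"
  proof (rule mult_right_mono[OF _ second_moment_nonneg])
    have "expectation (\<lambda>\<omega>. (cos (W h \<omega> + \<theta>))\<^sup>2) \<le> expectation (\<lambda>\<omega>. 1)"
      by (intro integral_mono L2_integrable_sq cos_L2 W_measurable h) (auto simp: abs_square_le_1)
    then show "expectation (\<lambda>\<omega>. (cos (W h \<omega> + \<theta>))\<^sup>2) \<le> 1" by (simp add: prob_space)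
  qed
  finally show ?thesis by simp
qed

text \<open>Each use of the Skorohod duality shifts the phase by pi/2. Since two phases span all of
  them, 0 and pi/2 suffice for a closed system of equations.\<close>

lemma cos_moment_rotate:
  assumes h: "h \<in> H_space" and p: "p \<in> space quadrant"
  shows "cos_moment \<theta> h p = cos \<theta> * cos_moment 0 h p + sin \<theta> * cos_moment (pi/2) h p"
proof -
  have "cos_moment \<theta> h p = expectation (\<lambda>\<omega>. cos \<theta> * (cos (W h \<omega> + 0) * U p \<omega>) + sin \<theta> * (cos (W h \<omega> + pi/2) * U p \<omega>))"
    unfolding cos_moment_def
    by (intro Bochner_Integration.integral_cong) (auto simp: cos_add algebra_simps)
  also have "\<dots> = cos \<theta> * cos_moment 0 h p + sin \<theta> * cos_moment (pi/2) h p"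
    unfolding cos_moment_def
  proof -
    have i: "integrable M (\<lambda>\<omega>. cos (W h \<omega> + \<alpha>) * U p \<omega>)" for \<alpha>
      by (intro L2_mult_integrable cos_L2 W_measurable h U_L2 p)
    show "expectation (\<lambda>\<omega>. cos \<theta> * (cos (W h \<omega> + 0) * U p \<omega>) + sin \<theta> * (cos (W h \<omega> + pi/2) * U p \<omega>))
      = cos \<theta> * expectation (\<lambda>\<omega>. cos (W h \<omega> + 0) * U p \<omega>) + sin \<theta> * expectation (\<lambda>\<omega>. cos (W h \<omega> + pi/2) * U p \<omega>)"
      using Bochner_Integration.integral_add[OF integrable_mult_right[OF i[of 0], of "cos \<theta>"] integrable_mult_right[OF i[of "pi/2"], of "sin \<theta>"]]
      by simp
  qed
  finally show ?thesis .
qed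

lemma cos_moment_kern_L2:
  assumes "z > 0" "t > 0" "h \<in> H_space"
  shows "(\<lambda>p. kern \<beta> z t p * cos_moment \<theta> h p) \<in> L2_space quadrant"
  by (rule kern_mult_in_L2[where C=1]) (use assms cos_moment_sq_le in auto)

text \<open>The defining duality for a function of the single variable W h, followed by Fubini. The
  exchange is justified because both h and the integrand are square integrable on the product space
  and the cosine is bounded.\<close>

lemma skorohod_cos:
  assumes sk: "has_skorohod_integral M W (\<lambda>p \<omega>. kern \<beta> z t p * U p \<omega>) X"
    and h: "h \<in> H_space"
  shows "expectation (\<lambda>\<omega>. cos (W h \<omega> + \<theta>) * X \<omega>)
    = (LINT p|quadrant. h p * (kern \<beta> z t p * cos_moment (\<theta> + pi/2) h p))"
proof -
  let ?v = "\<lambda>p \<omega>. kern \<beta> z t p * U p \<omega>"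
  let ?f = "\<lambda>x :: nat \<Rightarrow> real. cos (x 0 + \<theta>)"
  let ?g = "\<lambda>\<omega> p. cos (W h \<omega> + (\<theta> + pi/2)) * h p"
  note [measurable] = W_measurable[OF h] L2_measurable[OF h]
  have Lv: "(\<lambda>(\<omega>, p). ?v p \<omega>) \<in> L2_space (M \<Otimes>\<^sub>M quadrant)"
    using sk by (auto simp: has_skorohod_integral_def)
  have Lh: "(\<lambda>(\<omega>, p). h p) \<in> L2_space (M \<Otimes>\<^sub>M quadrant)"
  proof -
    have "integrable (M \<Otimes>\<^sub>M quadrant) (\<lambda>(\<omega>, p). (h p)\<^sup>2)"
      using L2_integrable_sq[OF h] by (intro MQ.Fubini_integrable) auto
    then show ?thesis by (simp add: L2_space_def case_prod_unfold)
  qed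
  have Lg: "(\<lambda>(\<omega>, p). ?g \<omega> p) \<in> L2_space (M \<Otimes>\<^sub>M quadrant)"
  proof (rule L2_bound[OF Lh])
    show "AE x in M \<Otimes>\<^sub>M quadrant. \<bar>case x of (\<omega>, p) \<Rightarrow> ?g \<omega> p\<bar> \<le> \<bar>case x of (\<omega>, p) \<Rightarrow> h p\<bar>"
      by (intro AE_I2) (auto simp: abs_mult mult_left_le_one_le split: prod.split)
  qed measurable
  have int: "integrable (M \<Otimes>\<^sub>M quadrant) (\<lambda>(\<omega>, p). ?g \<omega> p * ?v p \<omega>)"
    using L2_mult_integrable[OF Lg Lv] by (simp add: case_prod_unfold)
  have "expectation (\<lambda>\<omega>. cos (W h \<omega> + \<theta>) * X \<omega>)
     = expectation (\<lambda>\<omega>. H_inner (malliavin_deriv W 1 ?f (\<lambda>_. h) \<omega>) (\<lambda>p. ?v p \<omega>))"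
  proof -
    have "\<forall>n f h. smooth_poly_growth n f \<and> (\<forall>i<n. h i \<in> H_space) \<longrightarrow>
        (LINT \<omega>|M. f (\<lambda>j. W (h j) \<omega>) * X \<omega>) =
        (LINT \<omega>|M. H_inner (malliavin_deriv W n f h \<omega>) (\<lambda>p. ?v p \<omega>))"
      using sk by (auto simp: has_skorohod_integral_def)
    from this[rule_format, of 1 ?f "\<lambda>_. h"] show ?thesis using smooth_poly_growth_cos h by simp
  qed
  also have "\<dots> = (LINT \<omega>|M. (LINT p|quadrant. ?g \<omega> p * ?v p \<omega>))"
    by (simp add: H_inner_def malliavin_deriv_def partial_deriv_cos)
  also have "\<dots> = (LINT p|quadrant. (LINT \<omega>|M. ?g \<omega> p * ?v p \<omega>))"
    by (rule MQ.Fubini_integral[symmetric, OF int])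
  also have "\<dots> = (LINT p|quadrant. h p * (kern \<beta> z t p * cos_moment (\<theta> + pi/2) h p))"
  proof (rule Bochner_Integration.integral_cong[OF refl])
    fix p
    have "(LINT \<omega>|M. ?g \<omega> p * ?v p \<omega>) = (LINT \<omega>|M. (h p * kern \<beta> z t p) * (cos (W h \<omega> + (\<theta> + pi/2)) * U p \<omega>))"
      by (intro Bochner_Integration.integral_cong) auto
    then show "(LINT \<omega>|M. ?g \<omega> p * ?v p \<omega>) = h p * (kern \<beta> z t p * cos_moment (\<theta> + pi/2) h p)"
      by (simp add: cos_moment_def)
  qed
  finally show ?thesis .
qed

text \<open>The constant 1 is almost surely the cosine of the noise of h = 0, for which the right
  side of \<open>skorohod_cos\<close> vanishes.\<close>

lemma skorohod_mean:
  assumes sk: "has_skorohod_integral M W (\<lambda>p \<omega>. kern \<beta> z t p * U p \<omega>) X"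
  shows "expectation X = 0"
proof -
  have X: "X \<in> L2_space M" using sk by (auto simp: has_skorohod_integral_def)
  note [measurable] = W_measurable[OF zero_in_H] L2_measurable[OF X]
  have "AE \<omega> in M. W (\<lambda>_. 0) \<omega> = 0"
    using W_lincomb[OF zero_in_H zero_in_H, of 0 0] by simp
  then have "expectation X = expectation (\<lambda>\<omega>. cos (W (\<lambda>_. 0) \<omega> + 0) * X \<omega>)"
    by (intro integral_cong_AE) auto
  also have "\<dots> = 0" by (subst skorohod_cos[OF sk zero_in_H]) simp
  finally show ?thesis .
qed

lemma cos_moment_equation:
  assumes z: "z > 0" and t: "t > 0" and h: "h \<in> H_space"
  shows "cos_moment \<theta> h (z, t) = u0 z t * (exp (- H_inner h h / 2) * cos \<theta>)
    + (LINT p|quadrant. h p * (kern \<beta> z t p * cos_moment (\<theta> + pi/2) h p))"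
proof -
  obtain X where sk: "has_skorohod_integral M W (\<lambda>p \<omega>. kern \<beta> z t p * U p \<omega>) X"
    and X: "AE \<omega> in M. u z t \<omega> = u0 z t + X \<omega>" by (rule mild_skorohod[OF z t])
  have XL: "X \<in> L2_space M" using sk by (auto simp: has_skorohod_integral_def)
  have UL: "U (z, t) \<in> L2_space M" using z t by (intro U_L2) (simp add: space_quadrant)
  note [measurable] = W_measurable[OF h] L2_measurable[OF XL] L2_measurable[OF UL]
  have "cos_moment \<theta> h (z, t) = expectation (\<lambda>\<omega>. u0 z t * cos (W h \<omega> + \<theta>) + cos (W h \<omega> + \<theta>) * X \<omega>)"
    unfolding cos_moment_def
    by (intro integral_cong_AE; (measurable)?) (use X in \<open>auto simp: U_def algebra_simps\<close>)
  also have "\<dots> = u0 z t * expectation (\<lambda>\<omega>. cos (W h \<omega> + \<theta>)) + expectation (\<lambda>\<omega>. cos (W h \<omega> + \<theta>) * X \<omega>)"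
  proof -
    have "integrable M (\<lambda>\<omega>. cos (W h \<omega> + \<theta>))" by (rule integrable_const_bound[where B=1], simp, measurable)
    moreover have "integrable M (\<lambda>\<omega>. cos (W h \<omega> + \<theta>) * X \<omega>)" by (intro L2_mult_integrable cos_L2 XL) measurable
    ultimately show ?thesis by simp
  qed
  finally show ?thesis by (simp only: expectation_cos[OF h] skorohod_cos[OF sk h])
qed

end

section \<open>Adaptedness and second moments\<close>

lemma before_H:
  assumes "h \<in> H_space"
  shows "before snd x h \<in> H_space"
  by (rule L2_bound[OF assms]) (use L2_measurable[OF assms] in \<open>auto simp: before_def\<close>)

lemma u0_bounds:
  assumes "z > 0" "t > 0"
  shows u0_ge: "z / (z + t) \<le> u0 z t" and u0_le: "u0 z t \<le> 2 * (z / (z + t))" and u0_pos: "u0 z t > 0"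
proof -
  have e: "(z / t) / (1 + z / t) = z / (z + t)" using assms by (simp add: field_simps)
  show "z / (z + t) \<le> u0 z t" using one_minus_exp_neg_ge[of "z / t"] assms unfolding e by (simp add: u0_def)
  moreover have "z / (z + t) > 0" using assms by simp
  ultimately show "u0 z t > 0" by linarith
  have "2 * (z / t) / (1 + z / t) = 2 * (z / (z + t))" using e by (metis times_divide_eq_right)
  then show "u0 z t \<le> 2 * (z / (z + t))" using one_minus_exp_neg_le[of "z / t"] assms by (simp add: u0_def)
qed

context mild_noise
begin

text \<open>Adaptedness in the form in which it is used: conditioning cos (W h + \<theta>) on the
  noise before the time of p replaces h by its restriction and multiplies by the Gaussian factor of
  the part that is cut off.\<close>

lemma cos_moment_nonanticipating:
  assumes h: "h \<in> H_space" and p: "p \<in> space quadrant"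
  shows "cos_moment \<theta> h p = exp (- (H_inner h h - H_inner (before snd (ereal (snd p)) h) (before snd (ereal (snd p)) h)) / 2)
    * cos_moment \<theta> (before snd (ereal (snd p)) h) p"
proof -
  obtain w \<tau> where wt: "p = (w, \<tau>)" "w > 0" "\<tau> > 0" using p by (auto simp: space_quadrant)
  define k where "k = before snd (ereal \<tau>) h"
  have k: "k \<in> H_space" unfolding k_def by (rule before_H[OF h])
  \<comment> \<open>This normalisation makes the inhomogeneous terms for h and k equal, so that the
    difference \<open>D\<close> solves a homogeneous equation.\<close>
  define a b where "a = exp (H_inner h h / 2)" and "b = exp (H_inner k k / 2)"
  define D where "D \<theta> q = a * cos_moment \<theta> h q - b * cos_moment \<theta> k q" for \<theta> q
  have [measurable]: "D \<theta> \<in> borel_measurable quadrant" for \<theta>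
    unfolding D_def[abs_def] using h k by measurable
  have D_bd: "(D \<theta> q)\<^sup>2 \<le> (2 * a\<^sup>2 + 2 * b\<^sup>2) * second_moment q" if q: "q \<in> space quadrant" for \<theta> q
  proof -
    have "(x - y)\<^sup>2 \<le> 2 * x\<^sup>2 + 2 * y\<^sup>2" for x y :: real
      using zero_le_power2[of "x + y"] by (simp add: power2_eq_square algebra_simps)
    then have "(D \<theta> q)\<^sup>2 \<le> 2 * (a * cos_moment \<theta> h q)\<^sup>2 + 2 * (b * cos_moment \<theta> k q)\<^sup>2" unfolding D_def .
    also have "\<dots> = 2 * a\<^sup>2 * (cos_moment \<theta> h q)\<^sup>2 + 2 * b\<^sup>2 * (cos_moment \<theta> k q)\<^sup>2"
      by (simp add: power_mult_distrib)
    also have "\<dots> \<le> 2 * a\<^sup>2 * second_moment q + 2 * b\<^sup>2 * second_moment q"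
      by (intro add_mono mult_left_mono cos_moment_sq_le h k q) auto
    finally show ?thesis by (simp add: distrib_right)
  qed
  have D_eq: "D \<theta> (z, t) = (LINT q|quadrant. h q * (kern \<beta> z t q * D (\<theta> + pi/2) q))"
    if z: "z > 0" and t: "0 < t" "t \<le> \<tau>" for \<theta> z t
  proof -
    have cancel: "a * exp (- H_inner h h / 2) = 1" "b * exp (- H_inner k k / 2) = 1"
      by (simp_all add: a_def b_def flip: exp_add)
    \<comment> \<open>For t <= \<tau> the kernel is supported before \<tau>, where k and h agree;
      hence both equations can be written with h.\<close>
    have kk: "k q * (kern \<beta> z t q * x) = h q * (kern \<beta> z t q * x)" for q x
      using t by (auto simp: k_def before_def kern_def)
    have i: "integrable quadrant (\<lambda>q. g q * (kern \<beta> z t q * cos_moment \<theta> g q))" if "g \<in> H_space" for g \<theta>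
      by (intro L2_mult_integrable cos_moment_kern_L2 z t that)
    have "D \<theta> (z, t) = u0 z t * cos \<theta> * (a * exp (- H_inner h h / 2)) - u0 z t * cos \<theta> * (b * exp (- H_inner k k / 2))
      + (a * (LINT q|quadrant. h q * (kern \<beta> z t q * cos_moment (\<theta> + pi/2) h q))
        - b * (LINT q|quadrant. k q * (kern \<beta> z t q * cos_moment (\<theta> + pi/2) k q)))"
      unfolding D_def cos_moment_equation[OF z t(1) h] cos_moment_equation[OF z t(1) k] by (simp add: algebra_simps)
    also have "\<dots> = a * (LINT q|quadrant. h q * (kern \<beta> z t q * cos_moment (\<theta> + pi/2) h q))
        - b * (LINT q|quadrant. k q * (kern \<beta> z t q * cos_moment (\<theta> + pi/2) k q))"
      unfolding cancel by simp
    also have "\<dots> = (LINT q|quadrant. a * (h q * (kern \<beta> z t q * cos_moment (\<theta> + pi/2) h q))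
        - b * (k q * (kern \<beta> z t q * cos_moment (\<theta> + pi/2) k q)))"
      using Bochner_Integration.integral_diff[OF integrable_mult_right[OF i[OF h], of a "\<theta> + pi/2"] integrable_mult_right[OF i[OF k], of b "\<theta> + pi/2"]]
      by simp
    also have "\<dots> = (LINT q|quadrant. h q * (kern \<beta> z t q * D (\<theta> + pi/2) q))"
      by (intro Bochner_Integration.integral_cong refl)
         (simp only: D_def kk, simp add: algebra_simps)
    finally show ?thesis .
  qed
  have D_le: "ennreal ((D \<theta> (z, t))\<^sup>2) \<le> ennreal (H_inner h h) * kernel_op \<beta> (\<lambda>q. ennreal ((D (\<theta> + pi/2) q)\<^sup>2)) z t"
    if z: "z > 0" and t: "0 < t" "t \<le> \<tau>" for \<theta> z t
  proof -
    have L: "(\<lambda>q. kern \<beta> z t q * D (\<theta> + pi/2) q) \<in> L2_space quadrant"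
      by (rule kern_mult_in_L2[OF z t(1) _ D_bd]) measurable
    have "(D \<theta> (z, t))\<^sup>2 \<le> (LINT q|quadrant. (h q)\<^sup>2) * (LINT q|quadrant. (kern \<beta> z t q * D (\<theta> + pi/2) q)\<^sup>2)"
      unfolding D_eq[OF z t] by (rule L2_cauchy_schwarz[OF h L])
    then have "ennreal ((D \<theta> (z, t))\<^sup>2) \<le> ennreal (H_inner h h) * ennreal (LINT q|quadrant. (kern \<beta> z t q * D (\<theta> + pi/2) q)\<^sup>2)"
      by (subst ennreal_mult[symmetric]) (auto simp: H_inner_def power2_eq_square intro!: ennreal_leI)
    also have "ennreal (LINT q|quadrant. (kern \<beta> z t q * D (\<theta> + pi/2) q)\<^sup>2) = kernel_op \<beta> (\<lambda>q. ennreal ((D (\<theta> + pi/2) q)\<^sup>2)) z t"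
      by (rule kern_mult_norm[OF z t(1) _ D_bd]) measurable
    finally show ?thesis .
  qed
  have D_rot: "D \<theta> q = cos \<theta> * D 0 q + sin \<theta> * D (pi/2) q" if q: "q \<in> space quadrant" for \<theta> q
    unfolding D_def cos_moment_rotate[OF h q, of \<theta>] cos_moment_rotate[OF k q, of \<theta>] by (simp add: algebra_simps)
  \<comment> \<open>Summing over two phases closes the estimate: phase 0 is bounded through pi/2,
    and pi/2 through pi, which is phase 0 up to a sign removed by squaring.\<close>
  define g where "g q = ennreal ((D 0 q)\<^sup>2) + ennreal ((D (pi/2) q)\<^sup>2)" for q
  have "g (w, \<tau>) = 0"
  proof (rule kernel_gronwall[OF \<beta>_pos \<open>\<tau> > 0\<close> _ _ _ \<open>w > 0\<close> \<open>\<tau> > 0\<close> order_refl])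
    show "g \<in> borel_measurable quadrant" unfolding g_def[abs_def] by measurable
    have "kernel_op \<beta> g 1 (7 * \<tau>) \<le> kernel_op \<beta> (\<lambda>q. ennreal (2 * (2 * a\<^sup>2 + 2 * b\<^sup>2)) * ennreal (second_moment q)) 1 (7 * \<tau>)"
    proof (rule kernel_op_mono)
      fix w' \<tau>' :: real assume "0 < w'" "0 < \<tau>'"
      then have q: "(w', \<tau>') \<in> space quadrant" by (simp add: space_quadrant)
      have "(D 0 (w', \<tau>'))\<^sup>2 + (D (pi/2) (w', \<tau>'))\<^sup>2 \<le> 2 * (2 * a\<^sup>2 + 2 * b\<^sup>2) * second_moment (w', \<tau>')"
        using D_bd[OF q, of 0] D_bd[OF q, of "pi/2"] by linarith
      then show "g (w', \<tau>') \<le> ennreal (2 * (2 * a\<^sup>2 + 2 * b\<^sup>2)) * ennreal (second_moment (w', \<tau>'))"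
        by (simp add: g_def second_moment_nonneg ennreal_leI flip: ennreal_mult ennreal_plus)
    qed
    also have "\<dots> < \<infinity>"
      using kernel_op_second_moment_finite[of 1 "7 * \<tau>"] \<open>\<tau> > 0\<close>
      by (subst kernel_op_cmult) (auto simp: ennreal_mult_less_top)
    finally show "kernel_op \<beta> g 1 (7 * \<tau>) < \<infinity>" .
    fix z t :: real assume z: "0 < z" and t: "0 < t" "t \<le> \<tau>"
    have "kernel_op \<beta> (\<lambda>q. ennreal ((D (pi/2 + pi/2) q)\<^sup>2)) z t \<le> kernel_op \<beta> (\<lambda>q. ennreal ((D 0 q)\<^sup>2)) z t"
      by (intro kernel_op_mono) (auto simp: D_rot[of _ pi] space_quadrant)
    then have "g (z, t) \<le> ennreal (H_inner h h) * kernel_op \<beta> (\<lambda>q. ennreal ((D (pi/2) q)\<^sup>2)) z t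
        + ennreal (H_inner h h) * kernel_op \<beta> (\<lambda>q. ennreal ((D 0 q)\<^sup>2)) z t"
      unfolding g_def using D_le[OF z t, of 0] D_le[OF z t, of "pi/2"]
      by (intro add_mono order_trans[OF D_le[OF z t, of "pi/2"]] mult_left_mono) auto
    also have "\<dots> = ennreal (H_inner h h) * kernel_op \<beta> g z t"
      unfolding g_def[abs_def] by (subst kernel_op_add) (auto simp: distrib_left add.commute)
    finally show "g (z, t) \<le> ennreal (H_inner h h) * kernel_op \<beta> g z t" .
  qed
  then have "D 0 p = 0" "D (pi/2) p = 0" by (auto simp: g_def wt)
  then have "D \<theta> p = 0" using D_rot[OF p, of \<theta>] by simp
  then have "cos_moment \<theta> h p = b / a * cos_moment \<theta> k p" by (simp add: D_def a_def field_simps)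
  also have "b / a = exp (- (H_inner h h - H_inner k k) / 2)"
    by (simp add: a_def b_def exp_diff[symmetric] diff_divide_distrib)
  finally show ?thesis by (simp add: k_def wt)
qed

lemma H_inner_before:
  "H_inner (before snd x g) (before snd x h) = (LINT q|quadrant. before snd x (\<lambda>q. g q * h q) q)"
  unfolding H_inner_def by (intro Bochner_Integration.integral_cong) (auto simp: before_def)

text \<open>Since R is the primitive of g h along time, the integrals of g h e^R and of -g h e^(-R)
  are exact. B and A stand for the cosines of the phase difference and the phase sum in
  \<open>expectation_cos_cos\<close>.\<close>

lemma integral_conditional_gram:
  assumes g: "g \<in> H_space" and h: "h \<in> H_space"
  defines "R \<equiv> \<lambda>p. H_inner (before snd (ereal (snd p)) g) (before snd (ereal (snd p)) h)"
  shows "integrable quadrant (\<lambda>p. g p * h p * (exp (R p) * B - exp (- R p) * A))"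
    and "(LINT p|quadrant. g p * h p * (exp (R p) * B - exp (- R p) * A))
      = (exp (H_inner g h) - 1) * B + (exp (- H_inner g h) - 1) * A"
proof -
  let ?r = "\<lambda>p. g p * h p" and ?m = "\<lambda>p. - (g p * h p)"
  have r: "integrable quadrant ?r" by (rule L2_mult_integrable[OF g h])
  have m: "integrable quadrant ?m" using r by simp
  have s: "snd \<in> borel_measurable quadrant" by measurable
  have Rr: "R p = (LINT q|quadrant. before snd (ereal (snd p)) ?r q)" for p
    by (simp add: R_def H_inner_before)
  have Rm: "- R p = (LINT q|quadrant. before snd (ereal (snd p)) ?m q)" for p
  proof -
    have "before snd x ?m = (\<lambda>q. - before snd x ?r q)" for x by (auto simp: before_def)
    then show ?thesis unfolding Rr by simp
  qed
  have 1: "integrable quadrant (\<lambda>p. ?r p * exp (R p))" "(LINT p|quadrant. ?r p * exp (R p)) = exp (H_inner g h) - 1"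
    unfolding Rr using Q.exp_of_primitive[OF r s AE_quadrant_time] by (simp_all add: H_inner_def)
  have 2: "integrable quadrant (\<lambda>p. ?m p * exp (- R p))" "(LINT p|quadrant. ?m p * exp (- R p)) = exp (- H_inner g h) - 1"
    unfolding Rm using Q.exp_of_primitive[OF m s AE_quadrant_time] by (simp_all add: H_inner_def)
  have e: "(\<lambda>p. g p * h p * (exp (R p) * B - exp (- R p) * A)) = (\<lambda>p. ?r p * exp (R p) * B + ?m p * exp (- R p) * A)"
    by (auto simp: algebra_simps)
  show "integrable quadrant (\<lambda>p. g p * h p * (exp (R p) * B - exp (- R p) * A))"
    unfolding e using 1(1) 2(1) by (intro Bochner_Integration.integrable_add integrable_mult_left)
  show "(LINT p|quadrant. g p * h p * (exp (R p) * B - exp (- R p) * A))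
      = (exp (H_inner g h) - 1) * B + (exp (- H_inner g h) - 1) * A"
    unfolding e using Bochner_Integration.integral_add[OF integrable_mult_left[OF 1(1), of B] integrable_mult_left[OF 2(1), of A]]
    by (simp only: integral_mult_left_zero 1(2) 2(2))
qed

text \<open>The upper half of the Ito isometry, tested against F. By adaptedness, the derivative of
  F may be replaced in the pairing with u(p) by its conditional expectation \<open>G p\<close>, and
  by Clark-Ocone the integral of E[(G p)^2] is the variance of F. Cauchy-Schwarz is used over the
  probability space for each p and then over p.\<close>

lemma skorohod_pairing_le:
  assumes sk: "has_skorohod_integral M W (\<lambda>p \<omega>. kern \<beta> z t p * U p \<omega>) X"
    and z: "z > 0" and t: "t > 0" and F: "F \<in> trig_span"
  shows "(expectation (\<lambda>\<omega>. F \<omega> * X \<omega>))\<^sup>2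
    \<le> (LINT p|quadrant. (kern \<beta> z t p)\<^sup>2 * second_moment p) * expectation (\<lambda>\<omega>. (F \<omega>)\<^sup>2)"
proof -
  obtain n :: nat and c h \<theta> where h: "\<And>j. h j \<in> H_space" and Fe: "F = (\<lambda>\<omega>. \<Sum>j<n. c j * cos (W (h j) \<omega> + \<theta> j))"
    using trig_span_sum[OF F] by blast
  have X: "X \<in> L2_space M" using sk by (auto simp: has_skorohod_integral_def)
  define hb where "hb j p = before snd (ereal (snd p)) (h j)" for j and p :: "real \<times> real"
  have hb: "hb j p \<in> H_space" for j p unfolding hb_def by (rule before_H[OF h])
  define a where "a j = c j * exp (- H_inner (h j) (h j) / 2)" for j
  define R where "R j k p = H_inner (hb j p) (hb k p)" for j k p
  \<comment> \<open>Formally the conditional expectation of the derivative of F at p given the noise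
    before \<open>snd p\<close>. The phase pi/2 comes from differentiating; c_j times the
    conditioning factor equals \<open>a j * exp (R j j p / 2)\<close>.\<close>
  define G where "G p \<omega> = (\<Sum>j<n. a j * h j p * exp (R j j p / 2) * cos (W (hb j p) \<omega> + (\<theta> j + pi/2)))" for p \<omega>
  define B where "B p = (\<Sum>j<n. c j * h j p * cos_moment (\<theta> j + pi/2) (h j) p)" for p
  define \<Gamma> where "\<Gamma> p = (\<Sum>j<n. \<Sum>k<n. a j * a k * (h j p * h k p *
      (exp (R j k p) * cos (\<theta> j - \<theta> k) - exp (- R j k p) * cos (\<theta> j + \<theta> k))) / 2)" for p
  have GL: "G p \<in> L2_space M" for p
  proof -
    have "(\<lambda>\<omega>. \<Sum>j<m. a j * h j p * exp (R j j p / 2) * cos (W (hb j p) \<omega> + (\<theta> j + pi/2))) \<in> L2_space M" for m :: nat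
    proof (induction m)
      case 0
      then show ?case by (simp add: L2_space_def)
    next
      case (Suc m)
      then show ?case unfolding sum.lessThan_Suc by (intro L2_add L2_cmult cos_L2 W_measurable hb)
    qed
    then show ?thesis unfolding G_def[abs_def] .
  qed
  have cosint: "integrable M (\<lambda>\<omega>. cos (W g \<omega> + \<alpha>) * cos (W g' \<omega> + \<alpha>'))" if "g \<in> H_space" "g' \<in> H_space" for g g' \<alpha> \<alpha>'
    by (intro L2_mult_integrable cos_L2 W_measurable that)
  have \<Gamma>G: "expectation (\<lambda>\<omega>. (G p \<omega>)\<^sup>2) = \<Gamma> p" for p
  proof -
    let ?b = "\<lambda>j. a j * h j p * exp (R j j p / 2)"
    have "expectation (\<lambda>\<omega>. (G p \<omega>)\<^sup>2) = expectation (\<lambda>\<omega>. \<Sum>j<n. \<Sum>k<n. ?b j * ?b k *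
        (cos (W (hb j p) \<omega> + (\<theta> j + pi/2)) * cos (W (hb k p) \<omega> + (\<theta> k + pi/2))))"
      unfolding G_def power2_eq_square sum_product by (simp add: mult_ac)
    also have "\<dots> = (\<Sum>j<n. \<Sum>k<n. ?b j * ?b k *
        expectation (\<lambda>\<omega>. cos (W (hb j p) \<omega> + (\<theta> j + pi/2)) * cos (W (hb k p) \<omega> + (\<theta> k + pi/2))))"
      using cosint hb by (subst Bochner_Integration.integral_sum; (subst Bochner_Integration.integral_sum)?; simp)
    also have "\<dots> = \<Gamma> p"
      unfolding \<Gamma>_def
    proof (intro sum.cong refl)
      fix j k
      have 1: "cos ((\<theta> j + pi/2) + (\<theta> k + pi/2)) = - cos (\<theta> j + \<theta> k)"
      proof -
        have "(\<theta> j + pi/2) + (\<theta> k + pi/2) = (\<theta> j + \<theta> k) + pi" by simp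
        then show ?thesis by (simp only: cos_periodic_pi)
      qed
      have 2: "(\<theta> j + pi/2) - (\<theta> k + pi/2) = \<theta> j - \<theta> k" by simp
      have 3: "exp (R j j p / 2) * exp (R k k p / 2) * exp (- (R j j p + R k k p) / 2) = 1"
        by (simp add: field_simps flip: exp_add)
      have "?b j * ?b k * expectation (\<lambda>\<omega>. cos (W (hb j p) \<omega> + (\<theta> j + pi/2)) * cos (W (hb k p) \<omega> + (\<theta> k + pi/2)))
        = (exp (R j j p / 2) * exp (R k k p / 2) * exp (- (R j j p + R k k p) / 2)) * (a j * a k * (h j p * h k p) *
          (exp (- R j k p) * (- cos (\<theta> j + \<theta> k)) + exp (R j k p) * cos (\<theta> j - \<theta> k)) / 2)"
        unfolding expectation_cos_cos[OF hb hb] 1 2 R_def by simp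
      also have "\<dots> = a j * a k * (h j p * h k p *
          (exp (R j k p) * cos (\<theta> j - \<theta> k) - exp (- R j k p) * cos (\<theta> j + \<theta> k))) / 2"
        unfolding 3 by simp
      finally show "?b j * ?b k * expectation (\<lambda>\<omega>. cos (W (hb j p) \<omega> + (\<theta> j + pi/2)) * cos (W (hb k p) \<omega> + (\<theta> k + pi/2)))
        = a j * a k * (h j p * h k p * (exp (R j k p) * cos (\<theta> j - \<theta> k) - exp (- R j k p) * cos (\<theta> j + \<theta> k))) / 2" .
    qed
    finally show ?thesis .
  qed
  have \<Gamma>0: "\<Gamma> p \<ge> 0" for p unfolding \<Gamma>G[symmetric] by simp
  note gram = integral_conditional_gram[OF h h, folded hb_def, folded R_def]
  have \<Gamma>i: "integrable quadrant \<Gamma>"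
    unfolding \<Gamma>_def[abs_def] using gram(1)
    by (intro Bochner_Integration.integrable_sum integrable_divide integrable_mult_right)
  \<comment> \<open>The integral equals E[F^2] - E[F]^2: the terms -1 left by the exact integration
    assemble to the square of E[F] = sum of a_j cos \<theta>_j.\<close>
  have \<Gamma>le: "(LINT p|quadrant. \<Gamma> p) \<le> expectation (\<lambda>\<omega>. (F \<omega>)\<^sup>2)"
  proof -
    have "(LINT p|quadrant. \<Gamma> p) = (\<Sum>j<n. \<Sum>k<n. a j * a k * (LINT p|quadrant. h j p * h k p *
      (exp (R j k p) * cos (\<theta> j - \<theta> k) - exp (- R j k p) * cos (\<theta> j + \<theta> k))) / 2)"
      unfolding \<Gamma>_def using gram(1)
      by (subst Bochner_Integration.integral_sum; (subst Bochner_Integration.integral_sum)?; simp)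
    also have "\<dots> = (\<Sum>j<n. \<Sum>k<n. a j * a k *
        ((exp (H_inner (h j) (h k)) - 1) * cos (\<theta> j - \<theta> k) + (exp (- H_inner (h j) (h k)) - 1) * cos (\<theta> j + \<theta> k)) / 2)"
      by (simp only: gram(2))
    also have "\<dots> = (\<Sum>j<n. \<Sum>k<n. c j * c k * expectation (\<lambda>\<omega>. cos (W (h j) \<omega> + \<theta> j) * cos (W (h k) \<omega> + \<theta> k))
        - (a j * cos (\<theta> j)) * (a k * cos (\<theta> k)))"
    proof (intro sum.cong refl)
      fix j k
      have aa: "a j * a k = c j * c k * exp (- (H_inner (h j) (h j) + H_inner (h k) (h k)) / 2)"
        by (simp add: a_def field_simps flip: exp_add)
      have cc: "cos (\<theta> j) * cos (\<theta> k) = (cos (\<theta> j - \<theta> k) + cos (\<theta> j + \<theta> k)) / 2" by (simp add: cos_times_cos)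
      have "(a j * cos (\<theta> j)) * (a k * cos (\<theta> k)) = (a j * a k) * (cos (\<theta> j) * cos (\<theta> k))" by simp
      also have "\<dots> = (a j * a k) * ((cos (\<theta> j - \<theta> k) + cos (\<theta> j + \<theta> k)) / 2)" unfolding cc ..
      finally have cc': "(a j * cos (\<theta> j)) * (a k * cos (\<theta> k)) = (a j * a k) * ((cos (\<theta> j - \<theta> k) + cos (\<theta> j + \<theta> k)) / 2)" .
      have "c j * c k * expectation (\<lambda>\<omega>. cos (W (h j) \<omega> + \<theta> j) * cos (W (h k) \<omega> + \<theta> k))
        = (a j * a k) * ((exp (- H_inner (h j) (h k)) * cos (\<theta> j + \<theta> k) + exp (H_inner (h j) (h k)) * cos (\<theta> j - \<theta> k)) / 2)"
        unfolding aa expectation_cos_cos[OF h h] by simp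
      then show "a j * a k * ((exp (H_inner (h j) (h k)) - 1) * cos (\<theta> j - \<theta> k) + (exp (- H_inner (h j) (h k)) - 1) * cos (\<theta> j + \<theta> k)) / 2
        = c j * c k * expectation (\<lambda>\<omega>. cos (W (h j) \<omega> + \<theta> j) * cos (W (h k) \<omega> + \<theta> k)) - (a j * cos (\<theta> j)) * (a k * cos (\<theta> k))"
        unfolding cc' by (simp add: algebra_simps diff_divide_distrib add_divide_distrib)
    qed
    also have "\<dots> = (\<Sum>j<n. \<Sum>k<n. c j * c k * expectation (\<lambda>\<omega>. cos (W (h j) \<omega> + \<theta> j) * cos (W (h k) \<omega> + \<theta> k)))
        - (\<Sum>j<n. a j * cos (\<theta> j))\<^sup>2"
      by (simp add: sum_subtractf power2_eq_square sum_product)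
    also have "(\<Sum>j<n. \<Sum>k<n. c j * c k * expectation (\<lambda>\<omega>. cos (W (h j) \<omega> + \<theta> j) * cos (W (h k) \<omega> + \<theta> k)))
       = expectation (\<lambda>\<omega>. \<Sum>j<n. \<Sum>k<n. c j * c k * (cos (W (h j) \<omega> + \<theta> j) * cos (W (h k) \<omega> + \<theta> k)))"
      using cosint h by (subst Bochner_Integration.integral_sum; (subst Bochner_Integration.integral_sum)?; simp)
    also have "\<dots> = expectation (\<lambda>\<omega>. (F \<omega>)\<^sup>2)"
      unfolding Fe power2_eq_square sum_product by (simp add: mult_ac)
    finally show ?thesis by simp
  qed
  have pairing: "expectation (\<lambda>\<omega>. F \<omega> * X \<omega>) = (LINT p|quadrant. kern \<beta> z t p * B p)"
  proof -
    have i: "integrable M (\<lambda>\<omega>. cos (W (h j) \<omega> + \<theta> j) * X \<omega>)" for j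
      by (intro L2_mult_integrable cos_L2 W_measurable h X)
    have i': "integrable quadrant (\<lambda>p. h j p * (kern \<beta> z t p * cos_moment (\<theta> j + pi/2) (h j) p))" for j
      by (intro L2_mult_integrable cos_moment_kern_L2 z t h)
    have "expectation (\<lambda>\<omega>. F \<omega> * X \<omega>) = expectation (\<lambda>\<omega>. \<Sum>j<n. c j * (cos (W (h j) \<omega> + \<theta> j) * X \<omega>))"
      unfolding Fe by (simp add: sum_distrib_right mult.assoc)
    also have "\<dots> = (\<Sum>j<n. c j * expectation (\<lambda>\<omega>. cos (W (h j) \<omega> + \<theta> j) * X \<omega>))"
      using i by (subst Bochner_Integration.integral_sum) auto
    also have "\<dots> = (\<Sum>j<n. c j * (LINT p|quadrant. h j p * (kern \<beta> z t p * cos_moment (\<theta> j + pi/2) (h j) p)))"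
      by (simp only: skorohod_cos[OF sk h])
    also have "\<dots> = (LINT p|quadrant. (\<Sum>j<n. c j * (h j p * (kern \<beta> z t p * cos_moment (\<theta> j + pi/2) (h j) p))))"
      using i' by (subst Bochner_Integration.integral_sum) auto
    also have "\<dots> = (LINT p|quadrant. kern \<beta> z t p * B p)"
      unfolding B_def by (simp add: sum_distrib_left mult_ac)
    finally show ?thesis .
  qed
  have [measurable]: "B \<in> borel_measurable quadrant"
    unfolding B_def[abs_def] using h L2_measurable[OF h] by measurable
  \<comment> \<open>\<open>B p\<close> pairs u(p) with the full derivative of F; adaptedness, in the
    form \<open>cos_moment_nonanticipating\<close>, allows \<open>G p\<close> in its place.\<close>
  have BG: "B p = expectation (\<lambda>\<omega>. G p \<omega> * U p \<omega>)" if p: "p \<in> space quadrant" for p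
  proof -
    have i: "integrable M (\<lambda>\<omega>. cos (W (hb j p) \<omega> + (\<theta> j + pi/2)) * U p \<omega>)" for j
      by (intro L2_mult_integrable cos_L2 W_measurable hb U_L2 p)
    have "expectation (\<lambda>\<omega>. G p \<omega> * U p \<omega>) = expectation (\<lambda>\<omega>. \<Sum>j<n. a j * h j p * exp (R j j p / 2) *
        (cos (W (hb j p) \<omega> + (\<theta> j + pi/2)) * U p \<omega>))"
      unfolding G_def by (simp add: sum_distrib_right mult.assoc)
    also have "\<dots> = (\<Sum>j<n. a j * h j p * exp (R j j p / 2) * cos_moment (\<theta> j + pi/2) (hb j p) p)"
      unfolding cos_moment_def using i by (subst Bochner_Integration.integral_sum) auto
    also have "\<dots> = B p" unfolding B_def
    proof (intro sum.cong refl)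
      fix j
      have "exp (- H_inner (h j) (h j) / 2) * exp (R j j p / 2) = exp (- (H_inner (h j) (h j) - R j j p) / 2)"
        by (simp add: field_simps flip: exp_add)
      then show "a j * h j p * exp (R j j p / 2) * cos_moment (\<theta> j + pi/2) (hb j p) p = c j * h j p * cos_moment (\<theta> j + pi/2) (h j) p"
        using cos_moment_nonanticipating[OF h p, of "\<theta> j + pi/2" j] unfolding a_def R_def hb_def by simp
    qed
    finally show ?thesis by simp
  qed
  have Bsq: "(B p)\<^sup>2 \<le> \<Gamma> p * second_moment p" if p: "p \<in> space quadrant" for p
    unfolding BG[OF p] \<Gamma>G[symmetric] second_moment_def by (intro L2_cauchy_schwarz GL U_L2 p)
  \<comment> \<open>The square root separates the pointwise bound into a factor that depends only on
    F and a factor that depends only on the kernel and u.\<close>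
  let ?f = "\<lambda>p. sqrt (\<Gamma> p)" and ?g = "\<lambda>p. kern \<beta> z t p * sqrt (second_moment p)"
  have fL: "?f \<in> L2_space quadrant" using \<Gamma>i \<Gamma>0 by (auto simp: L2_space_def)
  have gL: "?g \<in> L2_space quadrant"
    by (rule kern_mult_in_L2[OF z t, where C=1]) (auto simp: second_moment_nonneg)
  have le: "\<bar>kern \<beta> z t p * B p\<bar> \<le> \<bar>?f p * ?g p\<bar>" if p: "p \<in> space quadrant" for p
  proof -
    have "\<bar>B p\<bar> \<le> sqrt (\<Gamma> p * second_moment p)" using Bsq[OF p] by (intro real_le_rsqrt) simp
    then have "\<bar>kern \<beta> z t p\<bar> * \<bar>B p\<bar> \<le> \<bar>kern \<beta> z t p\<bar> * sqrt (\<Gamma> p * second_moment p)" by (intro mult_left_mono) auto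
    then show ?thesis using \<Gamma>0[of p] second_moment_nonneg[of p] by (simp add: abs_mult real_sqrt_mult mult_ac)
  qed
  have "\<bar>LINT p|quadrant. kern \<beta> z t p * B p\<bar> \<le> (LINT p|quadrant. \<bar>kern \<beta> z t p * B p\<bar>)"
    by (rule integral_abs_bound)
  also have "\<dots> \<le> (LINT p|quadrant. \<bar>?f p\<bar> * \<bar>?g p\<bar>)"
  proof (rule integral_mono)
    have fg: "integrable quadrant (\<lambda>p. \<bar>?f p * ?g p\<bar>)" by (intro integrable_abs L2_mult_integrable fL gL)
    then show "integrable quadrant (\<lambda>p. \<bar>?f p\<bar> * \<bar>?g p\<bar>)" by (simp only: abs_mult)
    show "integrable quadrant (\<lambda>p. \<bar>kern \<beta> z t p * B p\<bar>)"
      by (rule Bochner_Integration.integrable_bound[OF fg]) (use le in auto)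
    show "\<bar>kern \<beta> z t p * B p\<bar> \<le> \<bar>?f p\<bar> * \<bar>?g p\<bar>" if "p \<in> space quadrant" for p
      using le[OF that] by (simp only: abs_mult)
  qed
  finally have "\<bar>LINT p|quadrant. kern \<beta> z t p * B p\<bar> \<le> (LINT p|quadrant. \<bar>?f p\<bar> * \<bar>?g p\<bar>)" .
  then have "(LINT p|quadrant. kern \<beta> z t p * B p)\<^sup>2 \<le> (LINT p|quadrant. \<bar>?f p\<bar> * \<bar>?g p\<bar>)\<^sup>2"
    by (intro power2_le_iff_abs_le[THEN iffD2]) (auto intro!: Bochner_Integration.integral_nonneg)
  also have "\<dots> \<le> (LINT p|quadrant. \<bar>?f p\<bar>\<^sup>2) * (LINT p|quadrant. \<bar>?g p\<bar>\<^sup>2)"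
    by (rule L2_cauchy_schwarz) (use fL gL in \<open>auto simp: L2_space_def\<close>)
  also have "\<dots> = (LINT p|quadrant. \<Gamma> p) * (LINT p|quadrant. (kern \<beta> z t p)\<^sup>2 * second_moment p)"
    using \<Gamma>0 second_moment_nonneg by (simp add: power_mult_distrib)
  also have "\<dots> \<le> expectation (\<lambda>\<omega>. (F \<omega>)\<^sup>2) * (LINT p|quadrant. (kern \<beta> z t p)\<^sup>2 * second_moment p)"
    by (intro mult_right_mono \<Gamma>le Bochner_Integration.integral_nonneg) (auto simp: second_moment_nonneg)
  finally show ?thesis unfolding pairing by (simp add: mult.commute)
qed

text \<open>The pairing bound is uniform over a dense class of F, so duality turns it into a bound
  for the norm of X, a variable known only through its Skorohod pairings.\<close>

lemma skorohod_second_moment_le: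
  assumes sk: "has_skorohod_integral M W (\<lambda>p \<omega>. kern \<beta> z t p * U p \<omega>) X"
    and z: "z > 0" and t: "t > 0"
  shows "ennreal (expectation (\<lambda>\<omega>. (X \<omega>)\<^sup>2)) \<le> kernel_op \<beta> (\<lambda>p. ennreal (second_moment p)) z t"
proof -
  have X: "X \<in> L2_space M" using sk by (auto simp: has_skorohod_integral_def)
  let ?A = "LINT p|quadrant. (kern \<beta> z t p)\<^sup>2 * second_moment p"
  have "expectation (\<lambda>\<omega>. (X \<omega>)\<^sup>2) \<le> ?A"
    by (intro second_moment_le_of_trig[OF X] skorohod_pairing_le[OF sk z t])
       (auto intro!: Bochner_Integration.integral_nonneg simp: second_moment_nonneg)
  then have "ennreal (expectation (\<lambda>\<omega>. (X \<omega>)\<^sup>2)) \<le> ennreal ?A" by (rule ennreal_leI)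
  also have "ennreal ?A = ennreal (LINT p|quadrant. (kern \<beta> z t p * sqrt (second_moment p))\<^sup>2)"
    by (simp add: power_mult_distrib second_moment_nonneg)
  also have "\<dots> = kernel_op \<beta> (\<lambda>p. ennreal ((sqrt (second_moment p))\<^sup>2)) z t"
    by (rule kern_mult_norm[OF z t, where C=1]) (auto simp: second_moment_nonneg)
  finally show ?thesis by (simp add: second_moment_nonneg)
qed

section \<open>Comparison of second moments with the supersolution\<close>

lemma second_moment_decomposition:
  assumes z: "z > 0" and t: "t > 0"
  shows fluctuation_eq: "second_moment (z, t) = (u0 z t)\<^sup>2 + expectation (\<lambda>\<omega>. (u z t \<omega> - u0 z t)\<^sup>2)"
    and fluctuation_le: "ennreal (expectation (\<lambda>\<omega>. (u z t \<omega> - u0 z t)\<^sup>2)) \<le> kernel_op \<beta> (\<lambda>p. ennreal (second_moment p)) z t"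
proof -
  obtain X where sk: "has_skorohod_integral M W (\<lambda>p \<omega>. kern \<beta> z t p * U p \<omega>) X"
    and X: "AE \<omega> in M. u z t \<omega> = u0 z t + X \<omega>" by (rule mild_skorohod[OF z t])
  have XL: "X \<in> L2_space M" using sk by (auto simp: has_skorohod_integral_def)
  have UL: "u z t \<in> L2_space M" using U_L2[of "(z, t)"] z t by (simp add: space_quadrant U_def[abs_def])
  note [measurable] = L2_measurable[OF XL] L2_measurable[OF UL]
  have e: "expectation (\<lambda>\<omega>. (u z t \<omega> - u0 z t)\<^sup>2) = expectation (\<lambda>\<omega>. (X \<omega>)\<^sup>2)"
    by (rule integral_cong_AE) (use X in auto)
  show "ennreal (expectation (\<lambda>\<omega>. (u z t \<omega> - u0 z t)\<^sup>2)) \<le> kernel_op \<beta> (\<lambda>p. ennreal (second_moment p)) z t"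
    unfolding e by (rule skorohod_second_moment_le[OF sk z t])
  have Xi: "integrable M X" using L2_mult_integrable[OF XL, of "\<lambda>_. 1"] by (simp add: L2_space_def)
  \<comment> \<open>The mixed term vanishes because X is centred.\<close>
  have "second_moment (z, t) = expectation (\<lambda>\<omega>. (u0 z t)\<^sup>2 + 2 * u0 z t * X \<omega> + (X \<omega>)\<^sup>2)"
    unfolding second_moment_def U_def
    by (rule integral_cong_AE) (use X in \<open>auto simp: power2_sum\<close>)
  also have "\<dots> = (u0 z t)\<^sup>2 + 2 * u0 z t * expectation X + expectation (\<lambda>\<omega>. (X \<omega>)\<^sup>2)"
    using Xi L2_integrable_sq[OF XL] by (simp add: prob_space)
  finally show "second_moment (z, t) = (u0 z t)\<^sup>2 + expectation (\<lambda>\<omega>. (u z t \<omega> - u0 z t)\<^sup>2)"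
    unfolding e skorohod_mean[OF sk] by simp
qed

text \<open>From u_0 <= 2z/(z+t) comes the source term 4 (z/(z+t))^2. Once C t^\<gamma> <= 1/2, the
  operator maps 8 (z/(z+t))^2 below 4 (z/(z+t))^2, which closes the comparison with the factor
  8.\<close>

lemma second_moment_bound:
  obtains T \<gamma> C where "0 < T" "T < 1" "\<gamma> > 0"
    "\<And>z t. 0 < z \<Longrightarrow> 0 < t \<Longrightarrow> t \<le> T \<Longrightarrow> second_moment (z, t) \<le> 8 * (u0 z t)\<^sup>2"
    "\<And>z t. 0 < z \<Longrightarrow> 0 < t \<Longrightarrow> t \<le> T \<Longrightarrow> expectation (\<lambda>\<omega>. (u z t \<omega> - u0 z t)\<^sup>2) \<le> C * t powr \<gamma> * (u0 z t)\<^sup>2"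
proof -
  define \<gamma> where "\<gamma> = min (2 * \<beta>) (1/2)"
  have \<gamma>: "0 < \<gamma>" "\<gamma> \<le> 1/2" "\<gamma> \<le> 2 * \<beta>" using \<beta>_pos by (auto simp: \<gamma>_def)
  define C where "C = 240000000 / \<gamma>"
  have C: "C > 0" using \<gamma> by (simp add: C_def)
  \<comment> \<open>The second entry is the time at which C t^\<gamma> reaches 1/2; the first
    ensures T < 1.\<close>
  define T where "T = min (1/2) ((1 / (2 * C)) powr (1/\<gamma>))"
  have T: "0 < T" "T < 1" using C by (auto simp: T_def)
  have CT: "C * t powr \<gamma> \<le> 1/2" if "0 < t" "t \<le> T" for t
  proof -
    have "t powr \<gamma> \<le> ((1 / (2 * C)) powr (1/\<gamma>)) powr \<gamma>"
      using that \<gamma> by (intro powr_mono2) (auto simp: T_def)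
    also have "\<dots> = 1 / (2 * C)" using \<gamma> C by (simp add: powr_powr)
    finally show ?thesis using C by (simp add: field_simps)
  qed
  \<comment> \<open>Here \<open>\<nu>\<close> already denotes the square of the profile
    z/(z+t).\<close>
  define \<nu> :: "real \<times> real \<Rightarrow> ennreal" where "\<nu> p = ennreal ((fst p / (fst p + snd p))\<^sup>2)" for p
  have [measurable]: "\<nu> \<in> borel_measurable quadrant" unfolding \<nu>_def[abs_def] by measurable
  let ?m = "\<lambda>p. ennreal (second_moment p)"
  let ?B = "\<lambda>p. ennreal 8 * \<nu> p"
  have KB: "kernel_op \<beta> ?B z t \<le> ennreal (8 * (C * t powr \<gamma>)) * \<nu> (z, t)" if "0 < z" "0 < t" for z t
  proof -
    have "kernel_op \<beta> ?B z t = ennreal 8 * kernel_op \<beta> \<nu> z t" by (rule kernel_op_cmult) measurable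
    also have "\<dots> \<le> ennreal 8 * ennreal (C * t powr \<gamma> * (z / (z + t))\<^sup>2)"
      unfolding \<nu>_def[abs_def] C_def by (intro mult_left_mono kernel_op_profile_le that \<gamma>) auto
    also have "\<dots> = ennreal (8 * (C * t powr \<gamma>)) * \<nu> (z, t)"
    proof -
      have "ennreal 8 * ennreal (C * t powr \<gamma> * (z / (z + t))\<^sup>2) = ennreal (8 * (C * t powr \<gamma>) * (z / (z + t))\<^sup>2)"
        using C by (subst ennreal_mult[symmetric]) (auto simp: mult.assoc)
      also have "\<dots> = ennreal (8 * (C * t powr \<gamma>)) * ennreal ((z / (z + t))\<^sup>2)"
        using C by (intro ennreal_mult) auto
      finally show ?thesis by (simp add: \<nu>_def)
    qed
    finally show ?thesis .
  qed
  have KB4: "kernel_op \<beta> ?B z t \<le> ennreal 4 * \<nu> (z, t)" if "0 < z" "0 < t" "t \<le> T" for z t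
    using CT[OF that(2,3)] by (intro order_trans[OF KB[OF that(1,2)]] mult_right_mono ennreal_leI) auto
  have m_le: "?m (z, t) \<le> ennreal 4 * \<nu> (z, t) + kernel_op \<beta> ?m z t" if "0 < z" "0 < t" for z t
  proof -
    have "(u0 z t)\<^sup>2 \<le> (2 * (z / (z + t)))\<^sup>2"
      using u0_le[OF that] u0_pos[OF that] by (intro power_mono) auto
    then have "(u0 z t)\<^sup>2 \<le> 4 * (z / (z + t))\<^sup>2" by (simp only: power_mult_distrib) simp
    then have "ennreal ((u0 z t)\<^sup>2) \<le> ennreal 4 * \<nu> (z, t)"
      unfolding \<nu>_def by (subst ennreal_mult[symmetric]) (auto intro!: ennreal_leI)
    moreover have "?m (z, t) = ennreal ((u0 z t)\<^sup>2) + ennreal (expectation (\<lambda>\<omega>. (u z t \<omega> - u0 z t)\<^sup>2))"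
      unfolding fluctuation_eq[OF that] by (intro ennreal_plus) auto
    ultimately show ?thesis using fluctuation_le[OF that] by (simp add: add_mono)
  qed
  have m_B: "?m (z, t) \<le> ?B (z, t)" if z: "0 < z" and t: "0 < t" "t \<le> T" for z t
  proof -
    \<comment> \<open>Subtraction in \<open>ennreal\<close> is truncated at 0, so \<open>g\<close>
      is the excess of the second moment over the supersolution. From m <= ?B + g and linearity of
      the operator the excess satisfies g <= K g, so it vanishes by uniqueness.\<close>
    define g where "g p = ?m p - ?B p" for p
    have gm [measurable]: "g \<in> borel_measurable quadrant" unfolding g_def[abs_def] by measurable
    have mB: "?m p \<le> ?B p + g p" for p using ennreal_minus_le_iff[of "?m p" "?B p" "g p"] by (simp add: g_def)
    have "g (z, t) = 0"
    proof (rule kernel_gronwall[OF \<beta>_pos T(1) gm _ _ z t, where K=1])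
      have "kernel_op \<beta> g 1 (7 * T) \<le> kernel_op \<beta> ?m 1 (7 * T)"
        by (rule kernel_op_mono) (simp add: g_def diff_le_self_ennreal)
      also have "\<dots> < \<infinity>" using T by (intro kernel_op_second_moment_finite) auto
      finally show "kernel_op \<beta> g 1 (7 * T) < \<infinity>" .
      fix z t :: real assume zt: "0 < z" "0 < t" "t \<le> T"
      have "?m (z, t) \<le> ennreal 4 * \<nu> (z, t) + kernel_op \<beta> ?m z t" by (rule m_le[OF zt(1,2)])
      also have "kernel_op \<beta> ?m z t \<le> kernel_op \<beta> (\<lambda>p. ?B p + g p) z t" by (rule kernel_op_mono) (rule mB)
      also have "\<dots> = kernel_op \<beta> ?B z t + kernel_op \<beta> g z t" by (rule kernel_op_add) measurable
      also have "\<dots> \<le> ennreal 4 * \<nu> (z, t) + kernel_op \<beta> g z t" using KB4[OF zt] by (rule add_right_mono)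
      also have "ennreal 4 * \<nu> (z, t) + (ennreal 4 * \<nu> (z, t) + kernel_op \<beta> g z t) = ?B (z, t) + kernel_op \<beta> g z t"
      proof -
        have "ennreal 8 = ennreal 4 + ennreal 4" by (simp flip: ennreal_plus)
        then show ?thesis by (simp only: distrib_right add.assoc)
      qed
      finally have "?m (z, t) \<le> ?B (z, t) + kernel_op \<beta> g z t" by (simp add: add_left_mono)
      then show "g (z, t) \<le> ennreal 1 * kernel_op \<beta> g z t"
        unfolding g_def by (simp add: ennreal_minus_le_iff)
    qed
    then show ?thesis using mB[of "(z, t)"] by simp
  qed
  show ?thesis
  proof (rule that[OF T \<gamma>(1)])
    fix z t :: real assume zt: "0 < z" "0 < t" "t \<le> T"
    have v: "(z / (z + t))\<^sup>2 \<le> (u0 z t)\<^sup>2" using u0_ge[OF zt(1,2)] zt by (intro power_mono) auto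
    have "ennreal (second_moment (z, t)) \<le> ennreal (8 * (z / (z + t))\<^sup>2)"
      using m_B[OF zt] by (subst ennreal_mult) (auto simp: \<nu>_def)
    then have "second_moment (z, t) \<le> 8 * (z / (z + t))\<^sup>2" by (subst (asm) ennreal_le_iff) auto
    then show "second_moment (z, t) \<le> 8 * (u0 z t)\<^sup>2" using v by linarith
    \<comment> \<open>Feeding the bound on the second moment back into the inequality gains the
      factor t^\<gamma>, which drives the limit at time 0.\<close>
    have "ennreal (expectation (\<lambda>\<omega>. (u z t \<omega> - u0 z t)\<^sup>2)) \<le> kernel_op \<beta> ?m z t" by (rule fluctuation_le[OF zt(1,2)])
    also have "\<dots> \<le> kernel_op \<beta> ?B z t" using zt by (intro kernel_op_mono m_B) auto
    also have "\<dots> \<le> ennreal (8 * (C * t powr \<gamma>)) * \<nu> (z, t)" by (rule KB[OF zt(1,2)])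
    also have "\<dots> = ennreal (8 * (C * t powr \<gamma>) * (z / (z + t))\<^sup>2)"
      unfolding \<nu>_def using C by (subst ennreal_mult) auto
    finally have "expectation (\<lambda>\<omega>. (u z t \<omega> - u0 z t)\<^sup>2) \<le> 8 * (C * t powr \<gamma>) * (z / (z + t))\<^sup>2"
      using C by (subst (asm) ennreal_le_iff) auto
    also have "\<dots> \<le> 8 * (C * t powr \<gamma>) * (u0 z t)\<^sup>2" using C v by (intro mult_left_mono) auto
    finally show "expectation (\<lambda>\<omega>. (u z t \<omega> - u0 z t)\<^sup>2) \<le> (8 * C) * t powr \<gamma> * (u0 z t)\<^sup>2" by simp
  qed
qed

end

theorem theorem3p3:
  fixes M :: "'w measure"
    and W :: "(real \<times> real \<Rightarrow> real) \<Rightarrow> 'w \<Rightarrow> real"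
    and u :: "real \<Rightarrow> real \<Rightarrow> 'w \<Rightarrow> real"
    and \<beta> :: real
  assumes "\<beta> > 0"
    and "space_time_white_noise M W"
    and "mild_solution M W \<beta> u"
  shows "(\<exists>T. 0 < T \<and> T < 1 \<and>
            (\<forall>t\<in>{0..T}. \<exists>C>0.
               (SUP z\<in>{0<..}. \<integral>\<^sup>+ \<omega>. ennreal ((u z t \<omega> / u0 z t)\<^sup>2) \<partial>M) < ennreal C))
       \<and> (\<forall>z>0. ((\<lambda>t. \<integral>\<^sup>+ \<omega>. ennreal ((u z t \<omega> / u0 z t - 1)\<^sup>2) \<partial>M) \<longlongrightarrow> 0) (at_right 0))"
proof -
  interpret mild_noise M W \<beta> u
    using assms
    by (auto simp: mild_noise_def white_noise_def space_time_white_noise_def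
        white_noise_axioms_def mild_noise_axioms_def)
  obtain T \<gamma> C where T: "0 < T" "T < 1" and \<gamma>: "\<gamma> > 0"
    and m: "\<And>z t. 0 < z \<Longrightarrow> 0 < t \<Longrightarrow> t \<le> T \<Longrightarrow> second_moment (z, t) \<le> 8 * (u0 z t)\<^sup>2"
    and f: "\<And>z t. 0 < z \<Longrightarrow> 0 < t \<Longrightarrow> t \<le> T \<Longrightarrow>
      expectation (\<lambda>\<omega>. (u z t \<omega> - u0 z t)\<^sup>2) \<le> C * t powr \<gamma> * (u0 z t)\<^sup>2"
    by (rule second_moment_bound) blast
  have uL: "u z t \<in> L2_space M" if "z > 0" "t > 0" for z t
    using assms(3) that by (simp add: mild_solution_def)
  \<comment> \<open>At t = 0 both u and u_0 are 1 almost surely, so the same bound covers the left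
    end of the time interval.\<close>
  have A: "(\<integral>\<^sup>+ \<omega>. ennreal ((u z t \<omega> / u0 z t)\<^sup>2) \<partial>M) \<le> 8" if z: "z > 0" and t: "0 \<le> t" "t \<le> T" for z t
  proof (cases "t = 0")
    case True
    have "AE \<omega> in M. u z 0 \<omega> = 1" using assms(3) z by (simp add: mild_solution_def)
    then have "(\<integral>\<^sup>+ \<omega>. ennreal ((u z t \<omega> / u0 z t)\<^sup>2) \<partial>M) = (\<integral>\<^sup>+ \<omega>. 1 \<partial>M)"
      by (intro nn_integral_cong_AE) (auto simp: True u0_def)
    then show ?thesis by (simp add: emeasure_space_1)
  next
    case False
    then have t0: "t > 0" using t by simp
    have p: "u0 z t > 0" by (rule u0_pos[OF z t0])
    have "(\<integral>\<^sup>+ \<omega>. ennreal ((u z t \<omega> / u0 z t)\<^sup>2) \<partial>M) = ennreal (expectation (\<lambda>\<omega>. (u z t \<omega> / u0 z t)\<^sup>2))"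
      using L2_integrable_sq[OF uL[OF z t0]] by (intro nn_integral_eq_integral) (auto simp: power_divide)
    also have "expectation (\<lambda>\<omega>. (u z t \<omega> / u0 z t)\<^sup>2) = second_moment (z, t) / (u0 z t)\<^sup>2"
      by (simp add: power_divide second_moment_def U_def)
    also have "\<dots> \<le> 8" using m[OF z t0 t(2)] p by (simp add: divide_simps)
    finally show ?thesis by (simp add: ennreal_leI)
  qed
  \<comment> \<open>The supremum is at most 8; the value 9 leaves room for the strict
    inequality.\<close>
  have "(SUP z\<in>{0<..}. \<integral>\<^sup>+ \<omega>. ennreal ((u z t \<omega> / u0 z t)\<^sup>2) \<partial>M) < ennreal 9" if "t \<in> {0..T}" for t
  proof -
    have "(SUP z\<in>{0<..}. \<integral>\<^sup>+ \<omega>. ennreal ((u z t \<omega> / u0 z t)\<^sup>2) \<partial>M) \<le> 8"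
      using that A by (intro SUP_least) auto
    also have "(8::ennreal) < ennreal 9" by simp
    finally show ?thesis .
  qed
  then have 1: "\<forall>t\<in>{0..T}. \<exists>C>0. (SUP z\<in>{0<..}. \<integral>\<^sup>+ \<omega>. ennreal ((u z t \<omega> / u0 z t)\<^sup>2) \<partial>M) < ennreal C"
    by (intro ballI exI[of _ 9]) auto
  have 2: "((\<lambda>t. \<integral>\<^sup>+ \<omega>. ennreal ((u z t \<omega> / u0 z t - 1)\<^sup>2) \<partial>M) \<longlongrightarrow> 0) (at_right 0)" if z: "z > 0" for z
  proof (rule tendsto_sandwich[OF _ _ tendsto_const])
    show "\<forall>\<^sub>F t in at_right 0. (\<integral>\<^sup>+ \<omega>. ennreal ((u z t \<omega> / u0 z t - 1)\<^sup>2) \<partial>M) \<le> ennreal (C * t powr \<gamma>)"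
      unfolding eventually_at_right_field
    proof (intro exI[of _ T] conjI T allI impI)
      fix t :: real assume t: "0 < t" "t < T"
      have p: "u0 z t > 0" by (rule u0_pos[OF z t(1)])
      \<comment> \<open>With this form the fluctuation bound, which is relative to u_0^2, becomes
        the bound C t^\<gamma>, free of z.\<close>
      have e: "u z t \<omega> / u0 z t - 1 = (u z t \<omega> - u0 z t) / u0 z t" for \<omega> using p by (simp add: field_simps)
      have L: "(\<lambda>\<omega>. u z t \<omega> - u0 z t) \<in> L2_space M"
        using L2_diff[OF uL[OF z t(1)], of "\<lambda>_. u0 z t"] by (simp add: L2_space_def)
      have "(\<integral>\<^sup>+ \<omega>. ennreal ((u z t \<omega> / u0 z t - 1)\<^sup>2) \<partial>M) = ennreal (expectation (\<lambda>\<omega>. ((u z t \<omega> - u0 z t) / u0 z t)\<^sup>2))"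
        unfolding e using L2_integrable_sq[OF L] by (intro nn_integral_eq_integral) (auto simp: power_divide)
      also have "expectation (\<lambda>\<omega>. ((u z t \<omega> - u0 z t) / u0 z t)\<^sup>2) = expectation (\<lambda>\<omega>. (u z t \<omega> - u0 z t)\<^sup>2) / (u0 z t)\<^sup>2"
        by (simp add: power_divide)
      also have "\<dots> \<le> C * t powr \<gamma>" using f[OF z t(1)] t p by (simp add: divide_simps)
      finally show "(\<integral>\<^sup>+ \<omega>. ennreal ((u z t \<omega> / u0 z t - 1)\<^sup>2) \<partial>M) \<le> ennreal (C * t powr \<gamma>)"
        by (simp add: ennreal_leI)
    qed
    have "((\<lambda>t. t powr \<gamma>) \<longlongrightarrow> 0 powr \<gamma>) (at_right 0)"
      by (rule tendsto_powr') (use \<gamma> in \<open>auto simp: eventually_at_right_field intro!: exI[of _ 1] tendsto_ident_at\<close>)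
    then have "((\<lambda>t. C * t powr \<gamma>) \<longlongrightarrow> C * 0) (at_right 0)" by (intro tendsto_mult_left) simp
    then have "((\<lambda>t. ennreal (C * t powr \<gamma>)) \<longlongrightarrow> ennreal (C * 0)) (at_right 0)" by (rule tendsto_ennrealI)
    then show "((\<lambda>t. ennreal (C * t powr \<gamma>)) \<longlongrightarrow> 0) (at_right 0)" by simp
  qed auto
  show ?thesis using T 1 2 by blast
qed

end
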